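(* Let $G=\mathbb F_d*G_1*\cdots*G_m$ with generating set $S$, and let $(Y_n)_{n\ge0}$ be a nearest-neighbour quasi-irreducible coloured random walk on $G\times[r]$ defined by a family of matrices $(p_g)_{g\in S}$. Let $\pi$ be the unique invariant probability measure of the stochastic matrix $P=\sum_gp_g$. Then the drift $\gamma$ and entropy $h$ of $(Y_n)_{n\ge0}$ are given by $$\gamma=\sum_{g\in S}\ \sum_{u,v,w\in[r]}\pi(u)\,p_g(u,v)\Big(-\mu_{g^{-1}}(v,w)+\sum_{h\in\mathrm{Next}(g)}\mu_h(v,w)\Big)$$ and $$h=-\sum_{\substack{g\in G\\ u,v\in[r]}}\pi(u)\,p_g(u,v)\int_{\partial G}\log\Big(\frac{d\,g^{-1}p^\infty_u}{d\,p^\infty_v}\Big)\,d p^\infty_v .$$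
   Context: Group: $\mathbb F_d$ is the free group on $a_1,\dots,a_d$; $G_1,\dots,G_m$ are finite groups; $G=\mathbb F_d*G_1*\cdots*G_m$ has identity $e$ and generating set $S=\bigcup_{i=1}^d\{a_i,a_i^{-1}\}\cup\bigsqcup_{j=1}^m S_j$ with $S_j=G_j\setminus\{e\}$. $G$ is assumed not isomorphic to $\mathbb Z$ or $\mathbb Z/2\mathbb Z*\mathbb Z/2\mathbb Z$. For $g\in S$, $\mathrm{Next}(g)=S\setminus\{g^{-1}\}$ if $g\in\mathbb F_d$, and $\mathrm{Next}(g)=S\setminus S_j$ if $g\in S_j$. Every $g\in G$ is uniquely a reduced word $g_1\cdots g_n$ with $g_i\in S$, $g_{i+1}\in\mathrm{Next}(g_i)$. Coloured random walk: $[r]=\{1,\dots,r\}$; $(p_g)_{g\in G}$ are $r\times r$ matrices with non-negative entries such that $P=\sum_gp_g$ is stochastic; $(Y_n)$ is the Markov chain on $G\times[r]$ with transition probability $p_{g^{-1}h}(u,v)$ from $(g,u)$ to $(h,v)$. Its support is $\{g:p_g\neq0\}$; nearest-neighbour means support contained in $S$; quasi-irreducible means that the support generates $G$ and $P$ is irreducible. Drift and entropy: $|(g,u)|=|g|=\min\{k:g=s_1\cdots s_k,\ s_i\in S\}$; with $\mathcal P$ the transition kernel and $Y_0=(e,u)$, $\gamma=\lim_n|Y_n|/n$ and $h=\lim_n-\frac1n\log\mathcal P^n((e,u),Y_n)$, limits which exist a.s. and in $L^1$. Boundary and harmonic measure: $\partial G$ is the set of infinite words $\xi_1\xi_2\cdots$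 with $\xi_i\in S$, $\xi_{i+1}\in\mathrm{Next}(\xi_i)$, with the product topology and $\sigma$-algebra; $G$ acts on it by left multiplication followed by reduction, and $g\nu=g\cdot\nu$ denotes the image of a measure $\nu$ under $\xi\mapsto g\xi$. Taken as given (stated separately in the paper): the $G$-coordinate of $Y_n$ converges a.s. to a random variable $Y_\infty\in\partial G$; its law when $Y_0=(e,u)$ is the harmonic measure $p^\infty_u$, and $(p^\infty_u)_{u\in[r]}$ is the unique family of probability measures on $\partial G$ with $p^\infty_u=\sum_{g,v}p_g(u,v)\,g\cdot p^\infty_v$ for all $u$. For $g\in S$, $\mu_g(u,v)$ is the probability, when $Y_0=(e,u)$, that the first letter of $Y_\infty$ is $g$ and that the walk has colour $v$ at the time of its first visit to $\{g\}\times[r]$. *)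

theory Defs
  imports "HOL-Probability.Probability" "HOL-Algebra.Elementary_Groups"
begin

section \<open>The free product of a free group and finite groups\<close>

text \<open>
  The free product of the free group on \<open>d\<close> generators with \<open>Gs 0, \<dots>, Gs (m - 1)\<close> is
  modelled by its reduced words.  A letter is \<open>a\<^sub>i\<close> (\<open>Gen i\<close>), its inverse (\<open>GenInv i\<close>), or a
  non-neutral element \<open>x\<close> of the \<open>j\<close>-th group (\<open>Fac j x\<close>); indices start at \<open>0\<close>.
  All factors live on one type \<open>'a\<close>, which costs no generality, every finite group having an
  isomorphic copy on, say, \<open>nat\<close>.
\<close>

datatype 'a letter = Gen nat | GenInv nat | Fac nat 'a

definition factor_letters :: "(nat \<Rightarrow> 'a monoid) \<Rightarrow> nat \<Rightarrow> 'a letter set" where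
  "factor_letters Gs j = Fac j ` (carrier (Gs j) - {\<one>\<^bsub>Gs j\<^esub>})"

definition letters :: "nat \<Rightarrow> nat \<Rightarrow> (nat \<Rightarrow> 'a monoid) \<Rightarrow> 'a letter set" where
  "letters d m Gs = (\<Union>i<d. {Gen i, GenInv i}) \<union> (\<Union>j<m. factor_letters Gs j)"

primrec letter_inv :: "(nat \<Rightarrow> 'a monoid) \<Rightarrow> 'a letter \<Rightarrow> 'a letter" where
  "letter_inv Gs (Gen i) = GenInv i"
| "letter_inv Gs (GenInv i) = Gen i"
| "letter_inv Gs (Fac j x) = Fac j (inv\<^bsub>Gs j\<^esub> x)"

definition next_letters :: "nat \<Rightarrow> nat \<Rightarrow> (nat \<Rightarrow> 'a monoid) \<Rightarrow> 'a letter \<Rightarrow> 'a letter set" where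
  "next_letters d m Gs s =
     (case s of Fac j x \<Rightarrow> letters d m Gs - factor_letters Gs j
              | _ \<Rightarrow> letters d m Gs - {letter_inv Gs s})"

definition reduced_words :: "nat \<Rightarrow> nat \<Rightarrow> (nat \<Rightarrow> 'a monoid) \<Rightarrow> 'a letter list set" where
  "reduced_words d m Gs =
     {w. set w \<subseteq> letters d m Gs \<and> successively (\<lambda>s t. t \<in> next_letters d m Gs s) w}"

text \<open>
  The reduced word of a product of two letters.  If \<open>t\<close> may not follow \<open>s\<close> then either
  \<open>t = s\<inverse>\<close>, or \<open>s\<close> and \<open>t\<close> lie in the same finite factor and are multiplied there.
\<close>

definition letter_prod ::
    "nat \<Rightarrow> nat \<Rightarrow> (nat \<Rightarrow> 'a monoid) \<Rightarrow> 'a letter \<Rightarrow> 'a letter \<Rightarrow> 'a letter list" where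
  "letter_prod d m Gs s t =
     (if t \<in> next_letters d m Gs s then [s, t]
      else if t = letter_inv Gs s then []
      else (case (s, t) of (Fac j x, Fac k y) \<Rightarrow> [Fac j (x \<otimes>\<^bsub>Gs j\<^esub> y)] | _ \<Rightarrow> []))"

definition letter_mult_word ::
    "nat \<Rightarrow> nat \<Rightarrow> (nat \<Rightarrow> 'a monoid) \<Rightarrow> 'a letter \<Rightarrow> 'a letter list \<Rightarrow> 'a letter list" where
  "letter_mult_word d m Gs s w =
     (case w of [] \<Rightarrow> [s] | t # w' \<Rightarrow> letter_prod d m Gs s t @ w')"

definition free_prod :: "nat \<Rightarrow> nat \<Rightarrow> (nat \<Rightarrow> 'a monoid) \<Rightarrow> 'a letter list monoid" where
  "free_prod d m Gs =
     \<lparr>carrier = reduced_words d m Gs, mult = foldr (letter_mult_word d m Gs), one = []\<rparr>"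

text \<open>The letter \<open>s\<close> is the group element \<open>[s]\<close>.\<close>

definition generators :: "nat \<Rightarrow> nat \<Rightarrow> (nat \<Rightarrow> 'a monoid) \<Rightarrow> 'a letter list set" where
  "generators d m Gs = (\<lambda>s. [s]) ` letters d m Gs"

definition word_length :: "('g, 'b) monoid_scheme \<Rightarrow> 'g set \<Rightarrow> 'g \<Rightarrow> nat" where
  "word_length G T g =
     (LEAST k. \<exists>ss. length ss = k \<and> set ss \<subseteq> T \<and> g = foldr (\<otimes>\<^bsub>G\<^esub>) ss \<one>\<^bsub>G\<^esub>)"


section \<open>The boundary\<close>

definition boundary_set :: "nat \<Rightarrow> nat \<Rightarrow> (nat \<Rightarrow> 'a monoid) \<Rightarrow> 'a letter stream set" where
  "boundary_set d m Gs =
     {\<xi>. \<forall>i. \<xi> !! i \<in> letters d m Gs \<and> \<xi> !! Suc i \<in> next_letters d m Gs (\<xi> !! i)}"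

definition boundary :: "nat \<Rightarrow> nat \<Rightarrow> (nat \<Rightarrow> 'a monoid) \<Rightarrow> 'a letter stream measure" where
  "boundary d m Gs =
     restrict_space (stream_space (count_space (letters d m Gs))) (boundary_set d m Gs)"

definition letter_act ::
    "nat \<Rightarrow> nat \<Rightarrow> (nat \<Rightarrow> 'a monoid) \<Rightarrow> 'a letter \<Rightarrow> 'a letter stream \<Rightarrow> 'a letter stream" where
  "letter_act d m Gs s \<xi> = letter_prod d m Gs s (shd \<xi>) @- stl \<xi>"

definition boundary_act ::
    "nat \<Rightarrow> nat \<Rightarrow> (nat \<Rightarrow> 'a monoid) \<Rightarrow> 'a letter list \<Rightarrow> 'a letter stream \<Rightarrow> 'a letter stream" where
  "boundary_act d m Gs g \<xi> = foldr (letter_act d m Gs) g \<xi>"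

definition act_measure ::
    "nat \<Rightarrow> nat \<Rightarrow> (nat \<Rightarrow> 'a monoid) \<Rightarrow> 'a letter list \<Rightarrow> 'a letter stream measure
       \<Rightarrow> 'a letter stream measure" where
  "act_measure d m Gs g \<nu> = distr \<nu> (boundary d m Gs) (boundary_act d m Gs g)"

text \<open>Convergence of a sequence of reduced words to an infinite word: every prefix stabilises.\<close>

definition words_tendsto :: "(nat \<Rightarrow> 'l list) \<Rightarrow> 'l stream \<Rightarrow> bool" where
  "words_tendsto w \<xi> \<longleftrightarrow> (\<forall>k. \<forall>\<^sub>F n in sequentially. take k (w n) = stake k \<xi>)"


section \<open>Coloured random walks\<close>

definition stochastic_matrix :: "real^'r^'r \<Rightarrow> bool" where
  "stochastic_matrix P \<longleftrightarrow> (\<forall>u v. 0 \<le> P $ u $ v) \<and> (\<forall>u. (\<Sum>v\<in>UNIV. P $ u $ v) = 1)"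

definition irreducible_matrix :: "real^'r^'r \<Rightarrow> bool" where
  "irreducible_matrix P \<longleftrightarrow> (\<forall>u v. \<exists>n. 0 < (((**) P) ^^ n) (mat 1) $ u $ v)"

definition invariant_prob :: "real^'r^'r \<Rightarrow> real^'r \<Rightarrow> bool" where
  "invariant_prob P \<pi> \<longleftrightarrow> (\<forall>u. 0 \<le> \<pi> $ u) \<and> (\<Sum>u\<in>UNIV. \<pi> $ u) = 1 \<and> \<pi> v* P = \<pi>"

definition colour_matrix ::
    "('g, 'b) monoid_scheme \<Rightarrow> ('g \<Rightarrow> real^'r^'r) \<Rightarrow> real^'r^'r" where
  "colour_matrix G p = (\<Sum>\<^sub>\<infinity>g\<in>carrier G. p g)"

definition colour_family :: "('g, 'b) monoid_scheme \<Rightarrow> ('g \<Rightarrow> real^'r^'r) \<Rightarrow> bool" where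
  "colour_family G p \<longleftrightarrow>
     (\<forall>g\<in>carrier G. \<forall>u v. 0 \<le> p g $ u $ v) \<and>
     p summable_on carrier G \<and> stochastic_matrix (colour_matrix G p)"

definition walk_support :: "('g, 'b) monoid_scheme \<Rightarrow> ('g \<Rightarrow> real^'r^'r) \<Rightarrow> 'g set" where
  "walk_support G p = {g \<in> carrier G. p g \<noteq> 0}"

definition quasi_irreducible :: "('g, 'b) monoid_scheme \<Rightarrow> ('g \<Rightarrow> real^'r^'r) \<Rightarrow> bool" where
  "quasi_irreducible G p \<longleftrightarrow>
     generate G (walk_support G p) = carrier G \<and> irreducible_matrix (colour_matrix G p)"

definition states :: "('g, 'b) monoid_scheme \<Rightarrow> ('g \<times> 'r) set" where
  "states G = carrier G \<times> UNIV"

definition walk_kernel ::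
    "('g, 'b) monoid_scheme \<Rightarrow> ('g \<Rightarrow> real^'r^'r) \<Rightarrow> 'g \<times> 'r \<Rightarrow> 'g \<times> 'r \<Rightarrow> real" where
  "walk_kernel G p x y = p (inv\<^bsub>G\<^esub> (fst x) \<otimes>\<^bsub>G\<^esub> fst y) $ snd x $ snd y"

primrec kernel_pow :: "'x set \<Rightarrow> ('x \<Rightarrow> 'x \<Rightarrow> real) \<Rightarrow> nat \<Rightarrow> 'x \<Rightarrow> 'x \<Rightarrow> real" where
  "kernel_pow X K 0 x y = (if x = y then 1 else 0)"
| "kernel_pow X K (Suc n) x y = (\<Sum>\<^sub>\<infinity>z\<in>X. K x z * kernel_pow X K n z y)"

text \<open>\<open>Y\<close> is, under \<open>M\<close>, a Markov chain on the countable set \<open>X\<close> with kernel \<open>K\<close> and start \<open>x0\<close>.\<close>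

definition markov_chain ::
    "'w measure \<Rightarrow> (nat \<Rightarrow> 'w \<Rightarrow> 'x) \<Rightarrow> 'x set \<Rightarrow> ('x \<Rightarrow> 'x \<Rightarrow> real) \<Rightarrow> 'x \<Rightarrow> bool" where
  "markov_chain M Y X K x0 \<longleftrightarrow>
     prob_space M \<and>
     (\<forall>n. Y n \<in> measurable M (count_space X)) \<and>
     (\<forall>n. \<forall>x. (\<forall>i. x i \<in> X) \<longrightarrow>
        measure M {\<omega> \<in> space M. \<forall>i\<le>n. Y i \<omega> = x i} =
          (if x 0 = x0 then 1 else 0) * (\<Prod>i<n. K (x i) (x (Suc i))))"

text \<open>A family of laws, indexed by the initial colour \<open>u\<close>; under \<open>M u\<close> the walk starts at \<open>(e, u)\<close>.\<close>

definition coloured_walk ::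
    "('g, 'b) monoid_scheme \<Rightarrow> ('g \<Rightarrow> real^'r^'r) \<Rightarrow> ('r \<Rightarrow> 'w measure)
       \<Rightarrow> (nat \<Rightarrow> 'w \<Rightarrow> 'g \<times> 'r) \<Rightarrow> bool" where
  "coloured_walk G p M Y \<longleftrightarrow>
     (\<forall>u. markov_chain (M u) Y (states G) (walk_kernel G p) (\<one>\<^bsub>G\<^esub>, u))"

definition tendsto_as_L1 :: "'w measure \<Rightarrow> (nat \<Rightarrow> 'w \<Rightarrow> real) \<Rightarrow> real \<Rightarrow> bool" where
  "tendsto_as_L1 M Z c \<longleftrightarrow>
     (AE \<omega> in M. (\<lambda>n. Z n \<omega>) \<longlonglongrightarrow> c) \<and>
     (\<lambda>n. \<integral>\<^sup>+\<omega>. ennreal \<bar>Z n \<omega> - c\<bar> \<partial>M) \<longlonglongrightarrow> 0"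

definition is_drift ::
    "('g, 'b) monoid_scheme \<Rightarrow> 'g set \<Rightarrow> ('r \<Rightarrow> 'w measure) \<Rightarrow> (nat \<Rightarrow> 'w \<Rightarrow> 'g \<times> 'r)
       \<Rightarrow> real \<Rightarrow> bool" where
  "is_drift G T M Y \<gamma> \<longleftrightarrow>
     (\<forall>u. tendsto_as_L1 (M u) (\<lambda>n \<omega>. real (word_length G T (fst (Y n \<omega>))) / real n) \<gamma>)"

definition is_entropy ::
    "('g, 'b) monoid_scheme \<Rightarrow> ('g \<Rightarrow> real^'r^'r) \<Rightarrow> ('r \<Rightarrow> 'w measure)
       \<Rightarrow> (nat \<Rightarrow> 'w \<Rightarrow> 'g \<times> 'r) \<Rightarrow> real \<Rightarrow> bool" where
  "is_entropy G p M Y h \<longleftrightarrow>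
     (\<forall>u. tendsto_as_L1 (M u)
        (\<lambda>n \<omega>. - (1 / real n) *
           ln (kernel_pow (states G) (walk_kernel G p) n (\<one>\<^bsub>G\<^esub>, u) (Y n \<omega>))) h)"


section \<open>Harmonic measure\<close>

definition is_boundary_limit ::
    "nat \<Rightarrow> nat \<Rightarrow> (nat \<Rightarrow> 'a monoid) \<Rightarrow> ('r \<Rightarrow> 'w measure)
       \<Rightarrow> (nat \<Rightarrow> 'w \<Rightarrow> 'a letter list \<times> 'r) \<Rightarrow> ('w \<Rightarrow> 'a letter stream) \<Rightarrow> bool" where
  "is_boundary_limit d m Gs M Y Yinf \<longleftrightarrow>
     (\<forall>u. Yinf \<in> measurable (M u) (boundary d m Gs) \<and>
          (AE \<omega> in M u. words_tendsto (\<lambda>n. fst (Y n \<omega>)) (Yinf \<omega>)))"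

definition harmonic_measure ::
    "nat \<Rightarrow> nat \<Rightarrow> (nat \<Rightarrow> 'a monoid) \<Rightarrow> ('r \<Rightarrow> 'w measure) \<Rightarrow> ('w \<Rightarrow> 'a letter stream)
       \<Rightarrow> 'r \<Rightarrow> 'a letter stream measure" where
  "harmonic_measure d m Gs M Yinf u = distr (M u) (boundary d m Gs) Yinf"

definition first_letter_prob ::
    "('r \<Rightarrow> 'w measure) \<Rightarrow> (nat \<Rightarrow> 'w \<Rightarrow> 'a letter list \<times> 'r) \<Rightarrow> ('w \<Rightarrow> 'a letter stream)
       \<Rightarrow> 'a letter \<Rightarrow> 'r \<Rightarrow> 'r \<Rightarrow> real" where
  "first_letter_prob M Y Yinf s u v =
     measure (M u) {\<omega> \<in> space (M u). shd (Yinf \<omega>) = s \<and>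
       (\<exists>n. Y n \<omega> = ([s], v) \<and> (\<forall>k<n. fst (Y k \<omega>) \<noteq> [s]))}"

text \<open>
  The derivative \<open>d\<nu>/d\<mu>\<close> in the sense of the Lebesgue decomposition, i.e. the density of the
  part of \<open>\<nu>\<close> that is absolutely continuous with respect to \<open>\<mu>\<close>.  The constant
  \<^const>\<open>RN_deriv\<close> is not suitable: it is the zero function unless \<open>\<nu>\<close> is absolutely
  continuous with respect to \<open>\<mu>\<close>, and \<open>g\<inverse>p\<^sup>\<infinity>\<^sub>u\<close> need not be so with respect to \<open>p\<^sup>\<infinity>\<^sub>v\<close>
  (walk by uniform steps in \<open>{a, a\<inverse>}\<close> and in \<open>{b, b\<inverse>}\<close> alternately, switching colour at each step).
\<close>

definition is_lebesgue_deriv :: "'x measure \<Rightarrow> 'x measure \<Rightarrow> ('x \<Rightarrow> ennreal) \<Rightarrow> bool" where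
  "is_lebesgue_deriv \<mu> \<nu> f \<longleftrightarrow>
     f \<in> borel_measurable \<mu> \<and>
     (\<exists>N\<in>null_sets \<mu>. \<forall>A\<in>sets \<mu>.
        emeasure \<nu> A = emeasure (density \<mu> f) A + emeasure \<nu> (A \<inter> N))"

definition lebesgue_deriv :: "'x measure \<Rightarrow> 'x measure \<Rightarrow> 'x \<Rightarrow> ennreal" where
  "lebesgue_deriv \<mu> \<nu> = (SOME f. is_lebesgue_deriv \<mu> \<nu> f)"

lemma is_lebesgue_deriv_RN_deriv:
  assumes "sigma_finite_measure \<mu>" "absolutely_continuous \<mu> \<nu>" "sets \<nu> = sets \<mu>"
  shows "is_lebesgue_deriv \<mu> \<nu> (RN_deriv \<mu> \<nu>)"
  unfolding is_lebesgue_deriv_def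
  using sigma_finite_measure.density_RN_deriv[OF assms] by (auto intro!: bexI[of _ "{}"])

lemma is_lebesgue_deriv_lebesgue_deriv:
  assumes "finite_measure \<mu>" "finite_measure \<nu>" and sets: "sets \<nu> = sets \<mu>"
  shows "is_lebesgue_deriv \<mu> \<nu> (lebesgue_deriv \<mu> \<nu>)"
proof -
  interpret m: finite_measure \<mu> by fact
  interpret n: finite_measure \<nu> by fact
  define c where "c = Sup (emeasure \<nu> ` null_sets \<mu>)"
  have "\<exists>F. range F \<subseteq> emeasure \<nu> ` null_sets \<mu> \<and> c = (SUP i::nat. F i)"
    unfolding c_def by (rule ennreal_SUP_countable_SUP) auto
  then obtain F where F: "range F \<subseteq> emeasure \<nu> ` null_sets \<mu>" "c = (SUP i::nat. F i)" by blast
  then have "\<forall>i. \<exists>N. N \<in> null_sets \<mu> \<and> F i = emeasure \<nu> N" by blast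
  then obtain Ns where Ns: "\<And>i. Ns i \<in> null_sets \<mu>" "\<And>i. F i = emeasure \<nu> (Ns i)" by metis
  define N where "N = (\<Union>i. Ns i)"
  have N: "N \<in> null_sets \<mu>" unfolding N_def using Ns(1) by (rule null_sets_UN)
  then have N_sets: "N \<in> sets \<nu>" using sets by auto
  have c_le: "c \<le> emeasure \<nu> N"
    unfolding F(2) Ns(2) using N_sets by (intro SUP_least emeasure_mono) (auto simp: N_def)
  define \<nu>' where "\<nu>' = density \<nu> (indicator (space \<nu> - N))"
  have sets': "sets \<nu>' = sets \<mu>" by (simp add: \<nu>'_def sets)
  have \<nu>': "emeasure \<nu>' A = emeasure \<nu> (A - N)" if "A \<in> sets \<mu>" for A
  proof -
    have A: "A \<in> sets \<nu>" using that sets by simp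
    then have "emeasure \<nu>' A = emeasure \<nu> ((space \<nu> - N) \<inter> A)"
      unfolding \<nu>'_def using N_sets by (subst emeasure_density) (auto simp flip: indicator_inter_arith)
    also have "(space \<nu> - N) \<inter> A = A - N" using sets.sets_into_space[OF A] by auto
    finally show ?thesis .
  qed
  have "absolutely_continuous \<mu> \<nu>'"
    unfolding absolutely_continuous_def
  proof
    fix A assume A: "A \<in> null_sets \<mu>"
    have "emeasure \<nu> N + emeasure \<nu> (A - N) = emeasure \<nu> (N \<union> A)"
      using A N_sets sets by (subst plus_emeasure) (auto intro: arg_cong)
    also have "\<dots> \<le> c" unfolding c_def using A N by (intro SUP_upper) auto
    also have "\<dots> \<le> emeasure \<nu> N" by (rule c_le)
    finally have "emeasure \<nu> (A - N) = 0"
      using n.emeasure_finite[of N] by (cases "emeasure \<nu> N"; cases "emeasure \<nu> (A - N)") (auto simp flip: ennreal_plus)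
    then show "A \<in> null_sets \<nu>'" using \<nu>'[of A] A sets' by (simp add: null_sets_def)
  qed
  then obtain f where f: "f \<in> borel_measurable \<mu>" "density \<mu> f = \<nu>'"
    using m.Radon_Nikodym sets' by blast
  have "emeasure \<nu> A = emeasure (density \<mu> f) A + emeasure \<nu> (A \<inter> N)" if "A \<in> sets \<mu>" for A
    using that N_sets sets unfolding f(2) \<nu>'[OF that]
    by (subst plus_emeasure) (auto intro: arg_cong)
  then have "is_lebesgue_deriv \<mu> \<nu> f" unfolding is_lebesgue_deriv_def using f N by blast
  then show ?thesis
    unfolding lebesgue_deriv_def using someI[of "is_lebesgue_deriv \<mu> \<nu>" f] by simp
qed


section \<open>The free product is a group\<close>

locale free_product =
  fixes d m :: nat and Gs :: "nat \<Rightarrow> 'a monoid"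
  assumes grp: "\<And>j. j < m \<Longrightarrow> group (Gs j)"
begin

abbreviation "L \<equiv> letters d m Gs"
abbreviation "Nx \<equiv> next_letters d m Gs"
abbreviation "W \<equiv> reduced_words d m Gs"
abbreviation "mu \<equiv> letter_mult_word d m Gs"
abbreviation "ginv \<equiv> letter_inv Gs"

lemma L_iff: "Gen i \<in> L \<longleftrightarrow> i < d" "GenInv i \<in> L \<longleftrightarrow> i < d"
  "Fac j x \<in> L \<longleftrightarrow> j < m \<and> x \<in> carrier (Gs j) \<and> x \<noteq> \<one>\<^bsub>Gs j\<^esub>"
  by (auto simp: letters_def factor_letters_def)

lemma Nx_iff: "t \<in> Nx (Gen i) \<longleftrightarrow> t \<in> L \<and> t \<noteq> GenInv i"
  "t \<in> Nx (GenInv i) \<longleftrightarrow> t \<in> L \<and> t \<noteq> Gen i"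
  "Fac j x \<in> L \<Longrightarrow> t \<in> Nx (Fac j x) \<longleftrightarrow> t \<in> L \<and> (\<forall>y. t \<noteq> Fac j y)"
  by (auto simp: next_letters_def factor_letters_def L_iff letters_def)

lemma inv_L: "s \<in> L \<Longrightarrow> ginv s \<in> L"
  by (cases s) (auto simp: L_iff grp group.inv_closed group.inv_eq_1_iff)

lemma inv_inv: "s \<in> L \<Longrightarrow> ginv (ginv s) = s"
  by (cases s) (auto simp: L_iff grp group.inv_inv)

lemma W_Cons: "t # w \<in> W \<longleftrightarrow> t \<in> L \<and> w \<in> W \<and> (w = [] \<or> hd w \<in> Nx t)"
  by (cases w) (auto simp: reduced_words_def)

lemma W_Nil: "[] \<in> W" by (auto simp: reduced_words_def)

lemma Nx_Fac: "Nx (Fac j x) = L - factor_letters Gs j"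
  by (simp add: next_letters_def)

lemma prod_cases:
  assumes "s \<in> L" "t \<in> L"
  obtains "t \<in> Nx s" "letter_prod d m Gs s t = [s,t]"
   | "t \<notin> Nx s" "t = ginv s" "letter_prod d m Gs s t = []"
   | j x y where "s = Fac j x" "t = Fac j y" "t \<noteq> ginv s" "Fac j (x \<otimes>\<^bsub>Gs j\<^esub> y) \<in> L"
       "letter_prod d m Gs s t = [Fac j (x \<otimes>\<^bsub>Gs j\<^esub> y)]"
proof (cases "t \<in> Nx s")
  case True then show ?thesis using that(1) by (simp add: letter_prod_def)
next
  case n: False
  show ?thesis
  proof (cases "t = ginv s")
    case True then show ?thesis using n that(2) by (simp add: letter_prod_def)
  next
    case False
    with n assms obtain j x y where st: "s = Fac j x" "t = Fac j y"
      by (cases s) (auto simp: Nx_iff)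
    then have j: "j < m" "x \<in> carrier (Gs j)" "y \<in> carrier (Gs j)" using assms by (auto simp: L_iff)
    have "x \<otimes>\<^bsub>Gs j\<^esub> y \<noteq> \<one>\<^bsub>Gs j\<^esub>"
      using False st j grp[OF j(1)]
      by (metis group.inv_equality group.inv_inv letter_inv.simps(3) group.inv_closed)
    then have "Fac j (x \<otimes>\<^bsub>Gs j\<^esub> y) \<in> L" using j grp[OF j(1)] 
      by (auto simp: L_iff group.is_monoid monoid.m_closed)
    then show ?thesis using that(3) st n False by (simp add: letter_prod_def)
  qed
qed

lemma inv_not_Nx: "s \<in> L \<Longrightarrow> ginv s \<notin> Nx s"
  by (cases s) (auto simp: Nx_iff)

lemma mu_W: "s \<in> L \<Longrightarrow> w \<in> W \<Longrightarrow> mu s w \<in> W"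
proof (cases w)
  case Nil assume "s \<in> L" then show ?thesis using Nil by (simp add: letter_mult_word_def W_Cons W_Nil)
next
  case (Cons t w')
  assume a: "s \<in> L" "w \<in> W"
  then have t: "t \<in> L" "w' \<in> W" "w' = [] \<or> hd w' \<in> Nx t" by (auto simp: Cons W_Cons)
  show ?thesis using a(1) t(1)
    by (cases rule: prod_cases) (use Cons a t in \<open>auto simp: letter_mult_word_def W_Cons Nx_Fac\<close>)
qed

lemma mu_mu: "s \<in> L \<Longrightarrow> t \<in> L \<Longrightarrow> w \<in> W \<Longrightarrow> foldr mu (letter_prod d m Gs s t) w = mu s (mu t w)"
proof -
  have inv: "mu s (mu (ginv s) w) = w" if s: "s \<in> L" and w: "w \<in> W" for s w
  proof (cases w)
    case Nil then show ?thesis using s inv_not_Nx[OF s] by (auto simp: letter_mult_word_def letter_prod_def)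
  next
    case (Cons t w')
    then have t: "t \<in> L" "w' \<in> W" "w' = [] \<or> hd w' \<in> Nx t" using w by (auto simp: W_Cons)
    show ?thesis using inv_L[OF s] t(1)
    proof (cases rule: prod_cases)
      case 1 then show ?thesis using Cons inv_not_Nx[OF s] s by (simp add: letter_mult_word_def letter_prod_def)
    next
      case 2 
      then have "t = s" using inv_inv[OF s] by simp
      then show ?thesis using 2 Cons t by (cases w') (auto simp: letter_mult_word_def letter_prod_def)
    next
      case (3 j x y)
      then obtain x' where x': "s = Fac j x'" "x = inv\<^bsub>Gs j\<^esub> x'" by (cases s) auto
      interpret g: group "Gs j" using grp s x' by (simp add: L_iff)
      have c: "x' \<in> carrier (Gs j)" "y \<in> carrier (Gs j)" "y \<noteq> \<one>\<^bsub>Gs j\<^esub>" using s t x' 3 by (auto simp: L_iff)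
      have e: "x' \<otimes>\<^bsub>Gs j\<^esub> (x \<otimes>\<^bsub>Gs j\<^esub> y) = y" using c x' by (simp add: g.m_assoc[symmetric])
      have "x \<otimes>\<^bsub>Gs j\<^esub> y \<noteq> x" using c x' g.r_cancel_one by auto
      then show ?thesis using 3 Cons x' e s by (simp add: letter_mult_word_def letter_prod_def Nx_iff)
    qed
  qed
  assume a: "s \<in> L" "t \<in> L" "w \<in> W"
  show ?thesis using a(1,2)
  proof (cases rule: prod_cases)
    case 1 then show ?thesis by simp
  next
    case 2 then show ?thesis using inv a by simp
  next
    case (3 j x y)
    interpret g: group "Gs j" using grp a 3 by (simp add: L_iff)
    have c: "x \<in> carrier (Gs j)" "y \<in> carrier (Gs j)" "y \<noteq> \<one>\<^bsub>Gs j\<^esub>" "x \<noteq> \<one>\<^bsub>Gs j\<^esub>" "j < m"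
       using a 3 by (auto simp: L_iff)
    have nn: "x \<otimes>\<^bsub>Gs j\<^esub> y \<noteq> \<one>\<^bsub>Gs j\<^esub>" using 3 by (simp add: L_iff)
    show ?thesis
    proof (cases "\<exists>z w'. w = Fac j z # w'")
      case False
      then have h: "w = [] \<or> (hd w \<in> Nx (Fac j x) \<and> hd w \<in> Nx (Fac j y) \<and> hd w \<in> Nx (Fac j (x \<otimes>\<^bsub>Gs j\<^esub> y)))" 
        using a 3 by (cases w) (auto simp: W_Cons Nx_iff)
      have "t \<notin> Nx s" using 3 a by (auto simp: Nx_iff)
      moreover have "Fac j y \<noteq> Fac j (inv\<^bsub>Gs j\<^esub> x)" using 3 by auto
      ultimately show ?thesis using h 3
        by (cases w) (auto simp: letter_mult_word_def letter_prod_def)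
    next
      case True
      then obtain z w' where w: "w = Fac j z # w'" by auto
      then have z: "z \<in> carrier (Gs j)" "z \<noteq> \<one>\<^bsub>Gs j\<^esub>" "Fac j z \<in> L" and w': "w' = [] \<or> hd w' \<in> Nx (Fac j z)" using a by (auto simp: W_Cons L_iff)
      have P: "letter_prod d m Gs (Fac j b) (Fac j c) = (if c = inv\<^bsub>Gs j\<^esub> b then [] else [Fac j (b \<otimes>\<^bsub>Gs j\<^esub> c)])"
        if "Fac j b \<in> L" for b c using that by (auto simp: letter_prod_def Nx_iff)
      have nx: "Nx (Fac j b) = Nx (Fac j z)" for b by (simp add: next_letters_def)
      have mw: "mu (Fac j b) w' = Fac j b # w'" for b 
        using w' nx[of b] by (cases w') (auto simp: letter_mult_word_def letter_prod_def)
      have sL: "Fac j x \<in> L" "Fac j y \<in> L" using a 3 by auto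
      have eq: "z = inv\<^bsub>Gs j\<^esub> (x \<otimes>\<^bsub>Gs j\<^esub> y) \<longleftrightarrow> y \<otimes>\<^bsub>Gs j\<^esub> z = inv\<^bsub>Gs j\<^esub> x"
        using c z by (metis g.inv_equality g.inv_comm g.inv_inv g.m_assoc g.m_closed g.l_inv g.r_inv)
      show ?thesis
      proof (cases "z = inv\<^bsub>Gs j\<^esub> y")
        case True
        have "mu (Fac j y) w = w'" using True w P[OF sL(2)] by (simp add: letter_mult_word_def)
        moreover have "z \<noteq> inv\<^bsub>Gs j\<^esub> (x \<otimes>\<^bsub>Gs j\<^esub> y)" using True c eq g.r_inv[OF c(2)] by (metis g.inv_eq_1_iff)
        moreover have "x \<otimes>\<^bsub>Gs j\<^esub> y \<otimes>\<^bsub>Gs j\<^esub> z = x" using True c by (simp add: g.m_assoc)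
        ultimately show ?thesis using 3 w mw P[OF 3(4)] by (simp add: letter_mult_word_def)
      next
        case False
        have "mu (Fac j y) w = Fac j (y \<otimes>\<^bsub>Gs j\<^esub> z) # w'" using False w P[OF sL(2)] by (simp add: letter_mult_word_def)
        then show ?thesis using 3 w P[OF 3(4)] P[OF sL(1)] eq c z by (simp add: letter_mult_word_def g.m_assoc)
      qed
    qed
  qed
qed

lemma fold_W: "set u \<subseteq> L \<Longrightarrow> w \<in> W \<Longrightarrow> foldr mu u w \<in> W"
  by (induction u) (auto simp: mu_W)

lemma W_set: "u \<in> W \<Longrightarrow> set u \<subseteq> L" by (simp add: reduced_words_def)

lemma fold_mu: "s \<in> L \<Longrightarrow> v \<in> W \<Longrightarrow> w \<in> W \<Longrightarrow> foldr mu (mu s v) w = mu s (foldr mu v w)"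
proof (cases v)
  case Nil then show ?thesis by (simp add: letter_mult_word_def)
next
  case (Cons t v')
  assume a: "s \<in> L" "v \<in> W" "w \<in> W"
  have "foldr mu v' w \<in> W" using a Cons by (intro fold_W W_set) (auto simp: W_Cons)
  then have "foldr mu (letter_prod d m Gs s t) (foldr mu v' w) = mu s (mu t (foldr mu v' w))"
    using a Cons by (intro mu_mu) (auto simp: W_Cons)
  moreover have "mu s v = letter_prod d m Gs s t @ v'" by (simp add: Cons letter_mult_word_def)
  ultimately show ?thesis using Cons by simp
qed

lemma fold_assoc: "set u \<subseteq> L \<Longrightarrow> v \<in> W \<Longrightarrow> w \<in> W \<Longrightarrow>
   foldr mu (foldr mu u v) w = foldr mu u (foldr mu v w)"
  by (induction u) (auto simp: fold_mu fold_W)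

lemma fold_Nil: "u \<in> W \<Longrightarrow> foldr mu u [] = u"
  by (induction u) (auto simp: W_Cons letter_mult_word_def letter_prod_def split: list.splits)

lemma l_inverse: "set u \<subseteq> L \<Longrightarrow> \<exists>y\<in>W. \<forall>w\<in>W. foldr mu y (foldr mu u w) = w"
proof (induction u)
  case Nil then show ?case using W_Nil by (intro bexI[of _ "[]"]) auto
next
  case (Cons s u)
  then obtain y where y: "y \<in> W" "\<forall>w\<in>W. foldr mu y (foldr mu u w) = w" by auto
  have s: "s \<in> L" using Cons by auto
  let ?y = "foldr mu y [ginv s]"
  have i: "[ginv s] \<in> W" using s inv_L by (simp add: W_Cons W_Nil)
  have "foldr mu ?y (foldr mu (s # u) w) = w" if w: "w \<in> W" for w
  proof -
    have fw: "foldr mu u w \<in> W" using Cons w by (simp add: fold_W)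
    have "foldr mu ?y (foldr mu (s # u) w) = foldr mu y (mu (ginv s) (mu s (foldr mu u w)))"
      using fold_assoc[OF W_set[OF y(1)] i mu_W[OF s fw]] by simp
    also have "mu (ginv s) (mu s (foldr mu u w)) = foldr mu (letter_prod d m Gs (ginv s) s) (foldr mu u w)"
      using mu_mu[OF inv_L[OF s] s fw] by simp
    also have "letter_prod d m Gs (ginv s) s = []"
      using inv_not_Nx[OF inv_L[OF s]] inv_inv[OF s] by (simp add: letter_prod_def)
    finally show ?thesis using y w by simp
  qed
  then show ?case using fold_W[OF W_set[OF y(1)] i] by auto
qed

text \<open>Hence inverses, generated subgroups and isomorphisms of \<^const>\<open>free_prod\<close> have their usual meaning.\<close>

theorem group_free_prod: "group (free_prod d m Gs)"
proof (rule groupI)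
  fix x assume "x \<in> carrier (free_prod d m Gs)"
  then have x: "x \<in> W" by (simp add: free_prod_def)
  obtain y where "y\<in>W" "\<forall>w\<in>W. foldr mu y (foldr mu x w) = w" using l_inverse[OF W_set[OF x]] by auto
  then have "foldr mu y x = []" using fold_Nil[OF x] W_Nil by metis
  then show "\<exists>y\<in>carrier (free_prod d m Gs). y \<otimes>\<^bsub>free_prod d m Gs\<^esub> x = \<one>\<^bsub>free_prod d m Gs\<^esub>"
    using \<open>y \<in> W\<close> by (auto simp: free_prod_def)
qed (auto simp: free_prod_def W_Nil fold_W W_set fold_assoc)
end

end

theory Submission
  imports Defs
begin

text \<open>
  Both formulas are obtained as limits of increments.  Start the colour from its invariant law
  \<open>\<pi>\<close>.  After one step the colour again has law \<open>\<pi>\<close>, and the rest of the walk is a translate of a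
  walk started at the identity; so for a quantity that is additive, or nearly so, along the first
  step, the expectations at times \<open>n + 1\<close> and \<open>n\<close> differ by a contribution of the first step alone.
  A quantity whose mean increments converge to \<open>c\<close> has mean growth rate \<open>c\<close>.

  For the drift the quantity is the word length.  The identity \<open>length_mu\<close> shows that \<open>|s x| - |x|\<close> is
  \<open>1\<close>, \<open>-1\<close> or \<open>0\<close> according to the first letter of \<open>x\<close>, and the first letter of the walk converges
  to that of its limit.  Moreover a walk whose limit begins with \<open>s\<close> has to visit the word \<open>s\<close>, so
  that \<open>\<mu>\<^sub>s\<close>, summed over the colour at the first visit, is the law of the first letter
  (\<open>sum_first_letter_prob\<close>).

  For the entropy the quantity is the mutual information between the position \<open>Y n\<close> and the limit.
  Conditionally on \<open>Y n = y\<close> the limit has the translated harmonic measure \<open>nu y\<close> as its law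
  (\<open>law_Y_Yinf\<close>), and the chain rule for densities (\<open>dens_step\<close>) makes the mutual information exactly
  additive (\<open>mean_info_Suc\<close>): it grows at the rate \<open>\<Sum> \<pi>(u) p\<^sub>g(u,v) \<integral> log (d(g p\<^sub>v)/dp\<^sub>u) d(g p\<^sub>v)\<close>, with
  \<open>p\<^sub>u\<close> for the harmonic measure.  This rate is the right-hand side of the formula, because the
  logarithmic derivative there is that of the reciprocal density (\<open>info_lebesgue_deriv\<close>).

  It remains to see that entropy and mutual information have the same growth rate, that is, that the
  conditional entropy of \<open>Y n\<close> given the limit \<open>\<xi>\<close> is \<open>o(n)\<close> (\<open>cond_entropy_tendsto\<close>).  Here the geometry
  of the free product enters.  One step alters a reduced word at its last letter only, and the length
  of the walk is asymptotic to \<open>\<gamma> n\<close>; hence almost surely, for all large \<open>n\<close>, the word \<open>Y n\<close> has length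
  at most \<open>(\<gamma> + \<epsilon>) n\<close> and shares with \<open>\<xi>\<close> its first \<open>(\<gamma> - \<epsilon>) n\<close> letters (\<open>AE_near\<close>).  Given \<open>\<xi>\<close> only
  \<open>exp (O(\<epsilon> n))\<close> such words exist, and the exceptional words, at most exponentially many, have
  vanishing total probability.
\<close>

section \<open>Reduced words and their infinite limits\<close>

context free_product
begin

abbreviation "GP \<equiv> free_prod d m Gs"
abbreviation "bact \<equiv> boundary_act d m Gs"
abbreviation "Bd \<equiv> boundary d m Gs"
abbreviation "BS \<equiv> boundary_set d m Gs"

lemma W_append:
  "u @ w \<in> W \<longleftrightarrow> u \<in> W \<and> w \<in> W \<and> (u = [] \<or> w = [] \<or> hd w \<in> Nx (last u))"
  by (auto simp: reduced_words_def successively_append_iff)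

lemma fold_append: "u @ w \<in> W \<Longrightarrow> foldr mu u w = u @ w"
proof (induction u)
  case (Cons s u)
  then have "foldr mu u w = u @ w" and "u @ w = [] \<or> hd (u @ w) \<in> Nx s"
    by (auto simp: W_Cons)
  then have e: "foldr mu (s # u) w = mu s (u @ w)" "u @ w = [] \<or> hd (u @ w) \<in> Nx s" by simp_all
  show ?case unfolding e(1) using e(2)
    by (cases "u @ w") (simp_all add: letter_mult_word_def letter_prod_def)
qed simp

text \<open>
  Right multiplication by a letter affects a reduced word only at its last letter.  This is the
  tree-like geometry behind both formulas: a nearest-neighbour walk alters a long word only at its
  end.
\<close>

lemma right_mult:
  assumes x: "x \<in> W" and s: "s \<in> L"
  shows "foldr mu x [s] = x @ [s] \<or> (x \<noteq> [] \<and> foldr mu x [s] = butlast x) \<or>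
         (x \<noteq> [] \<and> (\<exists>t. foldr mu x [s] = butlast x @ [t]))"
proof (cases x rule: rev_cases)
  case Nil
  then show ?thesis by (simp add: letter_mult_word_def)
next
  case (snoc y t)
  have y: "y \<in> W" "t \<in> L" "y = [] \<or> t \<in> Nx (last y)"
    using x by (auto simp: snoc W_append W_Cons)
  have e: "foldr mu x [s] = foldr mu y (letter_prod d m Gs t s)"
    by (simp add: snoc letter_mult_word_def)
  show ?thesis using y(2) s
  proof (cases rule: prod_cases)
    case 1
    then have "y @ [t, s] \<in> W" using y s by (auto simp: W_append W_Cons W_Nil)
    then show ?thesis using e 1 fold_append[of y "[t, s]"] snoc by simp
  next
    case 2
    then show ?thesis using e fold_append[of y "[]"] y snoc by simp
  next
    case (3 j a b)
    let ?c = "Fac j (a \<otimes>\<^bsub>Gs j\<^esub> b)"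
    have "y = [] \<or> ?c \<in> Nx (last y)"
    proof (cases "y = []")
      case False
      then have "last y \<in> L" using W_set[OF y(1)] by auto
      then show ?thesis using False y(3) 3
        by (cases "last y") (auto simp: Nx_iff)
    qed simp
    then have "y @ [?c] \<in> W" using y 3 by (auto simp: W_append W_Cons W_Nil)
    then show ?thesis using e 3 fold_append[of y "[?c]"] snoc by simp
  qed
qed

lemma take_right_mult:
  assumes "x \<in> W" "s \<in> L" "k < length x"
  shows "take k (foldr mu x [s]) = take k x"
  using right_mult[OF assms(1,2)] assms(3) by (auto simp: take_butlast)

text \<open>
  Only words of length at most one can change their first letter in one step, so a walk has to pass
  through the one-letter word \<open>a\<close> in order to acquire the first letter \<open>a\<close>.
\<close>

lemma right_mult_hits:
  assumes x: "x \<in> W" and s: "s \<in> L"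
    and "take 1 (foldr mu x [s]) = [a]" "take 1 x \<noteq> [a]"
  shows "foldr mu x [s] = [a]"
proof -
  have "\<not> 1 < length x" using take_right_mult[OF x s, of 1] assms by auto
  then have "x = [] \<or> (\<exists>t. x = [t])"
    by (cases x; cases "tl x") auto
  then show ?thesis using right_mult[OF x s] assms by auto
qed

text \<open>
  The change of length under left multiplication by \<open>s\<close> depends on the first letter only.  Along the
  walk this letter stabilises, and that is how the drift comes to be expressed by the law of the
  first letter of the limit.
\<close>

lemma length_mu:
  assumes s: "s \<in> L" and w: "w \<in> W"
  shows "real (length (mu s w)) =
    real (length w) + (if w = [] \<or> hd w \<in> Nx s then 1 else if hd w = ginv s then -1 else 0)"
proof (cases w)
  case (Cons t w')
  then have t: "t \<in> L" using w by (simp add: W_Cons)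
  show ?thesis using s t
  proof (cases rule: prod_cases)
    case (3 j x y)
    then have "t \<notin> Nx s" using s by (simp add: Nx_iff)
    then show ?thesis using 3 by (simp add: Cons letter_mult_word_def)
  qed (simp_all add: Cons letter_mult_word_def)
qed (simp add: letter_mult_word_def)

lemma length_mu_le: "length (mu s w) \<le> Suc (length w)"
  by (auto simp: letter_mult_word_def letter_prod_def split: list.splits letter.splits)

lemma word_length_eq:
  assumes "w \<in> W"
  shows "word_length GP (generators d m Gs) w = length w"
  unfolding word_length_def
proof (rule Least_equality)
  have "foldr (\<otimes>\<^bsub>GP\<^esub>) (map (\<lambda>s. [s]) u) \<one>\<^bsub>GP\<^esub> = u" if "u \<in> W" for u
  proof -
    have "foldr (\<otimes>\<^bsub>GP\<^esub>) (map (\<lambda>s. [s]) u) \<one>\<^bsub>GP\<^esub> = foldr mu u []"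
      by (induction u) (simp_all add: free_prod_def)
    then show ?thesis using fold_Nil[OF that] by simp
  qed
  then show "\<exists>ss. length ss = length w \<and> set ss \<subseteq> generators d m Gs \<and>
      w = foldr (\<otimes>\<^bsub>GP\<^esub>) ss \<one>\<^bsub>GP\<^esub>"
    using assms W_set[OF assms]
    by (intro exI[of _ "map (\<lambda>s. [s]) w"]) (auto simp: generators_def)
next
  fix k
  assume "\<exists>ss. length ss = k \<and> set ss \<subseteq> generators d m Gs \<and> w = foldr (\<otimes>\<^bsub>GP\<^esub>) ss \<one>\<^bsub>GP\<^esub>"
  then obtain ss where ss: "length ss = k" "set ss \<subseteq> generators d m Gs"
    "w = foldr (\<otimes>\<^bsub>GP\<^esub>) ss \<one>\<^bsub>GP\<^esub>" by blast
  have "length (foldr (\<otimes>\<^bsub>GP\<^esub>) ss \<one>\<^bsub>GP\<^esub>) \<le> length ss" using ss(2)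
  proof (induction ss)
    case (Cons g ss)
    then obtain s where "g = [s]" by (auto simp: generators_def)
    then show ?case using Cons length_mu_le[of s "foldr (\<otimes>\<^bsub>GP\<^esub>) ss \<one>\<^bsub>GP\<^esub>"]
      by (simp add: free_prod_def)
  qed (simp add: free_prod_def)
  then show "length w \<le> k" using ss by simp
qed

lemma sing_W: "s \<in> L \<Longrightarrow> [s] \<in> W" by (simp add: W_Cons W_Nil)

lemma letter_prod_ginv: "s \<in> L \<Longrightarrow> letter_prod d m Gs (ginv s) s = []"
  using inv_not_Nx[OF inv_L, of s] by (simp add: letter_prod_def inv_inv)

lemma mu_ginv:
  assumes "s \<in> L" "w \<in> W"
  shows "mu (ginv s) (mu s w) = w"
  using mu_mu[OF inv_L[OF assms(1)] assms] letter_prod_ginv[OF assms(1)] by simp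

lemma mu_ginv':
  assumes "s \<in> L" "w \<in> W"
  shows "mu s (mu (ginv s) w) = w"
  using mu_ginv[OF inv_L[OF assms(1)] assms(2)] unfolding inv_inv[OF assms(1)] .

lemma inv_sing:
  assumes "s \<in> L"
  shows "inv\<^bsub>GP\<^esub> [s] = [ginv s]"
proof -
  interpret group GP by (rule group_free_prod)
  have "[ginv s] \<otimes>\<^bsub>GP\<^esub> [s] = \<one>\<^bsub>GP\<^esub>"
    using mu_ginv[OF assms W_Nil] by (simp add: free_prod_def letter_mult_word_def)
  then show ?thesis
    using sing_W[OF assms] sing_W[OF inv_L[OF assms]]
    by (intro inv_equality) (auto simp: free_prod_def)
qed

lemma boundary_iff: "\<xi> \<in> BS \<longleftrightarrow> (\<forall>k. stake k \<xi> \<in> W)"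
proof
  assume b: "\<xi> \<in> BS"
  show "\<forall>k. stake k \<xi> \<in> W"
    using b by (auto simp: boundary_set_def reduced_words_def set_conv_nth successively_conv_nth)
next
  assume w: "\<forall>k. stake k \<xi> \<in> W"
  show "\<xi> \<in> BS" unfolding boundary_set_def mem_Collect_eq
  proof
    fix i
    have "set (stake (Suc (Suc i)) \<xi>) \<subseteq> L"
      "successively (\<lambda>s t. t \<in> Nx s) (stake (Suc (Suc i)) \<xi>)"
      using w unfolding reduced_words_def by blast+
    then have "\<And>j. j < Suc (Suc i) \<Longrightarrow> stake (Suc (Suc i)) \<xi> ! j \<in> L"
      "stake (Suc (Suc i)) \<xi> ! Suc i \<in> Nx (stake (Suc (Suc i)) \<xi> ! i)"
      by (auto simp: set_conv_nth successively_conv_nth simp del: stake.simps)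
    from this(1)[of i] this(2) show "\<xi> !! i \<in> L \<and> \<xi> !! Suc i \<in> Nx (\<xi> !! i)"
      by (simp add: stake_nth del: stake.simps)
  qed
qed

lemma words_tendsto_unique:
  assumes "words_tendsto w \<xi>" "words_tendsto w \<eta>"
  shows "\<xi> = \<eta>"
proof -
  have "stake k \<xi> = stake k \<eta>" for k
  proof -
    have "\<forall>\<^sub>F n in sequentially. stake k \<xi> = stake k \<eta>"
      using assms[unfolded words_tendsto_def, rule_format, of k] by eventually_elim simp
    then show ?thesis by simp
  qed
  then have "\<xi> !! n = \<eta> !! n" for n
    using stake_nth[of n "Suc n" \<xi>] stake_nth[of n "Suc n" \<eta>] by simp
  then show ?thesis
    using smap_alt[of id \<xi> \<eta>] by (simp add: stream.map_id)
qed

lemma W_take: "w \<in> W \<Longrightarrow> take k w \<in> W"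
  by (metis append_take_drop_id W_append)

lemma words_tendsto_boundary:
  assumes "words_tendsto w \<xi>" "\<And>n. w n \<in> W"
  shows "\<xi> \<in> BS"
  unfolding boundary_iff
proof
  fix k
  from assms(1) have "\<forall>\<^sub>F n in sequentially. take k (w n) = stake k \<xi>"
    unfolding words_tendsto_def by blast
  then obtain n where "take k (w n) = stake k \<xi>" by (auto simp: eventually_sequentially)
  then show "stake k \<xi> \<in> W" using W_take[OF assms(2)] by metis
qed

lemma words_tendsto_stake: "words_tendsto (\<lambda>n. stake n \<xi>) \<xi>"
  unfolding words_tendsto_def
proof
  fix k show "\<forall>\<^sub>F n in sequentially. take k (stake n \<xi>) = stake k \<xi>"
    using eventually_ge_at_top[of k] by eventually_elim (simp add: take_stake min_def)
qed

text \<open>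
  Left multiplication extends continuously to infinite words, because a cancellation shifts the
  letters by at most one place.  The laws of the action on infinite words are then limits, along
  prefixes, of the laws of the group.
\<close>

lemma words_tendsto_mu:
  assumes "words_tendsto w \<xi>"
  shows "words_tendsto (\<lambda>n. mu s (w n)) (letter_act d m Gs s \<xi>)"
  unfolding words_tendsto_def
proof
  fix k
  have "\<forall>\<^sub>F n in sequentially. take (Suc k) (w n) = stake (Suc k) \<xi>"
    using assms unfolding words_tendsto_def by blast
  then show "\<forall>\<^sub>F n in sequentially. take k (mu s (w n)) = stake k (letter_act d m Gs s \<xi>)"
  proof eventually_elim
    case (elim n)
    then obtain w' where w: "w n = shd \<xi> # w'" "take k w' = stake k (stl \<xi>)"
      by (cases "w n") auto
    have "take (k - i) w' = stake (k - i) (stl \<xi>)" for i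
      using arg_cong[OF w(2), of "take (k - i)"] by (simp add: take_stake min_def)
    then show ?case
      by (simp add: w letter_mult_word_def letter_act_def stake_shift)
  qed
qed

lemma words_tendsto_act:
  "words_tendsto w \<xi> \<Longrightarrow> words_tendsto (\<lambda>n. foldr mu x (w n)) (bact x \<xi>)"
proof (induction x)
  case (Cons s x)
  from words_tendsto_mu[OF Cons.IH[OF Cons.prems], of s]
  show ?case by (simp add: boundary_act_def)
qed (simp add: boundary_act_def)

lemma act_boundary: "x \<in> W \<Longrightarrow> \<xi> \<in> BS \<Longrightarrow> bact x \<xi> \<in> BS"
  by (rule words_tendsto_boundary[OF words_tendsto_act[OF words_tendsto_stake]])
    (simp add: fold_W W_set boundary_iff)

lemma act_mult:
  assumes "x \<in> W" "y \<in> W" "\<xi> \<in> BS"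
  shows "bact (foldr mu x y) \<xi> = bact x (bact y \<xi>)"
proof (rule words_tendsto_unique)
  show "words_tendsto (\<lambda>n. foldr mu (foldr mu x y) (stake n \<xi>)) (bact (foldr mu x y) \<xi>)"
    by (rule words_tendsto_act[OF words_tendsto_stake])
  have "foldr mu (foldr mu x y) (stake n \<xi>) = foldr mu x (foldr mu y (stake n \<xi>))" for n
    using assms by (intro fold_assoc W_set) (auto simp: boundary_iff)
  then show "words_tendsto (\<lambda>n. foldr mu (foldr mu x y) (stake n \<xi>)) (bact x (bact y \<xi>))"
    by (simp add: words_tendsto_act words_tendsto_stake)
qed

lemma act_ginv:
  assumes "s \<in> L" "\<xi> \<in> BS"
  shows "bact [ginv s] (bact [s] \<xi>) = \<xi>" "bact [s] (bact [ginv s] \<xi>) = \<xi>"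
proof -
  have 1: "bact [ginv s] (bact [s] \<xi>) = \<xi>" if "s \<in> L" for s
  proof -
    have "bact [ginv s] (bact [s] \<xi>) = bact (foldr mu [ginv s] [s]) \<xi>"
      by (rule act_mult[OF sing_W[OF inv_L[OF that]] sing_W[OF that] assms(2), symmetric])
    also have "mu s [] = [s]" by (simp add: letter_mult_word_def)
    then have "foldr mu [ginv s] [s] = []"
      using mu_ginv[OF that W_Nil] by simp
    also have "bact [] \<xi> = \<xi>" by (simp add: boundary_act_def)
    finally show ?thesis .
  qed
  show "bact [ginv s] (bact [s] \<xi>) = \<xi>" by (rule 1[OF assms(1)])
  show "bact [s] (bact [ginv s] \<xi>) = \<xi>"
    using 1[OF inv_L[OF assms(1)]] unfolding inv_inv[OF assms(1)] .
qed

end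

locale finite_free_product = free_product +
  assumes finite_factor: "\<And>j. j < m \<Longrightarrow> finite (carrier (Gs j))"
begin

lemma finite_L: "finite L"
  by (auto simp: letters_def factor_letters_def finite_factor)

lemma space_boundary: "space Bd = BS"
proof -
  have "BS \<subseteq> streams L"
    by (auto simp: boundary_set_def streams_iff_snth)
  then show ?thesis
    by (auto simp: boundary_def space_restrict_space space_stream_space)
qed

lemma measurable_bact: 
  assumes "x \<in> W"
  shows "bact x \<in> Bd \<rightarrow>\<^sub>M Bd"
proof -
  let ?N = "stream_space (count_space L)"
  have L: "letter_act d m Gs s \<in> ?N \<rightarrow>\<^sub>M ?N" if s: "s \<in> L" for s
  proof -
    have 1: "(\<lambda>\<xi>. letter_prod d m Gs s t @- stl \<xi>) \<in> ?N \<rightarrow>\<^sub>M ?N" if t: "t \<in> L" for t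
      using s t
    proof (cases rule: prod_cases)
      case 1
      have "(\<lambda>\<xi>. s ## t ## stl \<xi>) \<in> ?N \<rightarrow>\<^sub>M ?N"
        using s t by (intro measurable_Stream measurable_stl) auto
      then show ?thesis unfolding 1(2) by simp
    next
      case 2
      have "(\<lambda>\<xi>. stl \<xi>) \<in> ?N \<rightarrow>\<^sub>M ?N" by (rule measurable_stl)
      then show ?thesis unfolding 2(3) by simp
    next
      case (3 j x y)
      have "(\<lambda>\<xi>. Fac j (x \<otimes>\<^bsub>Gs j\<^esub> y) ## stl \<xi>) \<in> ?N \<rightarrow>\<^sub>M ?N"
        using 3 by (intro measurable_Stream measurable_stl) auto
      then show ?thesis unfolding 3(5) by simp
    qed

    have "(\<lambda>\<xi>. (\<lambda>t \<xi>. if t \<in> L then letter_prod d m Gs s t @- stl \<xi> else \<xi>) (shd \<xi>) \<xi>) \<in> ?N \<rightarrow>\<^sub>M ?N"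
    proof (rule measurable_compose_countable'[where I = L])
      show "(\<lambda>\<xi>. if t \<in> L then letter_prod d m Gs s t @- stl \<xi> else \<xi>) \<in> ?N \<rightarrow>\<^sub>M ?N" if "t \<in> L" for t
        using 1[OF that] that by simp
    qed (auto simp: finite_L countable_finite)
    also have "?this \<longleftrightarrow> ?thesis"
      by (intro measurable_cong)
        (auto simp: letter_act_def space_stream_space streams_shd)
    finally show ?thesis .
  qed
  have "set x \<subseteq> L \<Longrightarrow> bact x \<in> ?N \<rightarrow>\<^sub>M ?N"
  proof (induction x)
    case (Cons s x)
    have "(\<lambda>\<xi>. letter_act d m Gs s (bact x \<xi>)) \<in> ?N \<rightarrow>\<^sub>M ?N"
      using Cons by (intro measurable_compose[OF _ L]) auto
    then show ?case by (simp add: boundary_act_def[abs_def] comp_def)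
  qed (simp add: boundary_act_def[abs_def] id_def)
  then have "bact x \<in> Bd \<rightarrow>\<^sub>M ?N"
    using W_set[OF assms] unfolding boundary_def by (auto intro: measurable_restrict_space1)
  moreover have "bact x \<in> space Bd \<rightarrow> BS"
    using act_boundary[OF assms] by (auto simp: space_boundary)
  ultimately show ?thesis unfolding boundary_def[of d m Gs]
    by (intro measurable_restrict_space2) (auto simp: boundary_def)
qed

lemma boundary_streams: "\<xi> \<in> BS \<Longrightarrow> \<xi> \<in> streams L"
  by (auto simp: boundary_set_def streams_iff_snth)

lemma sets_stream_L:
  "sets (stream_space (count_space L)) = sigma_sets (streams L) (sstart L ` lists L \<union> {{}})"
proof -
  have "sstart L ` lists L \<union> {{}} \<subseteq> Pow (streams L)"
    by (simp add: sstart_in_streams image_subset_iff)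
  then show ?thesis
    using sets_stream_space_sstart[OF countable_finite[OF finite_L]] by (simp add: sets_measure_of)
qed

lemma sstart_boundary: "sstart L w \<inter> BS = {\<xi> \<in> space Bd. stake (length w) \<xi> = w}"
proof -
  have "\<xi> \<in> sstart L w \<longleftrightarrow> stake (length w) \<xi> = w" if "\<xi> \<in> BS" for \<xi>
    using boundary_streams[OF that] by (simp add: sstart_eq list_eq_iff_nth_eq stake_nth)
  then show ?thesis by (auto simp: space_boundary)
qed

lemma cylinder_sets: "{\<xi> \<in> space Bd. stake k \<xi> = w} \<in> sets Bd"
proof (cases "length w = k \<and> w \<in> lists L")
  case True
  then have "sstart L w \<in> sets (stream_space (count_space L))"
    unfolding sets_stream_L by (intro sigma_sets.Basic) auto
  then have "BS \<inter> sstart L w \<in> sets Bd"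
    by (auto simp: boundary_def sets_restrict_space)
  then show ?thesis using True sstart_boundary[of w] by (simp add: Int_commute)
next
  case False
  have "{\<xi> \<in> space Bd. stake k \<xi> = w} = {}"
  proof -
    have "length (stake k \<xi>) = k \<and> stake k \<xi> \<in> lists L" if "\<xi> \<in> BS" for \<xi>
      using that W_set[of "stake k \<xi>"] by (auto simp: boundary_iff)
    then show ?thesis using False by (auto simp: space_boundary)
  qed
  then show ?thesis by (simp only: sets.empty_sets)
qed

text \<open>
  Two cylinders are nested or disjoint, so cylinders form an intersection-stable family; they
  generate the \<open>\<sigma>\<close>-algebra.
\<close>

lemma boundary_measure_eqI:
  assumes N: "finite_measure N" "finite_measure N'" "sets N = sets Bd" "sets N' = sets Bd"
    and eq: "\<And>k w. measure N {\<xi> \<in> space Bd. stake k \<xi> = w} = measure N' {\<xi> \<in> space Bd. stake k \<xi> = w}"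
  shows "N = N'"
proof (rule measure_eqI_generator_eq)
  interpret N: finite_measure N by fact
  interpret N': finite_measure N' by fact
  let ?cyl = "\<lambda>w. {\<xi> \<in> space Bd. stake (length w) \<xi> = w}"
  let ?E = "insert {} (range ?cyl)"
  show "?E \<subseteq> Pow (space Bd)" by auto
  show "Int_stable ?E"
  proof -
    have I: "?cyl v \<inter> ?cyl w \<in> ?E" if "length v \<le> length w" for v w
    proof (cases "take (length v) w = v")
      case True
      have "stake (length v) \<xi> = v" if "stake (length w) \<xi> = w" for \<xi>
        using True arg_cong[OF that, of "take (length v)"] \<open>length v \<le> length w\<close>
        by (simp add: take_stake min_def)
      then have "?cyl v \<inter> ?cyl w = ?cyl w" by auto
      then show ?thesis by auto
    next
      case False
      have "take (length v) w = v" if "stake (length v) \<xi> = v" "stake (length w) \<xi> = w" for \<xi>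
        using arg_cong[OF that(2), of "take (length v)"] that(1) \<open>length v \<le> length w\<close>
        by (simp add: take_stake min_def)
      then have "?cyl v \<inter> ?cyl w = {}" using False by auto
      then show ?thesis by auto
    qed
    have "?cyl v \<inter> ?cyl w \<in> ?E" for v w
      using I[of v w] I[of w v] by (cases "length v \<le> length w") (auto simp: Int_commute)
    then show ?thesis unfolding Int_stable_def by blast
  qed
  show "emeasure N X = emeasure N' X" if "X \<in> ?E" for X
    using that eq by (auto simp: N.emeasure_eq_measure N'.emeasure_eq_measure)
  have ssb: "sets Bd = sigma_sets (space Bd) ?E"
  proof
    have "?cyl w \<in> sets Bd" for w by (rule cylinder_sets)
    then show "sigma_sets (space Bd) ?E \<subseteq> sets Bd"
      by (intro sets.sigma_sets_subset) auto
    have BS: "id \<in> BS \<rightarrow> streams L"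
      by (auto intro: boundary_streams)
    have "sets Bd = {id -` A \<inter> BS |A. A \<in> sigma_sets (streams L) (sstart L ` lists L \<union> {{}})}"
      unfolding boundary_def sets_restrict_space sets_stream_L by auto
    also have "\<dots> = sigma_sets BS {id -` A \<inter> BS |A. A \<in> sstart L ` lists L \<union> {{}}}"
      by (rule sigma_sets_vimage_commute[OF BS])
    also have "\<dots> \<subseteq> sigma_sets (space Bd) ?E"
      unfolding space_boundary
    proof (rule sigma_sets_mono')
      show "{id -` A \<inter> BS |A. A \<in> sstart L ` lists L \<union> {{}}}
        \<subseteq> insert {} (range (\<lambda>w. {\<xi> \<in> BS. stake (length w) \<xi> = w}))"
        using sstart_boundary by (auto simp: space_boundary)
    qed
    finally show "sets Bd \<subseteq> sigma_sets (space Bd) ?E" .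
  qed
  show "sets N = sigma_sets (space Bd) ?E" "sets N' = sigma_sets (space Bd) ?E"
    using ssb N by simp_all
  show "range (\<lambda>_::nat. space Bd) \<subseteq> ?E"
    by (auto intro!: rev_image_eqI[of "[]"])
  show "(\<Union>i::nat. space Bd) = space Bd" by simp
  show "emeasure N (space Bd) \<noteq> \<infinity>" by simp
qed

end

section \<open>Markov chains with finitely many successors\<close>

text \<open>
  There are only countably many finite histories, and a history containing an impossible step has
  probability zero.
\<close>

lemma markov_chain_AE_successor:
  assumes mc: "markov_chain M Y X K x0" and X: "countable X"
    and K: "\<And>x y. x \<in> X \<Longrightarrow> y \<in> X \<Longrightarrow> y \<notin> nb x \<Longrightarrow> K x y = 0"
  shows "AE \<omega> in M. Y 0 \<omega> = x0" "AE \<omega> in M. \<forall>n. Y (Suc n) \<omega> \<in> nb (Y n \<omega>)"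
proof -
  interpret prob_space M using mc by (simp add: markov_chain_def)
  have [measurable]: "Y n \<in> M \<rightarrow>\<^sub>M count_space X" for n
    using mc by (simp add: markov_chain_def)
  have YX: "\<omega> \<in> space M \<Longrightarrow> Y n \<omega> \<in> X" for \<omega> n
    using measurable_space[of "Y n" M "count_space X" \<omega>] by simp
  have law: "prob {\<omega> \<in> space M. \<forall>i\<le>n. Y i \<omega> = x i} =
      (if x 0 = x0 then 1 else 0) * (\<Prod>i<n. K (x i) (x (Suc i)))" if "\<And>i. x i \<in> X" for n x
    using mc that by (simp add: markov_chain_def)
  have null: "AE \<omega> in M. \<not> (\<forall>i\<le>n. Y i \<omega> = x i)"
    if x: "\<And>i. i \<le> n \<Longrightarrow> x i \<in> X" and z: "x 0 \<noteq> x0 \<or> (\<exists>i<n. K (x i) (x (Suc i)) = 0)" for n x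
  proof -
    \<comment> \<open>The definition of a Markov chain speaks of total sequences of states, so the history is prolonged.\<close>
    define x' where "x' i = (if i \<le> n then x i else x 0)" for i
    have x': "x' i \<in> X" for i using x by (simp add: x'_def)
    have "{\<omega> \<in> space M. \<forall>i\<le>n. Y i \<omega> = x i} = {\<omega> \<in> space M. \<forall>i\<le>n. Y i \<omega> = x' i}"
      by (auto simp: x'_def)
    moreover have "(if x' 0 = x0 then 1 else 0) * (\<Prod>i<n. K (x' i) (x' (Suc i))) = 0"
      using z by (auto simp: x'_def)
    ultimately have "prob {\<omega> \<in> space M. \<forall>i\<le>n. Y i \<omega> = x i} = 0"
      using law[OF x', of n] by simp
    moreover have "{\<omega> \<in> space M. \<forall>i\<le>n. Y i \<omega> = x i} \<in> sets M"
    proof -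
      have "{\<omega> \<in> space M. Y i \<omega> = x i} \<in> sets M" if "i \<le> n" for i
      proof -
        have "{\<omega> \<in> space M. Y i \<omega> = x i} = Y i -` {x i} \<inter> space M" by auto
        also have "\<dots> \<in> sets M" using x[OF that] by (intro measurable_sets[of _ _ "count_space X"]) auto
        finally show ?thesis .
      qed
      then show ?thesis by (intro sets.sets_Collect_countable_All sets.sets_Collect_imp) auto
    qed
    ultimately show ?thesis
      by (subst (asm) prob_eq_0) auto
  qed
  have "AE \<omega> in M. \<forall>x\<in>X - {x0}. \<not> (\<forall>i\<le>0. Y i \<omega> = x)"
    unfolding AE_ball_countable[OF countable_Diff[OF X]]
    by (intro ballI null[of 0 "\<lambda>_. _"]) auto
  then show "AE \<omega> in M. Y 0 \<omega> = x0"
    using AE_space by eventually_elim (use YX in auto)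
  have "AE \<omega> in M. Y (Suc n) \<omega> \<in> nb (Y n \<omega>)" for n
  proof -
    let ?C = "{x \<in> {..Suc n} \<rightarrow>\<^sub>E X. x (Suc n) \<notin> nb (x n)}"
    have "countable ({..Suc n} \<rightarrow>\<^sub>E X)" by (intro countable_PiE) (use X in auto)
    then have "countable ?C" by (rule countable_subset[rotated]) auto
    then have "AE \<omega> in M. \<forall>x\<in>?C. \<not> (\<forall>i\<le>Suc n. Y i \<omega> = x i)"
      unfolding AE_ball_countable[OF \<open>countable ?C\<close>]
    proof (intro ballI null)
      fix x assume x: "x \<in> ?C"
      then show "i \<le> Suc n \<Longrightarrow> x i \<in> X" for i by (auto simp: PiE_iff)
      then show "x 0 \<noteq> x0 \<or> (\<exists>i<Suc n. K (x i) (x (Suc i)) = 0)"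
        using x K[of "x n" "x (Suc n)"] by auto
    qed
    then show ?thesis using AE_space
    proof eventually_elim
      case (elim \<omega>)
      let ?x = "restrict (\<lambda>i. Y i \<omega>) {..Suc n}"
      have "?x \<in> {..Suc n} \<rightarrow>\<^sub>E X" using YX elim(2) by auto
      moreover have "?x \<notin> ?C" using bspec[OF elim(1), of ?x] by (metis restrict_apply' atMost_iff)
      ultimately show ?case by auto
    qed
  qed
  then show "AE \<omega> in M. \<forall>n. Y (Suc n) \<omega> \<in> nb (Y n \<omega>)" by (simp add: AE_all_countable)
qed

text \<open>
  A form of the Markov property that dispenses with conditional expectations.  The event \<open>A k\<close> may
  concern the whole future after time \<open>k\<close>, and \<open>\<phi> n x\<close> plays the role of the probability of
  \<open>A (k + n)\<close> given that the chain is at \<open>x\<close> at time \<open>k\<close>.  It is applied both to events about a later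
  position and to events about the limit of the walk.
\<close>

lemma markov_chain_future:
  assumes mc: "markov_chain M Y X K x0" and X: "countable X"
    and nb: "\<And>x. x \<in> X \<Longrightarrow> finite (nb x)" "\<And>x. x \<in> X \<Longrightarrow> nb x \<subseteq> X"
    and K: "\<And>x y. x \<in> X \<Longrightarrow> y \<in> X \<Longrightarrow> y \<notin> nb x \<Longrightarrow> K x y = 0"
    and A: "\<And>n. A n \<in> sets M"
    and base: "\<And>k x. (\<And>i. x i \<in> X) \<Longrightarrow>
      measure M ({\<omega> \<in> space M. \<forall>i\<le>k. Y i \<omega> = x i} \<inter> A k) =
      measure M {\<omega> \<in> space M. \<forall>i\<le>k. Y i \<omega> = x i} * \<phi> 0 (x k)"
    and step: "\<And>n x. x \<in> X \<Longrightarrow> \<phi> (Suc n) x = (\<Sum>y\<in>nb x. K x y * \<phi> n y)"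
    and x: "\<And>i. x i \<in> X"
  shows "measure M ({\<omega> \<in> space M. \<forall>i\<le>k. Y i \<omega> = x i} \<inter> A (k + n)) =
      measure M {\<omega> \<in> space M. \<forall>i\<le>k. Y i \<omega> = x i} * \<phi> n (x k)"
  using x
proof (induction n arbitrary: k x)
  case 0
  then show ?case using base by simp
next
  case (Suc n)
  interpret prob_space M using mc by (simp add: markov_chain_def)
  have [measurable]: "Y n \<in> M \<rightarrow>\<^sub>M count_space X" for n
    using mc by (simp add: markov_chain_def)
  have law: "prob {\<omega> \<in> space M. \<forall>i\<le>n. Y i \<omega> = x i} =
      (if x 0 = x0 then 1 else 0) * (\<Prod>i<n. K (x i) (x (Suc i)))" if "\<And>i. x i \<in> X" for n x
    using mc that by (simp add: markov_chain_def)
  let ?H = "\<lambda>k x. {\<omega> \<in> space M. \<forall>i\<le>k. Y i \<omega> = x i}"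
  have HM: "?H k x \<in> sets M" if "\<And>i. x i \<in> X" for k x
  proof -
    have "{\<omega> \<in> space M. Y i \<omega> = x i} \<in> sets M" for i
    proof -
      have "{\<omega> \<in> space M. Y i \<omega> = x i} = Y i -` {x i} \<inter> space M" by auto
      also have "\<dots> \<in> sets M" using that by (intro measurable_sets[of _ _ "count_space X"]) auto
      finally show ?thesis .
    qed
    then show ?thesis by (intro sets.sets_Collect_countable_All sets.sets_Collect_imp) auto
  qed
  have ae: "AE \<omega> in M. \<forall>n. Y (Suc n) \<omega> \<in> nb (Y n \<omega>)"
    by (rule markov_chain_AE_successor(2)[OF mc X]) (rule K)
  define z where "z y = x(Suc k := y)" for y
  have z: "\<And>i. z y i \<in> X" if "y \<in> nb (x k)" for y
    using Suc.prems that nb(2)[OF Suc.prems] by (auto simp: z_def)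
  have Hz: "?H (Suc k) (z y) = {\<omega> \<in> ?H k x. Y (Suc k) \<omega> = y}" for y
    by (auto simp: z_def le_Suc_eq)
  have "prob (?H k x \<inter> A (k + Suc n)) = prob (\<Union>y\<in>nb (x k). ?H (Suc k) (z y) \<inter> A (Suc k + n))"
  proof (rule finite_measure_eq_AE)
    show "AE \<omega> in M. \<omega> \<in> ?H k x \<inter> A (k + Suc n) \<longleftrightarrow>
        \<omega> \<in> (\<Union>y\<in>nb (x k). ?H (Suc k) (z y) \<inter> A (Suc k + n))"
      using ae
    proof eventually_elim
      case (elim \<omega>)
      show ?case unfolding Hz using elim[rule_format, of k] by auto
    qed
    show "(\<Union>y\<in>nb (x k). ?H (Suc k) (z y) \<inter> A (Suc k + n)) \<in> sets M"
      using nb(1)[OF Suc.prems] HM[OF z] A by (intro sets.finite_UN sets.Int) auto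
  qed (use HM[OF Suc.prems] A in auto)
  also have "\<dots> = (\<Sum>y\<in>nb (x k). prob (?H (Suc k) (z y) \<inter> A (Suc k + n)))"
    using nb(1)[OF Suc.prems] HM[OF z] A
    by (intro finite_measure_finite_Union) (auto simp: Hz disjoint_family_on_def)
  also have "\<dots> = (\<Sum>y\<in>nb (x k). prob (?H k x) * (K (x k) y * \<phi> n y))"
  proof (rule sum.cong[OF refl])
    fix y assume y: "y \<in> nb (x k)"
    have "(\<Prod>i<k. K (z y i) (z y (Suc i))) = (\<Prod>i<k. K (x i) (x (Suc i)))"
      by (intro prod.cong) (auto simp: z_def)
    then have "prob (?H (Suc k) (z y)) = prob (?H k x) * K (x k) y"
      unfolding law[OF z[OF y]] law[OF Suc.prems] by (simp add: z_def)
    then show "prob (?H (Suc k) (z y) \<inter> A (Suc k + n)) = prob (?H k x) * (K (x k) y * \<phi> n y)"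
      using Suc.IH[OF z[OF y], of "Suc k"] by (simp add: z_def)
  qed
  also have "\<dots> = prob (?H k x) * \<phi> (Suc n) (x k)"
    using step[OF Suc.prems] by (simp add: sum_distrib_left)
  finally show ?case .
qed

lemma (in finite_measure) tendsto_measure_eventually_eq:
  assumes "\<And>n. {\<omega> \<in> space M. P n \<omega>} \<in> sets M" "{\<omega> \<in> space M. Q \<omega>} \<in> sets M"
    and "AE \<omega> in M. \<forall>\<^sub>F n in sequentially. P n \<omega> \<longleftrightarrow> Q \<omega>"
  shows "(\<lambda>n. measure M {\<omega> \<in> space M. P n \<omega>}) \<longlonglongrightarrow> measure M {\<omega> \<in> space M. Q \<omega>}"
proof -
  let ?I = "\<lambda>A. indicator A :: 'a \<Rightarrow> real"
  have "(\<lambda>n. \<integral>\<omega>. ?I {\<omega> \<in> space M. P n \<omega>} \<omega> \<partial>M) \<longlonglongrightarrow> (\<integral>\<omega>. ?I {\<omega> \<in> space M. Q \<omega>} \<omega> \<partial>M)"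
  proof (rule integral_dominated_convergence[where w = "\<lambda>_. 1"])
    show "AE \<omega> in M. (\<lambda>n. ?I {\<omega> \<in> space M. P n \<omega>} \<omega>) \<longlonglongrightarrow> ?I {\<omega> \<in> space M. Q \<omega>} \<omega>"
      using assms(3)
    proof eventually_elim
      case (elim \<omega>)
      show ?case
        by (rule tendsto_eventually) (use elim in eventually_elim, auto simp: indicator_def)
    qed
  qed (use assms in \<open>auto simp: indicator_def\<close>)
  then show ?thesis using assms by simp
qed

section \<open>Nearest-neighbour walks\<close>

locale boundary_walk = finite_free_product d m Gs
  for d m :: nat and Gs :: "nat \<Rightarrow> 'a monoid" +
  fixes p :: "'a letter list \<Rightarrow> real^'r^'r"
    and M :: "'r \<Rightarrow> 'w measure"
    and Y :: "nat \<Rightarrow> 'w \<Rightarrow> 'a letter list \<times> 'r"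
    and Yinf :: "'w \<Rightarrow> 'a letter stream"
  assumes family: "colour_family GP p"
    and nearest_neighbour: "walk_support GP p \<subseteq> generators d m Gs"
    and walk: "coloured_walk GP p M Y"
    and limit: "is_boundary_limit d m Gs M Y Yinf"
begin

text \<open>
  \<open>q n u\<close> is the law at time \<open>n\<close> of the walk started at \<open>(e, u)\<close>; the finite set \<open>D n\<close> carries it.
  \<open>nu (x, v)\<close> is the law of the limit of the walk started at \<open>(x, v)\<close>, namely the translate by \<open>x\<close>
  of the harmonic measure of the colour \<open>v\<close>.
\<close>

abbreviation "X \<equiv> W \<times> (UNIV :: 'r set)"
abbreviation "K \<equiv> walk_kernel GP p"
definition "q n u y = kernel_pow X K n ([], u) y"
definition "D n = {x \<in> W. length x \<le> n} \<times> (UNIV :: 'r set)"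
abbreviation "pinf u \<equiv> harmonic_measure d m Gs M Yinf u"
definition "nu y = act_measure d m Gs (fst y) (pinf (snd y))"

lemma states_eq: "states GP = X" by (simp add: states_def free_prod_def)

lemma carrier_eq: "carrier GP = W" by (simp add: free_prod_def)

lemma mult_eq: "x \<otimes>\<^bsub>GP\<^esub> y = foldr mu x y" by (simp add: free_prod_def)

lemma p_outside: "g \<in> W \<Longrightarrow> g \<notin> (\<lambda>s. [s]) ` L \<Longrightarrow> p g = 0"
  using nearest_neighbour by (auto simp: walk_support_def generators_def carrier_eq)

lemma p_nonneg: "s \<in> L \<Longrightarrow> 0 \<le> p [s] $ u $ v"
  using family sing_W by (auto simp: colour_family_def carrier_eq)

lemma infsum_letters:
  fixes F :: "'a letter list \<Rightarrow> 'c :: {topological_comm_monoid_add, t2_space}"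
  assumes "\<And>g. p g = 0 \<Longrightarrow> F g = 0"
  shows "(\<Sum>\<^sub>\<infinity>g\<in>carrier GP. F g) = (\<Sum>s\<in>L. F [s])"
proof -
  have "(\<Sum>\<^sub>\<infinity>g\<in>carrier GP. F g) = (\<Sum>\<^sub>\<infinity>g\<in>(\<lambda>s. [s]) ` L. F g)"
    by (rule infsum_cong_neutral) (auto simp: carrier_eq sing_W intro!: assms p_outside)
  also have "\<dots> = (\<Sum>s\<in>L. F [s])"
    by (simp add: infsum_finite finite_L sum.reindex inj_on_def)
  finally show ?thesis .
qed

lemma colour_matrix_eq: "colour_matrix GP p = (\<Sum>s\<in>L. p [s])"
  unfolding colour_matrix_def by (rule infsum_letters)

definition "nb x = (\<lambda>(s, v). (foldr mu (fst x) [s], v)) ` (L \<times> (UNIV :: 'r set))"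

lemma inv_mult_cancel:
  assumes "x \<in> W" "y \<in> W"
  shows "inv\<^bsub>GP\<^esub> x \<otimes>\<^bsub>GP\<^esub> foldr mu x y = y"
proof -
  interpret group GP by (rule group_free_prod)
  have c: "x \<in> carrier GP" "y \<in> carrier GP" using assms by (simp_all only: carrier_eq)
  have "inv\<^bsub>GP\<^esub> x \<otimes>\<^bsub>GP\<^esub> (x \<otimes>\<^bsub>GP\<^esub> y) = (inv\<^bsub>GP\<^esub> x \<otimes>\<^bsub>GP\<^esub> x) \<otimes>\<^bsub>GP\<^esub> y"
    by (rule m_assoc[symmetric]) (intro inv_closed c)+
  also have "\<dots> = y" by (simp only: l_inv[OF c(1)] l_one[OF c(2)])
  finally show ?thesis unfolding mult_eq .
qed

lemma mult_inv_cancel: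
  assumes "x \<in> W" "y \<in> W"
  shows "foldr mu x (inv\<^bsub>GP\<^esub> x \<otimes>\<^bsub>GP\<^esub> y) = y"
proof -
  interpret group GP by (rule group_free_prod)
  have c: "x \<in> carrier GP" "y \<in> carrier GP" using assms by (simp_all only: carrier_eq)
  have "x \<otimes>\<^bsub>GP\<^esub> (inv\<^bsub>GP\<^esub> x \<otimes>\<^bsub>GP\<^esub> y) = (x \<otimes>\<^bsub>GP\<^esub> inv\<^bsub>GP\<^esub> x) \<otimes>\<^bsub>GP\<^esub> y"
    by (rule m_assoc[symmetric]) (intro inv_closed c)+
  also have "\<dots> = y" by (simp only: r_inv[OF c(1)] l_one[OF c(2)])
  finally show ?thesis unfolding mult_eq .
qed

lemma mult_left_inj:
  assumes "x \<in> W" "y \<in> W" "z \<in> W" "foldr mu x y = foldr mu x z"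
  shows "y = z"
  using inv_mult_cancel[OF assms(1,3)] unfolding assms(4)[symmetric] inv_mult_cancel[OF assms(1,2)] .

lemma K_step: "x \<in> W \<Longrightarrow> s \<in> L \<Longrightarrow> K (x, u) (foldr mu x [s], v) = p [s] $ u $ v"
  unfolding walk_kernel_def fst_conv snd_conv by (simp only: inv_mult_cancel sing_W)

lemma K_outside:
  assumes "x \<in> X" "y \<in> X" "y \<notin> nb x"
  shows "K x y = 0"
proof (rule ccontr)
  let ?z = "inv\<^bsub>GP\<^esub> (fst x) \<otimes>\<^bsub>GP\<^esub> fst y"
  interpret group GP by (rule group_free_prod)
  have xy: "fst x \<in> W" "fst y \<in> W" using assms(1,2) by auto
  assume "K x y \<noteq> 0"
  then have "p ?z \<noteq> 0" unfolding walk_kernel_def by (rule contrapos_nn) simp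
  moreover have "?z \<in> carrier GP"
    by (intro m_closed inv_closed) (simp_all only: carrier_eq xy)
  then have "?z \<in> W" unfolding carrier_eq .
  ultimately obtain s where s: "s \<in> L" "?z = [s]" using p_outside by blast
  have "foldr mu (fst x) [s] = fst y"
    using mult_inv_cancel[OF xy] unfolding s(2) .
  then have "y = (\<lambda>(s, v). (foldr mu (fst x) [s], v)) (s, snd y)" by simp
  then have "y \<in> nb x" unfolding nb_def using s(1) by blast
  then show False using assms(3) by simp
qed

lemma finite_nb: "finite (nb x)" by (simp add: nb_def finite_L)

lemma nb_states: "x \<in> X \<Longrightarrow> nb x \<subseteq> X"
  by (auto simp: nb_def intro!: fold_W W_set sing_W simp del: foldr.simps)

lemma sum_nb:
  assumes "x \<in> W"
  shows "(\<Sum>y\<in>nb (x, u). K (x, u) y * F y) = (\<Sum>s\<in>L. \<Sum>v\<in>UNIV. p [s] $ u $ v * F (foldr mu x [s], v))"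
proof -
  have "inj_on (\<lambda>(s, v). (foldr mu x [s], v)) (L \<times> (UNIV :: 'r set))"
    using mult_left_inj[OF assms sing_W sing_W] by (intro inj_onI) (auto simp del: foldr.simps)
  then have "(\<Sum>y\<in>nb (x, u). K (x, u) y * F y) =
      (\<Sum>(s, v)\<in>L \<times> UNIV. K (x, u) (foldr mu x [s], v) * F (foldr mu x [s], v))"
    unfolding nb_def fst_conv by (subst sum.reindex) (simp_all add: case_prod_unfold comp_def)
  also have "\<dots> = (\<Sum>s\<in>L. \<Sum>v\<in>UNIV. K (x, u) (foldr mu x [s], v) * F (foldr mu x [s], v))"
    by (simp add: sum.cartesian_product)
  also have "\<dots> = (\<Sum>s\<in>L. \<Sum>v\<in>UNIV. p [s] $ u $ v * F (foldr mu x [s], v))"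
    by (intro sum.cong refl) (simp add: K_step[OF assms] del: foldr.simps)
  finally show ?thesis .
qed

lemma kernel_pow_nb:
  assumes "x \<in> X"
  shows "kernel_pow X K (Suc n) x y = (\<Sum>z\<in>nb x. K x z * kernel_pow X K n z y)"
proof -
  have "kernel_pow X K (Suc n) x y = (\<Sum>\<^sub>\<infinity>z\<in>nb x. K x z * kernel_pow X K n z y)"
    unfolding kernel_pow.simps
    by (rule infsum_cong_neutral) (use assms nb_states[OF assms] K_outside in auto)
  then show ?thesis by (simp add: finite_nb)
qed

lemma kernel_pow_Suc:
  assumes "x \<in> W"
  shows "kernel_pow X K (Suc n) (x, u) y =
    (\<Sum>s\<in>L. \<Sum>v\<in>UNIV. p [s] $ u $ v * kernel_pow X K n (foldr mu x [s], v) y)"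
  using assms by (subst kernel_pow_nb) (auto simp: sum_nb simp del: foldr.simps)

lemma fold_sing_W: "x \<in> W \<Longrightarrow> s \<in> L \<Longrightarrow> foldr mu x [s] \<in> W"
  by (intro fold_W W_set sing_W)

lemma kernel_pow_translate:
  assumes "g \<in> W" "x \<in> W" "y \<in> W"
  shows "kernel_pow X K n (foldr mu g x, u) (foldr mu g y, v) = kernel_pow X K n (x, u) (y, v)"
  using assms(2)
proof (induction n arbitrary: x u)
  case 0
  then show ?case using mult_left_inj[OF assms(1) _ assms(3), of x] by auto
next
  case (Suc n)
  have "foldr mu (foldr mu g x) [s] = foldr mu g (foldr mu x [s])" if "s \<in> L" for s
    using assms(1) Suc.prems sing_W[OF that] by (intro fold_assoc W_set)
  then show ?case
    using assms(1) Suc.prems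
    by (simp only: kernel_pow_Suc fold_W W_set Suc.IH fold_sing_W cong: sum.cong)
qed

lemma q_0: "q 0 u y = (if y = ([], u) then 1 else 0)" by (auto simp: q_def)

text \<open>
  Decomposition according to the first step: after a step \<open>s\<close> the walk is the translate by \<open>s\<close> of a
  walk started at the identity.
\<close>

lemma q_Suc:
  assumes "y \<in> W"
  shows "q (Suc n) u (y, w) = (\<Sum>s\<in>L. \<Sum>v\<in>UNIV. p [s] $ u $ v * q n v (mu (ginv s) y, w))"
proof -
  have "kernel_pow X K n ([s], v) (y, w) = q n v (mu (ginv s) y, w)" if "s \<in> L" for s v
    using kernel_pow_translate[OF sing_W[OF that] W_Nil mu_W[OF inv_L[OF that] assms], of n v w] that
      mu_ginv'[OF that assms]
    by (simp add: q_def letter_mult_word_def[of _ _ _ _ "[]"])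
  moreover have "foldr mu [] [s] = [s]" for s by simp
  ultimately show ?thesis unfolding q_def[of "Suc n"]
    by (simp only: kernel_pow_Suc[OF W_Nil] cong: sum.cong)
qed

lemma finite_D: "finite (D n)"
proof -
  have "{x \<in> W. length x \<le> n} \<subseteq> {xs. set xs \<subseteq> L \<and> length xs \<le> n}" using W_set by auto
  then show ?thesis unfolding D_def
    using finite_subset[OF _ finite_lists_length_le[OF finite_L]] by (intro finite_cartesian_product) auto
qed

lemma D_X: "D n \<subseteq> X" by (auto simp: D_def)

lemma q_nonneg: "y \<in> X \<Longrightarrow> 0 \<le> q n u y"
proof (induction n arbitrary: u y)
  case (Suc n)
  then obtain x w where y: "y = (x, w)" "x \<in> W" by auto
  show ?case unfolding y(1) q_Suc[OF y(2)]
    using y Suc.IH by (intro sum_nonneg mult_nonneg_nonneg p_nonneg) (auto simp: mu_W inv_L)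
qed (simp add: q_0)

lemma q_outside: "y \<in> X \<Longrightarrow> y \<notin> D n \<Longrightarrow> q n u y = 0"
proof (induction n arbitrary: u y)
  case (Suc n)
  obtain x w where y: "y = (x, w)" by (cases y)
  with Suc.prems have y: "y = (x, w)" "x \<in> W" "length x > Suc n" by (auto simp: D_def)
  have "q n v (mu (ginv s) x, w) = 0" if "s \<in> L" for s v
  proof (rule Suc.IH)
    show "(mu (ginv s) x, w) \<notin> D n"
      using length_mu_le[of s "mu (ginv s) x"] mu_ginv'[OF that y(2)] y(3) by (simp add: D_def)
  qed (simp add: mu_W inv_L that y)
  then show ?case unfolding y(1) q_Suc[OF y(2)] by simp
qed (auto simp: q_0 D_def W_Nil)

text \<open>
  The first-step decomposition for expectations; the increments of the mean length and of the mean
  information are both computed from it.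
\<close>

lemma sum_q_Suc:
  fixes F :: "'a letter list \<times> 'r \<Rightarrow> real"
  shows "(\<Sum>y\<in>D (Suc n). q (Suc n) u y * F y) =
    (\<Sum>s\<in>L. \<Sum>v\<in>UNIV. p [s] $ u $ v * (\<Sum>y\<in>D n. q n v y * F (mu s (fst y), snd y)))"
proof -
  have "(\<Sum>y\<in>D (Suc n). q n v (mu (ginv s) (fst y), snd y) * F y) =
      (\<Sum>y\<in>D n. q n v y * F (mu s (fst y), snd y))" if s: "s \<in> L" for s v
  proof -
    let ?t = "\<lambda>y :: 'a letter list \<times> 'r. (mu s (fst y), snd y)"
    have inj: "inj_on ?t (D n)"
      using mu_ginv[OF s] by (intro inj_on_inverseI[where g = "\<lambda>y. (mu (ginv s) (fst y), snd y)"]) (auto simp: D_def)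
    have sub: "?t ` D n \<subseteq> D (Suc n)"
      using length_mu_le[of s] le_trans mu_W[OF s] by (fastforce simp: D_def)
    have "(\<Sum>y\<in>D (Suc n). q n v (mu (ginv s) (fst y), snd y) * F y) =
        (\<Sum>y\<in>?t ` D n. q n v (mu (ginv s) (fst y), snd y) * F y)"
    proof (rule sum.mono_neutral_right[OF finite_D sub], rule ballI)
      fix y assume y: "y \<in> D (Suc n) - ?t ` D n"
      let ?z = "(mu (ginv s) (fst y), snd y)"
      have "y = ?t ?z" using mu_ginv'[OF s, of "fst y"] y by (auto simp: D_def)
      then have "?z \<notin> D n" using y by blast
      moreover have "?z \<in> X" using y mu_W[OF inv_L[OF s]] by (auto simp: D_def)
      ultimately show "q n v ?z * F y = 0" by (simp add: q_outside)
    qed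
    also have "\<dots> = (\<Sum>y\<in>D n. q n v (mu (ginv s) (fst (?t y)), snd (?t y)) * F (?t y))"
      by (subst sum.reindex[OF inj]) simp
    also have "\<dots> = (\<Sum>y\<in>D n. q n v y * F (?t y))"
      by (intro sum.cong refl) (auto simp: D_def mu_ginv[OF s])
    finally show ?thesis .
  qed
  note e = this
  have "(\<Sum>y\<in>D (Suc n). q (Suc n) u y * F y) =
    (\<Sum>y\<in>D (Suc n). \<Sum>s\<in>L. \<Sum>v\<in>UNIV. p [s] $ u $ v * (q n v (mu (ginv s) (fst y), snd y) * F y))"
    by (intro sum.cong refl) (auto simp: D_def q_Suc sum_distrib_right mult.assoc)
  also have "\<dots> = (\<Sum>s\<in>L. \<Sum>v\<in>UNIV. \<Sum>y\<in>D (Suc n). p [s] $ u $ v * (q n v (mu (ginv s) (fst y), snd y) * F y))"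
    by (subst sum.swap) (intro sum.cong refl, subst sum.swap, rule refl)
  also have "\<dots> = (\<Sum>s\<in>L. \<Sum>v\<in>UNIV. p [s] $ u $ v * (\<Sum>y\<in>D n. q n v y * F (mu s (fst y), snd y)))"
    by (intro sum.cong refl) (simp add: sum_distrib_left[symmetric] e)
  finally show ?thesis .
qed

end

section \<open>The joint law of the position and of the limit\<close>

context boundary_walk
begin

abbreviation "H u k x \<equiv> {\<omega> \<in> space (M u). \<forall>i\<le>k. Y i \<omega> = x i}"

lemma chain: "markov_chain (M u) Y X K ([], u)"
proof -
  have "\<one>\<^bsub>GP\<^esub> = []" by (simp add: free_prod_def)
  then show ?thesis using walk unfolding coloured_walk_def states_eq by metis
qed

lemma prob_M: "prob_space (M u)"
  using chain by (simp add: markov_chain_def)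

lemma measurable_Y: "Y n \<in> M u \<rightarrow>\<^sub>M count_space X"
  using chain[of u] by (simp add: markov_chain_def)

lemma measurable_Yinf: "Yinf \<in> M u \<rightarrow>\<^sub>M Bd"
  using limit by (simp add: is_boundary_limit_def)

lemma Y_X: "\<omega> \<in> space (M u) \<Longrightarrow> Y n \<omega> \<in> X"
  using measurable_space[OF measurable_Y] by simp

lemma Y_W: "\<omega> \<in> space (M u) \<Longrightarrow> fst (Y n \<omega>) \<in> W"
  using Y_X[of \<omega> u n] by (simp add: mem_Times_iff)

lemma Yinf_BS: "\<omega> \<in> space (M u) \<Longrightarrow> Yinf \<omega> \<in> BS"
  using measurable_space[OF measurable_Yinf] by (simp add: space_boundary)

lemma Y_sets: "{\<omega> \<in> space (M u). P (Y n \<omega>)} \<in> sets (M u)"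
proof -
  have "{\<omega> \<in> space (M u). P (Y n \<omega>)} = Y n -` {y \<in> X. P y} \<inter> space (M u)"
    using Y_X by auto
  also have "\<dots> \<in> sets (M u)" by (rule measurable_sets[OF measurable_Y]) auto
  finally show ?thesis .
qed

lemma Yinf_sets: "A \<in> sets Bd \<Longrightarrow> {\<omega> \<in> space (M u). Yinf \<omega> \<in> A} \<in> sets (M u)"
  using measurable_sets[OF measurable_Yinf, of A u] by (simp add: vimage_def Int_def conj_commute)

lemma H_sets: "H u k x \<in> sets (M u)"
  by (intro sets.sets_Collect_countable_All sets.sets_Collect_imp Y_sets)

lemma countable_X: "countable X"
proof -
  have "W \<subseteq> lists L" using W_set by auto
  then have "countable W"
    using countable_subset countable_lists[OF countable_finite[OF finite_L]] by blast
  then show ?thesis by simp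
qed

lemma AE_start: "AE \<omega> in M u. Y 0 \<omega> = ([], u)"
  by (rule markov_chain_AE_successor(1)[OF chain countable_X]) (rule K_outside)

lemma AE_nb: "AE \<omega> in M u. \<forall>n. Y (Suc n) \<omega> \<in> nb (Y n \<omega>)"
  by (rule markov_chain_AE_successor(2)[OF chain countable_X]) (rule K_outside)

lemma nb_length: "x \<in> D n \<Longrightarrow> y \<in> nb x \<Longrightarrow> y \<in> D (Suc n)"
proof -
  assume x: "x \<in> D n" and "y \<in> nb x"
  then obtain s v where y: "s \<in> L" "y = (foldr mu (fst x) [s], v)" by (auto simp: nb_def)
  have xW: "fst x \<in> W" "length (fst x) \<le> n" using x by (auto simp: D_def)
  have "length (foldr mu (fst x) [s]) \<le> Suc (length (fst x))"
    using right_mult[OF xW(1) y(1)] by auto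
  then show ?thesis using fold_sing_W[OF xW(1) y(1)] xW(2) unfolding D_def y(2) by auto
qed

lemma AE_D: "AE \<omega> in M u. \<forall>n. Y n \<omega> \<in> D n"
  using AE_start AE_nb
proof eventually_elim
  case (elim \<omega>)
  have "Y n \<omega> \<in> D n" for n
  proof (induction n)
    case 0
    then show ?case using elim(1) by (simp add: D_def W_Nil)
  next
    case (Suc n)
    then show ?case using nb_length elim(2) by blast
  qed
  then show ?case by blast
qed

lemma walk_future:
  assumes A: "\<And>n. A n \<in> sets (M u)"
    and base: "\<And>k x. (\<And>i. x i \<in> X) \<Longrightarrow> measure (M u) (H u k x \<inter> A k) = measure (M u) (H u k x) * \<phi> 0 (x k)"
    and step: "\<And>n x v. x \<in> W \<Longrightarrow>
      \<phi> (Suc n) (x, v) = (\<Sum>s\<in>L. \<Sum>w\<in>UNIV. p [s] $ v $ w * \<phi> n (foldr mu x [s], w))"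
    and x: "\<And>i. x i \<in> X"
  shows "measure (M u) (H u k x \<inter> A (k + n)) = measure (M u) (H u k x) * \<phi> n (x k)"
proof (rule markov_chain_future[where nb = nb and \<phi> = \<phi>, OF chain countable_X finite_nb nb_states _ A base _ x])
  show "\<phi> (Suc n) x = (\<Sum>y\<in>nb x. K x y * \<phi> n y)" if "x \<in> X" for n x
  proof -
    obtain z v where x: "x = (z, v)" by (cases x)
    then have z: "z \<in> W" using that by simp
    show ?thesis unfolding x step[OF z] sum_nb[OF z] ..
  qed
qed (auto intro: K_outside)

lemma prob_H0: "measure (M u) (H u 0 (\<lambda>_. ([], u))) = 1"
proof -
  interpret prob_space "M u" by (rule prob_M)
  have "{\<omega> \<in> space (M u). Y 0 \<omega> = ([], u)} \<in> sets (M u)" by (rule Y_sets)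
  then show ?thesis using AE_start[of u] by (subst prob_eq_1) auto
qed

lemma walk_future_start:
  assumes A: "\<And>n. A n \<in> sets (M u)"
    and base: "\<And>k x. (\<And>i. x i \<in> X) \<Longrightarrow> measure (M u) (H u k x \<inter> A k) = measure (M u) (H u k x) * \<phi> 0 (x k)"
    and step: "\<And>n x v. x \<in> W \<Longrightarrow>
      \<phi> (Suc n) (x, v) = (\<Sum>s\<in>L. \<Sum>w\<in>UNIV. p [s] $ v $ w * \<phi> n (foldr mu x [s], w))"
  shows "measure (M u) (A n) = \<phi> n ([], u)"
proof -
  interpret prob_space "M u" by (rule prob_M)
  have "prob (A n) = prob (H u 0 (\<lambda>_. ([], u)) \<inter> A (0 + n))"
  proof (rule finite_measure_eq_AE)
    show "AE \<omega> in M u. (\<omega> \<in> A n) = (\<omega> \<in> H u 0 (\<lambda>_. ([], u)) \<inter> A (0 + n))"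
      using AE_start[of u] AE_space by eventually_elim simp
  qed (intro A sets.Int H_sets)+
  also have "\<dots> = prob (H u 0 (\<lambda>_. ([], u))) * \<phi> n ([], u)"
    by (rule walk_future[where x = "\<lambda>_. ([], u)", OF A base step]) (auto simp: W_Nil)
  finally show ?thesis unfolding prob_H0 by simp
qed

lemma law_Y:
  assumes z: "z \<in> X"
  shows "measure (M u) {\<omega> \<in> space (M u). Y n \<omega> = z} = q n u z"
  unfolding q_def
proof (rule walk_future_start[where \<phi> = "\<lambda>n x. kernel_pow X K n x z"])
  show "{\<omega> \<in> space (M u). Y n \<omega> = z} \<in> sets (M u)" for n by (rule Y_sets)
  show "measure (M u) (H u k x \<inter> {\<omega> \<in> space (M u). Y k \<omega> = z}) =
      measure (M u) (H u k x) * kernel_pow X K 0 (x k) z" for k x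
  proof (cases "x k = z")
    case True
    then have "H u k x \<inter> {\<omega> \<in> space (M u). Y k \<omega> = z} = H u k x" by auto
    then show ?thesis using True by simp
  next
    case False
    then have "H u k x \<inter> {\<omega> \<in> space (M u). Y k \<omega> = z} = {}" by auto
    then show ?thesis using False by (simp only: kernel_pow.simps if_False measure_empty mult_zero_right)
  qed
qed (rule kernel_pow_Suc)

lemma integral_Y:
  fixes F :: "'a letter list \<times> 'r \<Rightarrow> real"
  shows "integrable (M u) (\<lambda>\<omega>. F (Y n \<omega>))"
    and "(\<integral>\<omega>. F (Y n \<omega>) \<partial>M u) = (\<Sum>y\<in>D n. q n u y * F y)"
proof -
  interpret prob_space "M u" by (rule prob_M)
  let ?E = "\<lambda>y. {\<omega> \<in> space (M u). Y n \<omega> = y}"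
  let ?G = "\<lambda>\<omega>. \<Sum>y\<in>D n. F y * indicator (?E y) \<omega>"
  have I: "integrable (M u) (indicator (?E y) :: _ \<Rightarrow> real)" for y
    by (rule integrable_real_indicator[OF Y_sets]) (simp add: emeasure_eq_measure)
  then have G: "integrable (M u) ?G"
    by (intro Bochner_Integration.integrable_sum integrable_mult_right)
  have AE: "AE \<omega> in M u. F (Y n \<omega>) = ?G \<omega>"
    using AE_D[of u] AE_space
  proof eventually_elim
    case (elim \<omega>)
    have "?G \<omega> = (\<Sum>y\<in>D n. if y = Y n \<omega> then F y else 0)"
      using elim(2) by (intro sum.cong) (auto simp: indicator_def)
    then show ?case using elim(1) by (simp add: finite_D)
  qed
  have meas: "(\<lambda>\<omega>. F (Y n \<omega>)) \<in> borel_measurable (M u)"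
    by (rule measurable_compose[OF measurable_Y]) simp
  show "integrable (M u) (\<lambda>\<omega>. F (Y n \<omega>))"
    using integrable_cong_AE[OF meas borel_measurable_integrable[OF G] AE] G by blast
  have "(\<integral>\<omega>. F (Y n \<omega>) \<partial>M u) = (\<integral>\<omega>. ?G \<omega> \<partial>M u)"
    by (rule integral_cong_AE[OF meas borel_measurable_integrable[OF G] AE])
  also have "\<dots> = (\<Sum>y\<in>D n. \<integral>\<omega>. F y * indicator (?E y) \<omega> \<partial>M u)"
    by (intro Bochner_Integration.integral_sum integrable_mult_right I)
  also have "\<dots> = (\<Sum>y\<in>D n. q n u y * F y)"
  proof (rule sum.cong[OF refl])
    fix y assume "y \<in> D n"
    then have "y \<in> X" using D_X by blast
    moreover have "?E y \<inter> space (M u) = ?E y" by auto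
    ultimately show "(\<integral>\<omega>. F y * indicator (?E y) \<omega> \<partial>M u) = q n u y * F y"
      using law_Y[of y u n] by simp
  qed
  finally show "(\<integral>\<omega>. F (Y n \<omega>) \<partial>M u) = (\<Sum>y\<in>D n. q n u y * F y)" .
qed

lemma AE_limit: "AE \<omega> in M u. words_tendsto (\<lambda>n. fst (Y n \<omega>)) (Yinf \<omega>)"
  using limit by (simp add: is_boundary_limit_def)

lemma prob_pinf: "prob_space (pinf u)"
  unfolding harmonic_measure_def by (rule prob_space.prob_space_distr[OF prob_M measurable_Yinf])

lemma sets_pinf: "sets (pinf u) = sets Bd"
  by (simp add: harmonic_measure_def)

lemma sets_nu: "sets (nu y) = sets Bd"
  by (simp add: nu_def act_measure_def)

lemma measurable_bact_pinf: "x \<in> W \<Longrightarrow> bact x \<in> pinf u \<rightarrow>\<^sub>M Bd"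
  using measurable_bact[of x] measurable_cong_sets[OF sets_pinf refl] by blast

lemma prob_nu: "y \<in> X \<Longrightarrow> prob_space (nu y)"
  unfolding nu_def act_measure_def
  by (intro prob_space.prob_space_distr[OF prob_pinf] measurable_bact_pinf) auto

lemma measure_pinf:
  "A \<in> sets Bd \<Longrightarrow> measure (pinf u) A = measure (M u) {\<omega> \<in> space (M u). Yinf \<omega> \<in> A}"
  unfolding harmonic_measure_def
  by (subst measure_distr[OF measurable_Yinf]) (auto intro!: arg_cong[where f = "measure (M u)"])

lemma measure_nu:
  assumes "x \<in> W" "A \<in> sets Bd"
  shows "measure (nu (x, v)) A = measure (M v) {\<omega> \<in> space (M v). bact x (Yinf \<omega>) \<in> A}"
proof -
  have "measure (nu (x, v)) A = measure (pinf v) (bact x -` A \<inter> space (pinf v))"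
    unfolding nu_def act_measure_def fst_conv snd_conv
    by (rule measure_distr[OF measurable_bact_pinf[OF assms(1)] assms(2)])
  also have "space (pinf v) = space Bd" by (rule sets_eq_imp_space_eq[OF sets_pinf])
  also have "measure (pinf v) (bact x -` A \<inter> space Bd) =
      measure (M v) {\<omega> \<in> space (M v). Yinf \<omega> \<in> bact x -` A \<inter> space Bd}"
    by (rule measure_pinf) (rule measurable_sets[OF measurable_bact[OF assms(1)] assms(2)])
  also have "{\<omega> \<in> space (M v). Yinf \<omega> \<in> bact x -` A \<inter> space Bd} = {\<omega> \<in> space (M v). bact x (Yinf \<omega>) \<in> A}"
    using Yinf_BS by (auto simp: space_boundary)
  finally show ?thesis .
qed

text \<open>
  The Markov property for an event at infinity.  The event that the limit begins with \<open>w\<close> is almost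
  surely the limit of the events that \<open>Y (k + n)\<close> begins with \<open>w\<close>; for these the Markov property
  applies, and by continuity of the action their probabilities converge on both sides.
\<close>

lemma law_history_cylinder:
  assumes x: "\<And>i. x i \<in> X"
  shows "measure (M u) (H u k x \<inter> {\<omega> \<in> space (M u). stake l (Yinf \<omega>) = w}) =
    measure (M u) (H u k x) * measure (M (snd (x k))) {\<omega> \<in> space (M (snd (x k))). stake l (bact (fst (x k)) (Yinf \<omega>)) = w}"
proof -
  define \<phi> where "\<phi> n z = (\<Sum>y\<in>D n. q n (snd z) y * (if take l (foldr mu (fst z) (fst y)) = w then 1 else 0))"
    for n and z :: "'a letter list \<times> 'r"
  have fin: "finite_measure (M u)" for u using prob_M[of u] by (simp add: prob_space_def)
  have phi_prob: "\<phi> n z = measure (M (snd z)) {\<omega> \<in> space (M (snd z)). take l (foldr mu (fst z) (fst (Y n \<omega>))) = w}"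
    for n z
  proof -
    have "\<phi> n z = (\<integral>\<omega>. (if take l (foldr mu (fst z) (fst (Y n \<omega>))) = w then 1 else 0) \<partial>M (snd z))"
      unfolding \<phi>_def by (rule integral_Y(2)[symmetric])
    also have "\<dots> = (\<integral>\<omega>. indicator {\<omega> \<in> space (M (snd z)). take l (foldr mu (fst z) (fst (Y n \<omega>))) = w} \<omega> \<partial>M (snd z))"
      by (intro Bochner_Integration.integral_cong refl) (simp add: indicator_def)
    also have "\<dots> = measure (M (snd z)) {\<omega> \<in> space (M (snd z)). take l (foldr mu (fst z) (fst (Y n \<omega>))) = w}"
      by (simp, rule arg_cong[where f = "measure (M (snd z))"]) auto
    finally show ?thesis .
  qed
  have sets1: "{\<omega> \<in> space (M u). stake l (bact z (Yinf \<omega>)) = w} \<in> sets (M u)" if "z \<in> W" for u z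
  proof -
    have "{\<omega> \<in> space (M u). stake l (bact z (Yinf \<omega>)) = w} =
        {\<omega> \<in> space (M u). Yinf \<omega> \<in> bact z -` {\<xi> \<in> space Bd. stake l \<xi> = w} \<inter> space Bd}"
      using Yinf_BS act_boundary[OF that] by (auto simp: space_boundary)
    also have "\<dots> \<in> sets (M u)"
      by (intro Yinf_sets measurable_sets[OF measurable_bact[OF that]] cylinder_sets)
    finally show ?thesis .
  qed
  have act_lim: "AE \<omega> in M u. \<forall>\<^sub>F n in sequentially. take l (foldr mu z (fst (Y n \<omega>))) = w \<longleftrightarrow> stake l (bact z (Yinf \<omega>)) = w"
    for u z
    using AE_limit
  proof eventually_elim
    case (elim \<omega>)
    from words_tendsto_act[OF this, of z, unfolded words_tendsto_def, rule_format, of l]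
    show ?case by eventually_elim simp
  qed
  have R: "(\<lambda>n. \<phi> n (x k)) \<longlonglongrightarrow>
      measure (M (snd (x k))) {\<omega> \<in> space (M (snd (x k))). stake l (bact (fst (x k)) (Yinf \<omega>)) = w}"
    unfolding phi_prob using x[of k]
    by (intro finite_measure.tendsto_measure_eventually_eq[OF fin] Y_sets sets1 act_lim) auto
  have step: "measure (M u) (H u k x \<inter> {\<omega> \<in> space (M u). take l (fst (Y (k + n) \<omega>)) = w}) =
      measure (M u) (H u k x) * \<phi> n (x k)" for n
  proof (rule walk_future[where \<phi> = \<phi> and A = "\<lambda>j. {\<omega> \<in> space (M u). take l (fst (Y j \<omega>)) = w}"])
    show "{\<omega> \<in> space (M u). take l (fst (Y j \<omega>)) = w} \<in> sets (M u)" for j by (rule Y_sets)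
    show "measure (M u) (H u k x \<inter> {\<omega> \<in> space (M u). take l (fst (Y k \<omega>)) = w}) =
      measure (M u) (H u k x) * \<phi> 0 (x k)" if x: "\<And>i. x i \<in> X" for k x
    proof -
      have "\<phi> 0 (x k) = measure (M (snd (x k))) {\<omega> \<in> space (M (snd (x k))). take l (fst (x k)) = w}"
        unfolding phi_prob
      proof (rule finite_measure.finite_measure_eq_AE[OF fin])
        show "AE \<omega> in M (snd (x k)). (\<omega> \<in> {\<omega> \<in> space (M (snd (x k))). take l (foldr mu (fst (x k)) (fst (Y 0 \<omega>))) = w}) =
          (\<omega> \<in> {\<omega> \<in> space (M (snd (x k))). take l (fst (x k)) = w})"
          using AE_start[of "snd (x k)"]
        proof eventually_elim
          case (elim \<omega>)
          have "foldr mu (fst (x k)) [] = fst (x k)" using x[of k] by (intro fold_Nil) auto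
          then show ?case using elim by simp
        qed
      qed (auto intro: Y_sets sets.sets_Collect_const)
      also have "\<dots> = (if take l (fst (x k)) = w then 1 else 0)"
        using prob_space.prob_space[OF prob_M] by simp
      finally have p0: "\<phi> 0 (x k) = (if take l (fst (x k)) = w then 1 else 0)" .
      show ?thesis
      proof (cases "take l (fst (x k)) = w")
        case True
        then have "H u k x \<inter> {\<omega> \<in> space (M u). take l (fst (Y k \<omega>)) = w} = H u k x" by auto
        then show ?thesis using True p0 by simp
      next
        case False
        then have "H u k x \<inter> {\<omega> \<in> space (M u). take l (fst (Y k \<omega>)) = w} = {}" by auto
        then show ?thesis using False p0 by simp
      qed
    qed
    show "\<phi> (Suc n) (z, v) = (\<Sum>s\<in>L. \<Sum>w'\<in>UNIV. p [s] $ v $ w' * \<phi> n (foldr mu z [s], w'))"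
      if z: "z \<in> W" for n z v
    proof -
      have "foldr mu z (mu s (fst y)) = foldr mu (foldr mu z [s]) (fst y)" if "s \<in> L" "y \<in> D n" for s y
        using fold_assoc[OF W_set[OF z] sing_W[OF that(1)], of "fst y"] that by (simp add: D_def mem_Times_iff)
      then show ?thesis unfolding \<phi>_def fst_conv snd_conv sum_q_Suc
        by (simp only: fst_conv cong: sum.cong)
    qed
  qed (rule x)
  have "(\<lambda>n. measure (M u) {\<omega> \<in> space (M u). \<omega> \<in> H u k x \<and> take l (fst (Y (k + n) \<omega>)) = w}) \<longlonglongrightarrow>
      measure (M u) {\<omega> \<in> space (M u). \<omega> \<in> H u k x \<and> stake l (Yinf \<omega>) = w}"
  proof (rule finite_measure.tendsto_measure_eventually_eq[OF fin])
    have c1: "{\<omega> \<in> space (M u). \<omega> \<in> H u k x \<and> P \<omega>} = H u k x \<inter> {\<omega> \<in> space (M u). P \<omega>}" for P by auto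
    show "{\<omega> \<in> space (M u). \<omega> \<in> H u k x \<and> take l (fst (Y (k + n) \<omega>)) = w} \<in> sets (M u)" for n
      unfolding c1 by (intro sets.Int H_sets Y_sets)
    show "{\<omega> \<in> space (M u). \<omega> \<in> H u k x \<and> stake l (Yinf \<omega>) = w} \<in> sets (M u)"
      unfolding c1 using sets1[OF W_Nil] by (intro sets.Int H_sets) (simp add: boundary_act_def)
    show "AE \<omega> in M u. \<forall>\<^sub>F n in sequentially. (\<omega> \<in> H u k x \<and> take l (fst (Y (k + n) \<omega>)) = w) \<longleftrightarrow>
        (\<omega> \<in> H u k x \<and> stake l (Yinf \<omega>) = w)"
      using AE_limit
    proof eventually_elim
      case (elim \<omega>)
      then have "\<forall>\<^sub>F n in sequentially. take l (fst (Y n \<omega>)) = stake l (Yinf \<omega>)"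
        by (simp add: words_tendsto_def)
      then have "\<forall>\<^sub>F n in sequentially. take l (fst (Y (n + k) \<omega>)) = stake l (Yinf \<omega>)"
        by (rule eventually_compose_filterlim) (rule filterlim_add_const_nat_at_top)
      then show ?case by eventually_elim (simp add: add.commute)
    qed
  qed
  also have "(\<lambda>n. measure (M u) {\<omega> \<in> space (M u). \<omega> \<in> H u k x \<and> take l (fst (Y (k + n) \<omega>)) = w}) =
      (\<lambda>n. measure (M u) (H u k x) * \<phi> n (x k))"
    unfolding step[symmetric] by (intro ext arg_cong[where f = "measure (M u)"]) auto
  finally have "(\<lambda>n. measure (M u) (H u k x) * \<phi> n (x k)) \<longlonglongrightarrow>
      measure (M u) {\<omega> \<in> space (M u). \<omega> \<in> H u k x \<and> stake l (Yinf \<omega>) = w}" .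
  from LIMSEQ_unique[OF this tendsto_mult_left[OF R]]
  have "measure (M u) {\<omega> \<in> space (M u). \<omega> \<in> H u k x \<and> stake l (Yinf \<omega>) = w} =
    measure (M u) (H u k x) *
    measure (M (snd (x k))) {\<omega> \<in> space (M (snd (x k))). stake l (bact (fst (x k)) (Yinf \<omega>)) = w}" .
  moreover have "{\<omega> \<in> space (M u). \<omega> \<in> H u k x \<and> stake l (Yinf \<omega>) = w} =
    H u k x \<inter> {\<omega> \<in> space (M u). stake l (Yinf \<omega>) = w}" by auto
  ultimately show ?thesis by simp
qed

lemma law_history_Yinf:
  assumes x: "\<And>i. x i \<in> X" and A: "A \<in> sets Bd"
  shows "measure (M u) (H u k x \<inter> {\<omega> \<in> space (M u). Yinf \<omega> \<in> A}) =
    measure (M u) (H u k x) * measure (nu (x k)) A"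
proof -
  interpret prob_space "M u" by (rule prob_M)
  interpret n: prob_space "nu (x k)" by (rule prob_nu[OF x])
  \<comment> \<open>The restriction to the history is not normalised, so histories of probability zero are covered.\<close>
  define N1 where "N1 = distr (density (M u) (indicator (H u k x))) Bd Yinf"
  define N2 where "N2 = density (nu (x k)) (\<lambda>_. ennreal (prob (H u k x)))"
  have Yd: "Yinf \<in> density (M u) (indicator (H u k x)) \<rightarrow>\<^sub>M Bd"
    using measurable_Yinf[of u] by (simp add: measurable_density_eq1)
  have em1: "emeasure N1 A = prob (H u k x \<inter> {\<omega> \<in> space (M u). Yinf \<omega> \<in> A})" if A: "A \<in> sets Bd" for A
  proof -
    have S: "{\<omega> \<in> space (M u). Yinf \<omega> \<in> A} \<in> sets (M u)" by (rule Yinf_sets[OF A])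
    have "emeasure N1 A = emeasure (density (M u) (indicator (H u k x))) (Yinf -` A \<inter> space (M u))"
      unfolding N1_def by (subst emeasure_distr[OF Yd A]) simp
    also have "Yinf -` A \<inter> space (M u) = {\<omega> \<in> space (M u). Yinf \<omega> \<in> A}" by auto
    also have "emeasure (density (M u) (indicator (H u k x))) {\<omega> \<in> space (M u). Yinf \<omega> \<in> A} =
        emeasure (M u) (H u k x \<inter> {\<omega> \<in> space (M u). Yinf \<omega> \<in> A})"
    proof -
      let ?S = "{\<omega> \<in> space (M u). Yinf \<omega> \<in> A}"
      have "emeasure (density (M u) (indicator (H u k x))) ?S =
          (\<integral>\<^sup>+\<omega>. indicator (H u k x) \<omega> * indicator ?S \<omega> \<partial>M u)"
        by (rule emeasure_density[OF borel_measurable_indicator[OF H_sets] S])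
      also have "\<dots> = (\<integral>\<^sup>+\<omega>. indicator (H u k x \<inter> ?S) \<omega> \<partial>M u)"
        by (simp only: indicator_inter_arith)
      also have "\<dots> = emeasure (M u) (H u k x \<inter> ?S)"
        by (rule nn_integral_indicator) (intro sets.Int H_sets S)
      finally show ?thesis .
    qed
    finally show ?thesis by (simp add: emeasure_eq_measure)
  qed
  have em2: "emeasure N2 A = prob (H u k x) * measure (nu (x k)) A" if A: "A \<in> sets Bd" for A
    unfolding N2_def using A
    by (subst emeasure_density_const) (simp_all add: sets_nu n.emeasure_eq_measure ennreal_mult)
  have m1: "measure N1 A = prob (H u k x \<inter> {\<omega> \<in> space (M u). Yinf \<omega> \<in> A})" if "A \<in> sets Bd" for A
    unfolding measure_def[of N1] em1[OF that] by simp
  have m2: "measure N2 A = prob (H u k x) * measure (nu (x k)) A" if "A \<in> sets Bd" for A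
    unfolding measure_def[of N2] em2[OF that] by simp
  have "N1 = N2"
  proof (rule boundary_measure_eqI)
    show s1: "sets N1 = sets Bd" by (simp add: N1_def)
    show s2: "sets N2 = sets Bd" by (simp add: N2_def sets_nu)
    have "space Bd \<in> sets Bd" by simp
    from em1[OF this] em2[OF this] show "finite_measure N1" "finite_measure N2"
      using sets_eq_imp_space_eq[OF s1] sets_eq_imp_space_eq[OF s2]
      by (auto intro!: finite_measureI)
    fix l w
    let ?C = "{\<xi> \<in> space Bd. stake l \<xi> = w}"
    have C: "?C \<in> sets Bd" by (rule cylinder_sets)
    have "measure N1 ?C = prob (H u k x \<inter> {\<omega> \<in> space (M u). stake l (Yinf \<omega>) = w})"
      unfolding m1[OF C] using Yinf_BS by (intro arg_cong[where f = prob]) (auto simp: space_boundary)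
    also have "\<dots> = prob (H u k x) * measure (M (snd (x k))) {\<omega> \<in> space (M (snd (x k))). stake l (bact (fst (x k)) (Yinf \<omega>)) = w}"
      by (rule law_history_cylinder[OF x])
    also have "{\<omega> \<in> space (M (snd (x k))). stake l (bact (fst (x k)) (Yinf \<omega>)) = w} =
        {\<omega> \<in> space (M (snd (x k))). bact (fst (x k)) (Yinf \<omega>) \<in> ?C}"
      using Yinf_BS act_boundary[of "fst (x k)"] x[of k] by (auto simp: space_boundary)
    also have "measure (M (snd (x k))) \<dots> = measure (nu (fst (x k), snd (x k))) ?C"
      by (rule measure_nu[OF _ C, symmetric]) (use x[of k] in auto)
    finally show "measure N1 ?C = measure N2 ?C" by (simp add: m2[OF C])
  qed
  then show ?thesis using m1[OF A] m2[OF A] by simp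
qed

text \<open>
  In other words, \<open>nu y\<close> is the conditional law of the limit given \<open>Y n = y\<close>.
\<close>

lemma law_Y_Yinf:
  assumes y: "y \<in> X" and A: "A \<in> sets Bd"
  shows "measure (M u) {\<omega> \<in> space (M u). Y n \<omega> = y \<and> Yinf \<omega> \<in> A} = q n u y * measure (nu y) A"
proof -
  have "measure (M u) {\<omega> \<in> space (M u). Y n \<omega> = y \<and> Yinf \<omega> \<in> A} =
      kernel_pow X K n ([], u) y * measure (nu y) A"
  proof (rule walk_future_start[where \<phi> = "\<lambda>n x. kernel_pow X K n x y * measure (nu y) A"])
    have c: "{\<omega> \<in> space (M u). Y n \<omega> = y \<and> Yinf \<omega> \<in> A} =
        {\<omega> \<in> space (M u). Y n \<omega> = y} \<inter> {\<omega> \<in> space (M u). Yinf \<omega> \<in> A}" for n by auto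
    show "{\<omega> \<in> space (M u). Y n \<omega> = y \<and> Yinf \<omega> \<in> A} \<in> sets (M u)" for n
      unfolding c by (intro sets.Int Y_sets Yinf_sets A)
    show "measure (M u) (H u k x \<inter> {\<omega> \<in> space (M u). Y k \<omega> = y \<and> Yinf \<omega> \<in> A}) =
      measure (M u) (H u k x) * (kernel_pow X K 0 (x k) y * measure (nu y) A)"
      if x: "\<And>i. x i \<in> X" for k x
    proof (cases "x k = y")
      case True
      then have "H u k x \<inter> {\<omega> \<in> space (M u). Y k \<omega> = y \<and> Yinf \<omega> \<in> A} =
          H u k x \<inter> {\<omega> \<in> space (M u). Yinf \<omega> \<in> A}" by auto
      then show ?thesis using True law_history_Yinf[OF x A, of u k] by simp
    next
      case False
      then have "H u k x \<inter> {\<omega> \<in> space (M u). Y k \<omega> = y \<and> Yinf \<omega> \<in> A} = {}" by auto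
      then show ?thesis using False by (simp only: kernel_pow.simps if_False measure_empty mult_zero_right mult_zero_left)
    qed
    show "kernel_pow X K (Suc n) (z, v) y * measure (nu y) A =
      (\<Sum>s\<in>L. \<Sum>w\<in>UNIV. p [s] $ v $ w * (kernel_pow X K n (foldr mu z [s], w) y * measure (nu y) A))"
      if "z \<in> W" for n z v
      unfolding kernel_pow_Suc[OF that] by (simp only: sum_distrib_right mult.assoc)
  qed
  then show ?thesis by (simp add: q_def)
qed

lemma law_Y_Yinf_sum:
  assumes "\<And>y. y \<in> D n \<Longrightarrow> {\<xi> \<in> space Bd. R y \<xi>} \<in> sets Bd"
  shows "{\<omega> \<in> space (M u). Y n \<omega> \<in> D n \<and> R (Y n \<omega>) (Yinf \<omega>)} \<in> sets (M u)"
    and "measure (M u) {\<omega> \<in> space (M u). Y n \<omega> \<in> D n \<and> R (Y n \<omega>) (Yinf \<omega>)} =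
      (\<Sum>y\<in>D n. q n u y * measure (nu y) {\<xi> \<in> space Bd. R y \<xi>})"
proof -
  interpret prob_space "M u" by (rule prob_M)
  let ?S = "\<lambda>y. {\<omega> \<in> space (M u). Y n \<omega> = y \<and> Yinf \<omega> \<in> {\<xi> \<in> space Bd. R y \<xi>}}"
  have U: "{\<omega> \<in> space (M u). Y n \<omega> \<in> D n \<and> R (Y n \<omega>) (Yinf \<omega>)} = (\<Union>y\<in>D n. ?S y)"
    using Yinf_BS by (auto simp: space_boundary)
  have S: "?S y \<in> sets (M u)" if "y \<in> D n" for y
  proof -
    have "?S y = {\<omega> \<in> space (M u). Y n \<omega> = y} \<inter> {\<omega> \<in> space (M u). Yinf \<omega> \<in> {\<xi> \<in> space Bd. R y \<xi>}}" by auto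
    also have "\<dots> \<in> sets (M u)" by (intro sets.Int Y_sets Yinf_sets assms that)
    finally show ?thesis .
  qed
  then show "{\<omega> \<in> space (M u). Y n \<omega> \<in> D n \<and> R (Y n \<omega>) (Yinf \<omega>)} \<in> sets (M u)"
    unfolding U by (intro sets.finite_UN finite_D)
  have "prob (\<Union>y\<in>D n. ?S y) = (\<Sum>y\<in>D n. prob (?S y))"
    using S finite_D by (intro finite_measure_finite_Union) (auto simp: disjoint_family_on_def)
  also have "\<dots> = (\<Sum>y\<in>D n. q n u y * measure (nu y) {\<xi> \<in> space Bd. R y \<xi>})"
    using D_X assms by (intro sum.cong refl law_Y_Yinf) auto
  finally show "prob {\<omega> \<in> space (M u). Y n \<omega> \<in> D n \<and> R (Y n \<omega>) (Yinf \<omega>)} =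
      (\<Sum>y\<in>D n. q n u y * measure (nu y) {\<xi> \<in> space Bd. R y \<xi>})" unfolding U .
qed

lemma pinf_decomp:
  assumes A: "A \<in> sets Bd"
  shows "measure (pinf u) A = (\<Sum>y\<in>D n. q n u y * measure (nu y) A)"
proof -
  interpret prob_space "M u" by (rule prob_M)
  have eq: "{\<xi> \<in> space Bd. \<xi> \<in> A} = A" using sets.sets_into_space[OF A] by auto
  have "measure (pinf u) A = prob {\<omega> \<in> space (M u). Yinf \<omega> \<in> A}" by (rule measure_pinf[OF A])
  also have "\<dots> = prob {\<omega> \<in> space (M u). Y n \<omega> \<in> D n \<and> Yinf \<omega> \<in> A}"
  proof (rule finite_measure_eq_AE)
    show "AE \<omega> in M u. \<omega> \<in> {\<omega> \<in> space (M u). Yinf \<omega> \<in> A} \<longleftrightarrow> \<omega> \<in> {\<omega> \<in> space (M u). Y n \<omega> \<in> D n \<and> Yinf \<omega> \<in> A}"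
      using AE_D[of u] by eventually_elim auto
    show "{\<omega> \<in> space (M u). Y n \<omega> \<in> D n \<and> Yinf \<omega> \<in> A} \<in> sets (M u)"
      by (rule law_Y_Yinf_sum(1)) (simp add: eq A)
  qed (rule Yinf_sets[OF A])
  also have "\<dots> = (\<Sum>y\<in>D n. q n u y * measure (nu y) A)"
    using law_Y_Yinf_sum(2)[where n = n and R = "\<lambda>_ \<xi>. \<xi> \<in> A" and u = u] A by (simp add: eq)
  finally show ?thesis .
qed

end

section \<open>The drift\<close>

text \<open>
  Cesaro's theorem: a sequence with converging increments grows linearly at the limiting rate.
\<close>

lemma tendsto_average_of_increments:
  fixes a :: "nat \<Rightarrow> real"
  assumes "(\<lambda>n. a (Suc n) - a n) \<longlonglongrightarrow> c"
  shows "(\<lambda>n. a n / real n) \<longlonglongrightarrow> c"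
proof -
  define b where "b n = a n - real n * c" for n
  have b: "(\<lambda>n. b (Suc n) - b n) \<longlonglongrightarrow> 0"
    using tendsto_diff[OF assms tendsto_const[of c]] by (simp add: b_def algebra_simps)
  have "(\<lambda>n. b n / real n) \<longlonglongrightarrow> 0"
  proof (rule LIMSEQ_I)
    fix e :: real assume e: "e > 0"
    then obtain N where N: "\<And>n. n \<ge> N \<Longrightarrow> \<bar>b (Suc n) - b n\<bar> < e / 2"
      using LIMSEQ_D[OF b, of "e / 2"] by auto
    have bd: "\<bar>b (N + k)\<bar> \<le> \<bar>b N\<bar> + real k * (e / 2)" for k
    proof (induction k)
      case (Suc k)
      have "real (Suc k) * (e / 2) = real k * (e / 2) + e / 2" by (simp add: algebra_simps)
      moreover have "\<bar>b (Suc (N + k))\<bar> \<le> \<bar>b (N + k)\<bar> + \<bar>b (Suc (N + k)) - b (N + k)\<bar>" by linarith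
      ultimately show ?case using N[of "N + k"] Suc.IH unfolding add_Suc_right by linarith
    qed simp
    have "(\<lambda>n. \<bar>b N\<bar> / real n) \<longlonglongrightarrow> 0" by (rule lim_const_over_n)
    then obtain N' where N': "\<And>n. n \<ge> N' \<Longrightarrow> \<bar>b N\<bar> / real n < e / 2"
      using LIMSEQ_D[of _ 0 "e / 2"] e by fastforce
    have "norm (b n / real n - 0) < e" if n: "n \<ge> max (Suc N) N'" for n
    proof -
      have n0: "real n > 0" using n by simp
      have "\<bar>b n\<bar> \<le> \<bar>b N\<bar> + real (n - N) * (e / 2)" using bd[of "n - N"] n by simp
      also have "\<dots> \<le> \<bar>b N\<bar> + real n * (e / 2)"
        using e n by (intro add_left_mono mult_right_mono) auto
      finally have "\<bar>b n\<bar> / real n \<le> \<bar>b N\<bar> / real n + e / 2"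
        using n0 by (simp add: field_simps)
      moreover have "\<bar>b N\<bar> / real n < e / 2" using N'[of n] n by simp
      ultimately have "\<bar>b n\<bar> / real n < e" by linarith
      then show ?thesis by simp
    qed
    then show "\<exists>no. \<forall>n\<ge>no. norm (b n / real n - 0) < e" by blast
  qed
  then have "(\<lambda>n. b n / real n + c) \<longlonglongrightarrow> 0 + c" by (intro tendsto_add tendsto_const)
  moreover have "\<forall>\<^sub>F n in sequentially. b n / real n + c = a n / real n"
    using eventually_gt_at_top[of 0] by eventually_elim (simp add: b_def field_simps)
  ultimately show ?thesis by (simp add: filterlim_cong)
qed

lemma tendsto_as_L1_integral:
  assumes M: "prob_space M" and Z: "\<And>n. integrable M (Z n)" and lim: "tendsto_as_L1 M Z c"
  shows "(\<lambda>n. \<integral>\<omega>. Z n \<omega> \<partial>M) \<longlonglongrightarrow> c"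
proof -
  interpret prob_space M by fact
  have I: "integrable M (\<lambda>\<omega>. \<bar>Z n \<omega> - c\<bar>)" for n using Z by simp
  have eq: "(\<integral>\<^sup>+\<omega>. ennreal \<bar>Z n \<omega> - c\<bar> \<partial>M) = ennreal (\<integral>\<omega>. \<bar>Z n \<omega> - c\<bar> \<partial>M)" for n
    by (rule nn_integral_eq_integral[OF I]) simp
  have "(\<lambda>n. ennreal (\<integral>\<omega>. \<bar>Z n \<omega> - c\<bar> \<partial>M)) \<longlonglongrightarrow> ennreal 0"
    using lim by (simp add: tendsto_as_L1_def eq)
  then have L: "(\<lambda>n. \<integral>\<omega>. \<bar>Z n \<omega> - c\<bar> \<partial>M) \<longlonglongrightarrow> 0"
    by (subst (asm) tendsto_ennreal_iff) auto
  have "(\<lambda>n. (\<integral>\<omega>. Z n \<omega> \<partial>M) - c) \<longlonglongrightarrow> 0"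
  proof (rule Lim_null_comparison[OF always_eventually L], rule allI)
    fix n
    have "(\<integral>\<omega>. Z n \<omega> \<partial>M) - c = (\<integral>\<omega>. Z n \<omega> - c \<partial>M)"
      using Z by (simp add: prob_space)
    then show "norm ((\<integral>\<omega>. Z n \<omega> \<partial>M) - c) \<le> (\<integral>\<omega>. \<bar>Z n \<omega> - c\<bar> \<partial>M)"
      using integral_norm_bound[of M "\<lambda>\<omega>. Z n \<omega> - c"] by simp
  qed
  then show ?thesis by (simp add: LIM_zero_iff)
qed

context boundary_walk
begin

definition "first_letter v s = measure (M v) {\<omega> \<in> space (M v). shd (Yinf \<omega>) = s}"

lemma shd_sets: "{\<omega> \<in> space (M v). shd (Yinf \<omega>) = s} \<in> sets (M v)"
proof -
  have "{\<omega> \<in> space (M v). shd (Yinf \<omega>) = s} = {\<omega> \<in> space (M v). Yinf \<omega> \<in> {\<xi> \<in> space Bd. stake 1 \<xi> = [s]}}"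
    using Yinf_BS by (auto simp: space_boundary)
  also have "\<dots> \<in> sets (M v)" by (intro Yinf_sets cylinder_sets)
  finally show ?thesis .
qed

lemma nb_cases: "y \<in> nb x \<Longrightarrow> \<exists>s\<in>L. \<exists>v. y = (foldr mu (fst x) [s], v)"
  by (auto simp: nb_def)

lemma AE_hits_first_letter: "AE \<omega> in M v. \<exists>n. fst (Y n \<omega>) = [shd (Yinf \<omega>)]"
  using AE_start[of v] AE_nb[of v] AE_limit[of v] AE_space
proof eventually_elim
  case (elim \<omega>)
  let ?a = "shd (Yinf \<omega>)"
  have "\<exists>n. take 1 (fst (Y n \<omega>)) = [?a]"
    using elim(3)[unfolded words_tendsto_def, rule_format, of 1] by (auto simp: eventually_sequentially)
  then have ex: "take 1 (fst (Y (LEAST n. take 1 (fst (Y n \<omega>)) = [?a]) \<omega>)) = [?a]" (is "take 1 (fst (Y ?n \<omega>)) = _")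
    by (rule LeastI_ex)
  then have "?n \<noteq> 0" using elim(1) by (metis fst_conv list.distinct(1) take_Nil)
  then obtain j where j: "?n = Suc j" by (cases ?n) auto
  then have nj: "take 1 (fst (Y j \<omega>)) \<noteq> [?a]"
    using not_less_Least[of j "\<lambda>n. take 1 (fst (Y n \<omega>)) = [?a]"] by simp
  have "Y (Suc j) \<omega> \<in> nb (Y j \<omega>)" using elim(2) by blast
  from nb_cases[OF this] obtain s w where s: "s \<in> L" "Y (Suc j) \<omega> = (foldr mu (fst (Y j \<omega>)) [s], w)"
    by blast
  have e: "fst (Y (Suc j) \<omega>) = foldr mu (fst (Y j \<omega>)) [s]" unfolding s(2) by (rule fst_conv)
  have "take 1 (foldr mu (fst (Y j \<omega>)) [s]) = [?a]" using ex unfolding j e .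
  then have "foldr mu (fst (Y j \<omega>)) [s] = [?a]"
    by (rule right_mult_hits[OF Y_W[OF elim(4)] s(1) _ nj])
  then have "fst (Y (Suc j) \<omega>) = [?a]" unfolding e .
  then show ?case by blast
qed

text \<open>
  Summing over the colour at the first visit loses nothing: a walk whose limit begins with \<open>s\<close> almost
  surely visits the word \<open>s\<close>, and the first visit has just one colour.
\<close>

lemma sum_first_letter_prob:
  "(\<Sum>w\<in>UNIV. first_letter_prob M Y Yinf s v w) = first_letter v s"
proof -
  interpret prob_space "M v" by (rule prob_M)
  let ?E = "\<lambda>w. {\<omega> \<in> space (M v). shd (Yinf \<omega>) = s \<and>
       (\<exists>n. Y n \<omega> = ([s], w) \<and> (\<forall>k<n. fst (Y k \<omega>) \<noteq> [s]))}"
  have "{\<omega> \<in> space (M v). \<exists>n. Y n \<omega> = ([s], w) \<and> (\<forall>k<n. fst (Y k \<omega>) \<noteq> [s])} \<in> sets (M v)" for w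
    by (intro sets.sets_Collect_countable_Ex sets.sets_Collect_conj sets.sets_Collect_countable_All
        sets.sets_Collect_imp Y_sets sets.sets_Collect_const)
  then have E: "?E w \<in> sets (M v)" for w
    by (intro sets.sets_Collect_conj shd_sets)
  have "(\<Sum>w\<in>UNIV. first_letter_prob M Y Yinf s v w) = (\<Sum>w\<in>UNIV. prob (?E w))"
    by (simp add: first_letter_prob_def)
  also have "\<dots> = prob (\<Union>w\<in>UNIV. ?E w)"
  proof (rule finite_measure_finite_Union[symmetric])
    show "disjoint_family_on ?E UNIV" unfolding disjoint_family_on_def
    proof (intro ballI impI)
      fix w w' :: 'r assume "w \<noteq> w'"
      have "w = w'" if "Y n \<omega> = ([s], w)" "\<forall>k<n. fst (Y k \<omega>) \<noteq> [s]"
        "Y n' \<omega> = ([s], w')" "\<forall>k<n'. fst (Y k \<omega>) \<noteq> [s]" for n n' \<omega>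
        using that by (cases n n' rule: linorder_cases) auto
      then show "?E w \<inter> ?E w' = {}" using \<open>w \<noteq> w'\<close> by blast
    qed
  qed (use E in auto)
  also have "\<dots> = first_letter v s" unfolding first_letter_def
  proof (rule finite_measure_eq_AE)
    show "AE \<omega> in M v. \<omega> \<in> (\<Union>w. ?E w) \<longleftrightarrow> \<omega> \<in> {\<omega> \<in> space (M v). shd (Yinf \<omega>) = s}"
      using AE_hits_first_letter
    proof eventually_elim
      case (elim \<omega>)
      have "\<exists>w n. Y n \<omega> = ([s], w) \<and> (\<forall>k<n. fst (Y k \<omega>) \<noteq> [s])" if s: "shd (Yinf \<omega>) = s"
      proof -
        have "\<exists>n. fst (Y n \<omega>) = [s]" using elim s by simp
        then obtain n where n: "fst (Y n \<omega>) = [s]" "\<forall>k<n. fst (Y k \<omega>) \<noteq> [s]"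
          using exists_least_iff[of "\<lambda>n. fst (Y n \<omega>) = [s]"] by blast
        then have "Y n \<omega> = ([s], snd (Y n \<omega>))" by (metis prod.collapse)
        then show ?thesis using n(2) by blast
      qed
      then show ?case by auto
    qed
  qed (use E shd_sets in auto)
  finally show ?thesis .
qed

definition "length_step s x = (if x = [] \<or> hd x \<in> Nx s then 1 else if hd x = ginv s then - 1 else (0::real))"

lemma finite_Nx: "finite (Nx s)"
  by (rule finite_subset[OF _ finite_L]) (auto simp: next_letters_def split: letter.splits)

text \<open>
  The increment of length is bounded and is a function of the first letter, which is eventually that
  of the limit; dominated convergence applies.
\<close>

lemma length_step_tendsto:
  assumes s: "s \<in> L"
  shows "(\<lambda>n. \<Sum>y\<in>D n. q n v y * length_step s (fst y)) \<longlonglongrightarrow>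
    - first_letter v (ginv s) + (\<Sum>t\<in>Nx s. first_letter v t)"
proof -
  interpret prob_space "M v" by (rule prob_M)
  let ?I = "\<lambda>t. indicator {\<omega> \<in> space (M v). shd (Yinf \<omega>) = t} :: _ \<Rightarrow> real"
  let ?g = "\<lambda>\<omega>. - ?I (ginv s) \<omega> + (\<Sum>t\<in>Nx s. ?I t \<omega>)"
  have I: "integrable (M v) (?I t)" for t
    by (rule integrable_real_indicator[OF shd_sets]) (simp add: emeasure_eq_measure)
  have II: "(\<integral>\<omega>. ?I t \<omega> \<partial>M v) = first_letter v t" for t
    unfolding first_letter_def by (simp, rule arg_cong[where f = prob]) auto
  have "(\<lambda>n. \<integral>\<omega>. length_step s (fst (Y n \<omega>)) \<partial>M v) \<longlonglongrightarrow> (\<integral>\<omega>. ?g \<omega> \<partial>M v)"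
  proof (rule integral_dominated_convergence[where w = "\<lambda>_. 1"])
    show "?g \<in> borel_measurable (M v)"
      using I by (intro borel_measurable_add borel_measurable_uminus borel_measurable_sum borel_measurable_integrable)
    show "(\<lambda>\<omega>. length_step s (fst (Y n \<omega>))) \<in> borel_measurable (M v)" for n
      by (rule borel_measurable_integrable) (rule integral_Y(1))
    show "AE \<omega> in M v. (\<lambda>n. length_step s (fst (Y n \<omega>))) \<longlonglongrightarrow> ?g \<omega>"
      using AE_limit AE_space
    proof eventually_elim
      case (elim \<omega>)
      have "?g \<omega> = length_step s [shd (Yinf \<omega>)]"
      proof -
        have "(\<Sum>t\<in>Nx s. ?I t \<omega>) = (\<Sum>t\<in>Nx s. if t = shd (Yinf \<omega>) then 1 else 0)"
          using elim(2) by (intro sum.cong) (auto simp: indicator_def)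
        then show ?thesis using elim(2) inv_not_Nx[OF s] finite_Nx
          by (auto simp: length_step_def indicator_def)
      qed
      moreover have "\<forall>\<^sub>F n in sequentially. length_step s (fst (Y n \<omega>)) = length_step s [shd (Yinf \<omega>)]"
        using elim(1)[unfolded words_tendsto_def, rule_format, of 1]
      proof eventually_elim
        case (elim n)
        then show ?case by (cases "fst (Y n \<omega>)") (auto simp: length_step_def)
      qed
      ultimately show ?case by (simp add: tendsto_eventually)
    qed
    show "AE \<omega> in M v. norm (length_step s (fst (Y n \<omega>))) \<le> 1" for n
      by (simp add: length_step_def)
  qed simp
  moreover have "(\<integral>\<omega>. ?g \<omega> \<partial>M v) = - first_letter v (ginv s) + (\<Sum>t\<in>Nx s. first_letter v t)"
    using I by (subst Bochner_Integration.integral_add) (simp_all add: II del: Bochner_Integration.integral_indicator)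
  moreover have "(\<integral>\<omega>. length_step s (fst (Y n \<omega>)) \<partial>M v) = (\<Sum>y\<in>D n. q n v y * length_step s (fst y))" for n
    by (rule integral_Y(2))
  ultimately show ?thesis by simp
qed

end

locale stationary_walk = boundary_walk d m Gs p M Y Yinf
  for d m :: nat and Gs :: "nat \<Rightarrow> 'a monoid" and p :: "'a letter list \<Rightarrow> real^'r^'r"
    and M :: "'r \<Rightarrow> 'w measure" and Y :: "nat \<Rightarrow> 'w \<Rightarrow> 'a letter list \<times> 'r"
    and Yinf :: "'w \<Rightarrow> 'a letter stream" +
  fixes \<pi> :: "real^'r"
  assumes invariant: "invariant_prob (colour_matrix GP p) \<pi>"
begin

lemma sum_pi: "(\<Sum>u\<in>UNIV. \<pi> $ u) = 1"
  using invariant by (simp add: invariant_prob_def)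

lemma pi_invariant: "(\<Sum>u\<in>UNIV. \<Sum>s\<in>L. \<pi> $ u * p [s] $ u $ v) = \<pi> $ v"
proof -
  have "\<pi> v* (\<Sum>s\<in>L. p [s]) = \<pi>"
    using invariant unfolding invariant_prob_def colour_matrix_eq by blast
  then have "(\<pi> v* (\<Sum>s\<in>L. p [s])) $ v = \<pi> $ v" by simp
  then have "(\<Sum>u\<in>UNIV. \<pi> $ u * (\<Sum>s\<in>L. p [s]) $ u $ v) = \<pi> $ v"
    by (simp only: vector_matrix_mult_def vec_lambda_beta)
  moreover have "\<pi> $ u * (\<Sum>s\<in>L. p [s]) $ u $ v = (\<Sum>s\<in>L. \<pi> $ u * p [s] $ u $ v)" for u
    by (simp add: sum_distrib_left)
  ultimately show ?thesis by (simp only:)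
qed

text \<open>
  If the initial colour is distributed according to \<open>\<pi>\<close>, so is the colour after one step.  This makes
  the part of an expectation that comes from the steps after the first one cancel in the increments.
\<close>

lemma sum_pi_invariant:
  "(\<Sum>u\<in>UNIV. \<pi> $ u * (\<Sum>s\<in>L. \<Sum>v\<in>UNIV. p [s] $ u $ v * F v)) = (\<Sum>v\<in>UNIV. \<pi> $ v * F v)"
proof -
  have "(\<Sum>u\<in>UNIV. \<pi> $ u * (\<Sum>s\<in>L. \<Sum>v\<in>UNIV. p [s] $ u $ v * F v)) =
      (\<Sum>u\<in>UNIV. \<Sum>s\<in>L. \<Sum>v\<in>UNIV. \<pi> $ u * p [s] $ u $ v * F v)"
    by (simp only: sum_distrib_left mult.assoc)
  also have "\<dots> = (\<Sum>u\<in>UNIV. \<Sum>v\<in>UNIV. \<Sum>s\<in>L. \<pi> $ u * p [s] $ u $ v * F v)"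
    by (intro sum.cong refl sum.swap)
  also have "\<dots> = (\<Sum>v\<in>UNIV. \<Sum>u\<in>UNIV. \<Sum>s\<in>L. \<pi> $ u * p [s] $ u $ v * F v)"
    by (rule sum.swap)
  also have "\<dots> = (\<Sum>v\<in>UNIV. (\<Sum>u\<in>UNIV. \<Sum>s\<in>L. \<pi> $ u * p [s] $ u $ v) * F v)"
    by (simp only: sum_distrib_right)
  finally show ?thesis by (simp only: pi_invariant)
qed

lemma sum_order:
  "(\<Sum>u\<in>UNIV. \<pi> $ u * (\<Sum>s\<in>L. \<Sum>v\<in>UNIV. p [s] $ u $ v * F s u v)) =
   (\<Sum>s\<in>L. \<Sum>u\<in>UNIV. \<Sum>v\<in>UNIV. \<pi> $ u * p [s] $ u $ v * F s u v)"
proof -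
  have "(\<Sum>u\<in>UNIV. \<pi> $ u * (\<Sum>s\<in>L. \<Sum>v\<in>UNIV. p [s] $ u $ v * F s u v)) =
      (\<Sum>u\<in>UNIV. \<Sum>s\<in>L. \<Sum>v\<in>UNIV. \<pi> $ u * p [s] $ u $ v * F s u v)"
    by (simp only: sum_distrib_left mult.assoc)
  also have "\<dots> = (\<Sum>s\<in>L. \<Sum>u\<in>UNIV. \<Sum>v\<in>UNIV. \<pi> $ u * p [s] $ u $ v * F s u v)"
    by (rule sum.swap)
  finally show ?thesis .
qed

lemma mean_length_increment:
  "(\<Sum>u\<in>UNIV. \<pi> $ u * (\<Sum>y\<in>D (Suc n). q (Suc n) u y * real (length (fst y)))) -
   (\<Sum>u\<in>UNIV. \<pi> $ u * (\<Sum>y\<in>D n. q n u y * real (length (fst y)))) =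
   (\<Sum>s\<in>L. \<Sum>u\<in>UNIV. \<Sum>v\<in>UNIV. \<pi> $ u * p [s] $ u $ v * (\<Sum>y\<in>D n. q n v y * length_step s (fst y)))"
proof -
  let ?l = "\<lambda>v. \<Sum>y\<in>D n. q n v y * real (length (fst y))"
  let ?d = "\<lambda>s v. \<Sum>y\<in>D n. q n v y * length_step s (fst y)"
  have "(\<Sum>y\<in>D n. q n v y * real (length (mu s (fst y)))) = ?l v + ?d s v" if "s \<in> L" for s v
  proof -
    have "q n v y * real (length (mu s (fst y))) =
        q n v y * real (length (fst y)) + q n v y * length_step s (fst y)" if "y \<in> D n" for y
      using length_mu[OF \<open>s \<in> L\<close>, of "fst y"] that
      unfolding length_step_def by (simp add: D_def mem_Times_iff ring_distribs)
    then show ?thesis by (simp add: sum.distrib)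
  qed
  then have "(\<Sum>y\<in>D (Suc n). q (Suc n) u y * real (length (fst y))) =
     (\<Sum>s\<in>L. \<Sum>v\<in>UNIV. p [s] $ u $ v * ?l v) + (\<Sum>s\<in>L. \<Sum>v\<in>UNIV. p [s] $ u $ v * ?d s v)" for u
    unfolding sum_q_Suc by (simp add: ring_distribs sum.distrib)
  then have "(\<Sum>u\<in>UNIV. \<pi> $ u * (\<Sum>y\<in>D (Suc n). q (Suc n) u y * real (length (fst y)))) =
    (\<Sum>u\<in>UNIV. \<pi> $ u * (\<Sum>s\<in>L. \<Sum>v\<in>UNIV. p [s] $ u $ v * ?l v)) +
    (\<Sum>u\<in>UNIV. \<pi> $ u * (\<Sum>s\<in>L. \<Sum>v\<in>UNIV. p [s] $ u $ v * ?d s v))"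
    by (simp only: ring_distribs sum.distrib)
  then show ?thesis unfolding sum_pi_invariant sum_order by simp
qed

lemma mean_length_tendsto:
  assumes "is_drift GP (generators d m Gs) M Y \<gamma>"
  shows "(\<lambda>n. (\<Sum>u\<in>UNIV. \<pi> $ u * (\<Sum>y\<in>D n. q n u y * real (length (fst y)))) / real n) \<longlonglongrightarrow> \<gamma>"
proof -
  have lim: "(\<lambda>n. (\<Sum>y\<in>D n. q n u y * real (length (fst y))) / real n) \<longlonglongrightarrow> \<gamma>" for u
  proof -
    let ?Z = "\<lambda>n \<omega>. real (word_length GP (generators d m Gs) (fst (Y n \<omega>))) / real n"
    have Z: "?Z n \<omega> = real (length (fst (Y n \<omega>))) / real n" if "\<omega> \<in> space (M u)" for n \<omega>
      by (simp add: word_length_eq[OF Y_W[OF that]])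
    have "(\<lambda>n. \<integral>\<omega>. ?Z n \<omega> \<partial>M u) \<longlonglongrightarrow> \<gamma>"
    proof (rule tendsto_as_L1_integral[OF prob_M])
      show "integrable (M u) (?Z n)" for n by (rule integral_Y(1))
      show "tendsto_as_L1 (M u) ?Z \<gamma>" using assms by (simp add: is_drift_def)
    qed
    moreover have "(\<integral>\<omega>. ?Z n \<omega> \<partial>M u) = (\<Sum>y\<in>D n. q n u y * real (length (fst y))) / real n" for n
    proof -
      have "(\<integral>\<omega>. ?Z n \<omega> \<partial>M u) = (\<integral>\<omega>. real (length (fst (Y n \<omega>))) / real n \<partial>M u)"
        by (rule Bochner_Integration.integral_cong[OF refl Z])
      also have "\<dots> = (\<Sum>y\<in>D n. q n u y * (real (length (fst y)) / real n))" by (rule integral_Y(2))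
      also have "\<dots> = (\<Sum>y\<in>D n. q n u y * real (length (fst y))) / real n"
        by (simp add: sum_divide_distrib)
      finally show ?thesis .
    qed
    ultimately show ?thesis by (simp only:)
  qed
  have "(\<lambda>n. \<Sum>u\<in>UNIV. \<pi> $ u * ((\<Sum>y\<in>D n. q n u y * real (length (fst y))) / real n)) \<longlonglongrightarrow> (\<Sum>u\<in>UNIV. \<pi> $ u * \<gamma>)"
    by (intro tendsto_sum tendsto_mult_left lim)
  moreover have "(\<Sum>u\<in>UNIV. \<pi> $ u * \<gamma>) = \<gamma>" by (simp add: sum_distrib_right[symmetric] sum_pi)
  moreover have "(\<Sum>u\<in>UNIV. \<pi> $ u * A u) / r = (\<Sum>u\<in>UNIV. \<pi> $ u * (A u / r))" for A r
    by (simp add: sum_divide_distrib)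
  ultimately show ?thesis by (simp only:)
qed

text \<open>
  Averaged over \<open>\<pi>\<close>, the increments of the mean length converge to the right-hand side, while the
  mean length divided by \<open>n\<close> converges to \<open>\<gamma>\<close>.
\<close>

theorem drift_formula:
  assumes "is_drift GP (generators d m Gs) M Y \<gamma>"
  shows "\<gamma> = (\<Sum>g\<in>L. \<Sum>u\<in>UNIV. \<Sum>v\<in>UNIV. \<Sum>w\<in>UNIV.
           \<pi> $ u * p [g] $ u $ v *
             (- first_letter_prob M Y Yinf (ginv g) v w + (\<Sum>s\<in>Nx g. first_letter_prob M Y Yinf s v w)))"
proof -
  have "(\<lambda>n. \<Sum>s\<in>L. \<Sum>u\<in>UNIV. \<Sum>v\<in>UNIV. \<pi> $ u * p [s] $ u $ v * (\<Sum>y\<in>D n. q n v y * length_step s (fst y)))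
    \<longlonglongrightarrow> (\<Sum>s\<in>L. \<Sum>u\<in>UNIV. \<Sum>v\<in>UNIV. \<pi> $ u * p [s] $ u $ v *
          (- first_letter v (ginv s) + (\<Sum>t\<in>Nx s. first_letter v t)))"
    by (intro tendsto_sum tendsto_mult_left length_step_tendsto)
  then have "\<gamma> = (\<Sum>s\<in>L. \<Sum>u\<in>UNIV. \<Sum>v\<in>UNIV. \<pi> $ u * p [s] $ u $ v *
          (- first_letter v (ginv s) + (\<Sum>t\<in>Nx s. first_letter v t)))"
    unfolding mean_length_increment[symmetric]
    by (intro LIMSEQ_unique[OF mean_length_tendsto[OF assms]] tendsto_average_of_increments)
  moreover have "- first_letter v (ginv s) + (\<Sum>t\<in>Nx s. first_letter v t) =
      (\<Sum>w\<in>UNIV. - first_letter_prob M Y Yinf (ginv s) v w + (\<Sum>t\<in>Nx s. first_letter_prob M Y Yinf t v w))" for s v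
  proof -
    have "(\<Sum>w\<in>UNIV. \<Sum>t\<in>Nx s. first_letter_prob M Y Yinf t v w) = (\<Sum>t\<in>Nx s. first_letter v t)"
      unfolding sum_first_letter_prob[symmetric] by (rule sum.swap)
    then show ?thesis by (simp add: sum_subtractf sum_first_letter_prob)
  qed
  ultimately show ?thesis by (simp only: sum_distrib_left)
qed

end

section \<open>Densities of translated harmonic measures\<close>

text \<open>
  The domination \<open>c \<nu> \<le> \<mu>\<close> forces the density to be at most \<open>1 / c\<close> almost everywhere; truncating it
  makes the bound hold everywhere, so that all integrands built from it are bounded.
\<close>

lemma bounded_density:
  assumes fin: "finite_measure \<mu>" "finite_measure \<nu>" and sets: "sets \<nu> = sets \<mu>"
    and c: "c > 0" and dom: "\<And>A. A \<in> sets \<mu> \<Longrightarrow> c * measure \<nu> A \<le> measure \<mu> A"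
  shows "\<exists>f :: 'x \<Rightarrow> real. f \<in> borel_measurable \<mu> \<and> (\<forall>x. 0 \<le> f x) \<and> (\<forall>x. f x \<le> 1 / c) \<and>
    \<nu> = density \<mu> (\<lambda>x. ennreal (f x))"
proof -
  interpret m: finite_measure \<mu> by fact
  interpret n: finite_measure \<nu> by fact
  have ac: "absolutely_continuous \<mu> \<nu>"
    unfolding absolutely_continuous_def
  proof
    fix A assume A: "A \<in> null_sets \<mu>"
    then have "A \<in> sets \<mu>" "measure \<mu> A = 0" by (auto simp: measure_def)
    then have "c * measure \<nu> A \<le> 0" using dom[of A] by simp
    then have "measure \<nu> A = 0" using c measure_nonneg[of \<nu> A] by (simp add: mult_le_0_iff)
    then show "A \<in> null_sets \<nu>" using \<open>A \<in> sets \<mu>\<close> sets by (auto simp: null_sets_def n.emeasure_eq_measure)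
  qed
  obtain d where d: "d \<in> borel_measurable \<mu>" "AE x in \<mu>. RN_deriv \<mu> \<nu> x = ennreal (d x)" "\<And>x. 0 \<le> d x"
    using m.real_RN_deriv[OF fin(2) ac sets] by blast
  have nud: "\<nu> = density \<mu> (\<lambda>x. ennreal (d x))"
  proof -
    have "\<nu> = density \<mu> (RN_deriv \<mu> \<nu>)" using m.density_RN_deriv[OF ac sets] by simp
    also have "\<dots> = density \<mu> (\<lambda>x. ennreal (d x))"
      using d by (intro density_cong) auto
    finally show ?thesis .
  qed
  have int: "integrable \<mu> d"
  proof -
    have "integrable \<nu> (\<lambda>_. 1 :: real)" by simp
    then show ?thesis using d by (subst (asm) nud, subst (asm) integrable_density) auto
  qed
  \<comment> \<open>On the set where the density exceeds the bound, the domination leaves room for a null set only.\<close>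
  define B where "B = {x \<in> space \<mu>. 1 / c < d x}"
  have B: "B \<in> sets \<mu>" using d(1) by (simp add: B_def)
  have "measure \<nu> B = (\<integral>x. indicator B x \<partial>\<nu>)"
    using B sets.sets_into_space[OF B] sets_eq_imp_space_eq[OF sets] by (simp add: Int_absorb2)
  also have "\<dots> = (\<integral>x. d x * indicator B x \<partial>\<mu>)"
    using d B by (subst nud, subst integral_density) auto
  finally have nB: "measure \<nu> B = (\<integral>x. d x * indicator B x \<partial>\<mu>)" .
  have iB: "integrable \<mu> (\<lambda>x. d x * indicator B x)"
    using integrable_mult_indicator[OF B int] by (simp add: mult.commute)
  have iB': "integrable \<mu> (\<lambda>x. 1 / c * indicator B x)"
    using B by (intro integrable_mult_right integrable_real_indicator) (auto simp: m.emeasure_eq_measure)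
  have "(\<integral>x. (d x - 1 / c) * indicator B x \<partial>\<mu>) = measure \<nu> B - 1 / c * measure \<mu> B"
  proof -
    have "(\<integral>x. (d x - 1 / c) * indicator B x \<partial>\<mu>) = (\<integral>x. d x * indicator B x - 1 / c * indicator B x \<partial>\<mu>)"
      by (simp add: left_diff_distrib)
    also have "\<dots> = (\<integral>x. d x * indicator B x \<partial>\<mu>) - (\<integral>x. 1 / c * indicator B x \<partial>\<mu>)"
      by (rule Bochner_Integration.integral_diff[OF iB iB'])
    also have "(\<integral>x. 1 / c * indicator B x \<partial>\<mu>) = 1 / c * measure \<mu> B"
      using sets.sets_into_space[OF B] by (simp add: Int_absorb2)
    finally show ?thesis using nB by simp
  qed
  also have "\<dots> \<le> 0" using dom[OF B] c by (simp add: field_simps)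
  finally have le0: "(\<integral>x. (d x - 1 / c) * indicator B x \<partial>\<mu>) \<le> 0" .
  have nn: "0 \<le> (d x - 1 / c) * indicator B x" for x by (auto simp: B_def indicator_def)
  have iD: "integrable \<mu> (\<lambda>x. (d x - 1 / c) * indicator B x)"
    using Bochner_Integration.integrable_diff[OF iB iB'] by (simp add: left_diff_distrib)
  have "0 \<le> (\<integral>x. (d x - 1 / c) * indicator B x \<partial>\<mu>)"
    by (rule integral_nonneg_AE) (use nn in simp)
  then have "(\<integral>x. (d x - 1 / c) * indicator B x \<partial>\<mu>) = 0"
    using le0 by linarith
  then have "AE x in \<mu>. (d x - 1 / c) * indicator B x = 0"
    using integral_nonneg_eq_0_iff_AE[OF iD] nn by simp
  then have "AE x in \<mu>. ennreal (d x) = ennreal (min (d x) (1 / c))"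
    using AE_space by eventually_elim (auto simp: B_def indicator_def min_def split: if_splits)
  then have "density \<mu> (\<lambda>x. ennreal (d x)) = density \<mu> (\<lambda>x. ennreal (min (d x) (1 / c)))"
    using d(1) by (intro density_cong) auto
  then show ?thesis
    using d(1,3) c nud by (intro exI[of _ "\<lambda>x. min (d x) (1 / c)"]) auto
qed

lemma
  fixes f :: "'x \<Rightarrow> real" and g :: "'x \<Rightarrow> real"
  assumes f: "f \<in> borel_measurable \<mu>" "\<And>x. 0 \<le> f x" "\<And>x. f x \<le> C" and g: "integrable \<mu> g"
  shows integrable_bounded_density: "integrable (density \<mu> (\<lambda>x. ennreal (f x))) g"
    and integrable_bounded_mult: "integrable \<mu> (\<lambda>x. f x * g x)"
proof -
  have "integrable \<mu> (\<lambda>x. C * g x)" using g by simp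
  then show i: "integrable \<mu> (\<lambda>x. f x * g x)"
  proof (rule Bochner_Integration.integrable_bound)
    show "(\<lambda>x. f x * g x) \<in> borel_measurable \<mu>" using f(1) g by measurable
    have "norm (f x * g x) \<le> norm (C * g x)" for x
    proof -
      have "\<bar>f x\<bar> \<le> \<bar>C\<bar>" using f(2,3)[of x] by linarith
      then show ?thesis by (simp add: abs_mult mult_right_mono)
    qed
    then show "AE x in \<mu>. norm (f x * g x) \<le> norm (C * g x)" by simp
  qed
  then show "integrable (density \<mu> (\<lambda>x. ennreal (f x))) g"
    using f g by (subst integrable_density) auto
qed

text \<open>
  The function \<open>t ln t\<close> is bounded on bounded intervals: it is at least \<open>-1\<close> because
  \<open>ln (1 / t) \<le> 1 / t - 1\<close>, and at most \<open>t\<^sup>2\<close> because \<open>ln t \<le> t\<close>.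
\<close>

lemma integrable_mult_ln:
  fixes f :: "'x \<Rightarrow> real"
  assumes "finite_measure \<mu>" and f: "f \<in> borel_measurable \<mu>" "\<And>x. 0 \<le> f x" "\<And>x. f x \<le> C"
  shows "integrable \<mu> (\<lambda>x. f x * ln (f x))"
proof -
  interpret finite_measure \<mu> by fact
  show ?thesis
  proof (rule integrable_const_bound[where B = "1 + C\<^sup>2"])
    have "norm (f x * ln (f x)) \<le> 1 + C\<^sup>2" for x
    proof (cases "f x = 0")
      case False
      then have p: "f x > 0" using f(2)[of x] by simp
      have "f x * ln (f x) \<le> f x * f x"
        using ln_le_minus_one[OF p] p by (intro mult_left_mono) auto
      also have "\<dots> \<le> C\<^sup>2" unfolding power2_eq_square using f(2,3)[of x] by (intro mult_mono) auto
      finally have 1: "f x * ln (f x) \<le> C\<^sup>2" .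
      have "ln (1 / f x) \<le> 1 / f x - 1" using p by (intro ln_le_minus_one) simp
      then have "f x * ln (1 / f x) \<le> f x * (1 / f x - 1)" using p by (intro mult_left_mono) auto
      then have 2: "- (f x * ln (f x)) \<le> 1" using p by (simp add: ln_div algebra_simps)
      have "0 \<le> C\<^sup>2" by simp
      with 1 2 show ?thesis unfolding real_norm_def by linarith
    qed simp
    then show "AE x in \<mu>. norm (f x * ln (f x)) \<le> 1 + C\<^sup>2" by simp
  qed (use f(1) in measurable)
qed

lemma integrable_density_ln:
  fixes f :: "'x \<Rightarrow> real"
  assumes "finite_measure \<mu>" and f: "f \<in> borel_measurable \<mu>" "\<And>x. 0 \<le> f x" "\<And>x. f x \<le> C"
  shows "integrable (density \<mu> (\<lambda>x. ennreal (f x))) (\<lambda>x. ln (f x))"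
  using integrable_mult_ln[OF assms] f by (subst integrable_density) auto

text \<open>
  If \<open>\<mu>\<close> has density \<open>\<kappa>\<close> with respect to \<open>\<nu>\<close>, then \<open>d\<nu>/d\<mu> = 1 / \<kappa>\<close> even though \<open>\<nu>\<close> may have a part
  that is singular to \<open>\<mu>\<close>: off the \<open>\<mu>\<close>-null set carrying that part the two measures have mutual
  densities.
\<close>

lemma lebesgue_deriv_reciprocal:
  fixes \<kappa> :: "'x \<Rightarrow> real"
  assumes fin: "finite_measure \<mu>" "finite_measure \<nu>" and sets: "sets \<nu> = sets \<mu>"
    and F: "is_lebesgue_deriv \<mu> \<nu> F"
    and \<kappa>: "\<kappa> \<in> borel_measurable \<mu>" "\<And>x. 0 \<le> \<kappa> x" and \<mu>: "\<mu> = density \<nu> (\<lambda>x. ennreal (\<kappa> x))"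
  shows "AE x in \<mu>. ln (enn2real (F x)) = - ln (\<kappa> x)"
proof -
  interpret m: finite_measure \<mu> by fact
  obtain N where N: "N \<in> null_sets \<mu>" and eq: "\<And>A. A \<in> sets \<mu> \<Longrightarrow>
      emeasure \<nu> A = emeasure (density \<mu> F) A + emeasure \<nu> (A \<inter> N)"
    and F_meas: "F \<in> borel_measurable \<mu>"
    using F by (auto simp: is_lebesgue_deriv_def)
  let ?I = "indicator (space \<mu> - N) :: 'x \<Rightarrow> ennreal"
  have Ns: "N \<in> sets \<mu>" using N by auto
  have I\<mu>: "?I \<in> borel_measurable \<mu>" using Ns by simp
  have borel: "h \<in> borel_measurable \<nu>" if "h \<in> borel_measurable \<mu>" for h :: "'x \<Rightarrow> ennreal"
    using that measurable_cong_sets[OF sets refl] by blast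
  have k': "(\<lambda>x. ennreal (\<kappa> x)) \<in> borel_measurable \<mu>" using \<kappa>(1) by simp
  have dI: "density \<nu> ?I = density \<mu> F"
  proof (rule measure_eqI)
    show "sets (density \<nu> ?I) = sets (density \<mu> F)" using sets by simp
    fix A assume "A \<in> sets (density \<nu> ?I)"
    then have A: "A \<in> sets \<mu>" "A \<in> sets \<nu>" using sets by auto
    have AN: "A - N \<in> sets \<mu>" using A Ns by auto
    have "emeasure (density \<nu> ?I) A = (\<integral>\<^sup>+x. ?I x * indicator A x \<partial>\<nu>)"
      by (rule emeasure_density[OF borel[OF I\<mu>] A(2)])
    also have "\<dots> = (\<integral>\<^sup>+x. indicator (A - N) x \<partial>\<nu>)"
      using sets.sets_into_space[OF A(1)] by (intro nn_integral_cong) (auto simp: indicator_def)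
    also have "\<dots> = emeasure \<nu> (A - N)" using AN sets by simp
    also have "\<dots> = emeasure (density \<mu> F) (A - N)"
    proof -
      have "(A - N) \<inter> N = {}" by auto
      then show ?thesis using eq[OF AN] by simp
    qed
    also have "\<dots> = emeasure (density \<mu> F) A"
    proof (rule emeasure_eq_AE)
      have "AE x in \<mu>. x \<notin> N" by (rule AE_not_in[OF N])
      then have "AE x in density \<mu> F. x \<notin> N"
        unfolding AE_density[OF F_meas] by eventually_elim simp
      then show "AE x in density \<mu> F. (x \<in> A - N) = (x \<in> A)" by eventually_elim auto
    qed (use A AN in auto)
    finally show "emeasure (density \<nu> ?I) A = emeasure (density \<mu> F) A" .
  qed
  have "density \<mu> (\<lambda>x. F x * ennreal (\<kappa> x)) = density (density \<mu> F) (\<lambda>x. ennreal (\<kappa> x))"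
    by (rule density_density_eq[OF F_meas k', symmetric])
  also have "\<dots> = density (density \<nu> ?I) (\<lambda>x. ennreal (\<kappa> x))" by (simp only: dI)
  also have "\<dots> = density \<nu> (\<lambda>x. ?I x * ennreal (\<kappa> x))"
    by (rule density_density_eq[OF borel[OF I\<mu>] borel[OF k']])
  also have "\<dots> = density \<nu> (\<lambda>x. ennreal (\<kappa> x) * ?I x)" by (simp only: mult.commute)
  also have "\<dots> = density (density \<nu> (\<lambda>x. ennreal (\<kappa> x))) ?I"
    by (rule density_density_eq[OF borel[OF k'] borel[OF I\<mu>], symmetric])
  also have "\<dots> = density \<mu> ?I" by (simp only: \<mu>[symmetric])
  also have "\<dots> = density \<mu> (\<lambda>_. 1)"
  proof (rule density_cong[OF I\<mu>])
    have "AE x in \<mu>. x \<notin> N" by (rule AE_not_in[OF N])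
    then show "AE x in \<mu>. ?I x = 1" using AE_space by eventually_elim simp
  qed simp
  finally have "AE x in \<mu>. F x * ennreal (\<kappa> x) = 1"
    using F_meas k' by (subst (asm) m.density_unique_iff) auto
  then show ?thesis
  proof eventually_elim
    case (elim x)
    have "enn2real (F x * ennreal (\<kappa> x)) = 1" by (simp only: elim enn2real_1)
    then have e: "enn2real (F x) * \<kappa> x = 1"
      unfolding enn2real_mult enn2real_ennreal[OF \<kappa>(2)] .
    then have "\<kappa> x \<noteq> 0" by auto
    then have k: "\<kappa> x > 0" using \<kappa>(2)[of x] by simp
    then have "enn2real (F x) = 1 / \<kappa> x" using e by (simp add: field_simps)
    then show ?case using k by (simp add: ln_div)
  qed
qed

lemma distr_density_inverse:
  assumes T: "T \<in> \<mu> \<rightarrow>\<^sub>M N" "T' \<in> N \<rightarrow>\<^sub>M \<mu>" and inv: "\<And>x. x \<in> space \<mu> \<Longrightarrow> T' (T x) = x"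
    and f: "f \<in> borel_measurable \<mu>"
  shows "distr (density \<mu> f) N T = density (distr \<mu> N T) (\<lambda>x. f (T' x))"
proof -
  have m: "(\<lambda>x. f (T' (T x))) \<in> borel_measurable \<mu>"
    by (rule measurable_compose[OF measurable_compose[OF T] f])
  have "density (distr \<mu> N T) (\<lambda>x. f (T' x)) = distr (density \<mu> (\<lambda>x. f (T' (T x)))) N T"
    by (rule density_distr[OF measurable_compose[OF T(2) f] T(1)])
  also have "density \<mu> (\<lambda>x. f (T' (T x))) = density \<mu> f"
    using inv by (intro density_cong[OF m f]) (auto intro!: AE_I2)
  finally show ?thesis ..
qed

context boundary_walk
begin

text \<open>
  For a state \<open>y\<close> that the walk from colour \<open>u\<close> can reach, the law \<open>nu y\<close> is dominated by a multiple
  of the harmonic measure of \<open>u\<close>.  The density \<open>dens u y\<close> is picked real-valued and bounded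
  everywhere, rather than being the Radon-Nikodym derivative, which may take infinite values.
\<close>

definition "reach u y \<longleftrightarrow> y \<in> X \<and> (\<exists>n. 0 < q n u y)"

definition "is_dens u y f \<longleftrightarrow> f \<in> borel_measurable Bd \<and> (\<forall>\<xi>. 0 \<le> f \<xi>) \<and> (\<exists>C. \<forall>\<xi>. f \<xi> \<le> C) \<and>
  nu y = density (pinf u) (\<lambda>\<xi>. ennreal (f \<xi>))"

definition "dens u y = (SOME f :: 'a letter stream \<Rightarrow> real. is_dens u y f)"

lemma finite_pinf: "finite_measure (pinf u)"
  using prob_pinf[of u] by (simp add: prob_space_def)

lemma finite_nu: "y \<in> X \<Longrightarrow> finite_measure (nu y)"
  using prob_nu[of y] by (simp add: prob_space_def)

lemma borel_pinf: "borel_measurable (pinf u) = borel_measurable Bd"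
  by (rule measurable_cong_sets[OF sets_pinf refl])

lemma q_nonneg_D: "y \<in> D n \<Longrightarrow> 0 \<le> q k u y"
  using D_X[of n] by (intro q_nonneg) blast

lemma nu_dominated:
  assumes "y \<in> X" "A \<in> sets Bd"
  shows "q n u y * measure (nu y) A \<le> measure (pinf u) A"
proof (cases "y \<in> D n")
  case True
  have "q n u y * measure (nu y) A \<le> (\<Sum>y\<in>D n. q n u y * measure (nu y) A)"
    using True q_nonneg_D by (intro member_le_sum finite_D) (auto intro!: mult_nonneg_nonneg)
  then show ?thesis by (simp only: pinf_decomp[OF assms(2), of u n])
qed (simp add: q_outside assms)

lemma is_dens_dens:
  assumes "reach u y"
  shows "is_dens u y (dens u y)"
proof -
  obtain n where n: "y \<in> X" "0 < q n u y" using assms by (auto simp: reach_def)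
  have "\<exists>f :: 'a letter stream \<Rightarrow> real. f \<in> borel_measurable (pinf u) \<and> (\<forall>x. 0 \<le> f x) \<and>
    (\<forall>x. f x \<le> 1 / q n u y) \<and> nu y = density (pinf u) (\<lambda>x. ennreal (f x))"
  proof (rule bounded_density[OF finite_pinf finite_nu[OF n(1)] _ n(2)])
    show "sets (nu y) = sets (pinf u)" by (simp only: sets_nu sets_pinf)
    show "q n u y * measure (nu y) A \<le> measure (pinf u) A" if "A \<in> sets (pinf u)" for A
      using that by (intro nu_dominated n(1)) (simp only: sets_pinf)
  qed
  then obtain f :: "'a letter stream \<Rightarrow> real" where f: "f \<in> borel_measurable (pinf u)" "\<forall>x. 0 \<le> f x"
    "\<forall>x. f x \<le> 1 / q n u y" "nu y = density (pinf u) (\<lambda>x. ennreal (f x))" by blast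
  have "is_dens u y f" unfolding is_dens_def using f by (auto simp only: borel_pinf)
  then show ?thesis unfolding dens_def by (rule someI[of "is_dens u y"])
qed

lemma dens_facts:
  assumes "reach u y"
  shows "dens u y \<in> borel_measurable Bd" "\<And>\<xi>. 0 \<le> dens u y \<xi>"
    "nu y = density (pinf u) (\<lambda>\<xi>. ennreal (dens u y \<xi>))"
  using is_dens_dens[OF assms] unfolding is_dens_def by blast+

lemma dens_bounded:
  assumes "reach u y"
  shows "\<exists>C. \<forall>\<xi>. dens u y \<xi> \<le> C"
  using is_dens_dens[OF assms] unfolding is_dens_def by blast

lemma integral_dens:
  fixes g :: "'a letter stream \<Rightarrow> real"
  assumes "reach u y" and "g \<in> borel_measurable Bd"
  shows "(\<integral>\<xi>. g \<xi> \<partial>nu y) = (\<integral>\<xi>. dens u y \<xi> * g \<xi> \<partial>pinf u)"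
  unfolding dens_facts(3)[OF assms(1)] using dens_facts(1,2)[OF assms(1)] assms(2)
  by (subst integral_density) (auto simp: borel_pinf)

lemma measure_dens:
  assumes "reach u y" and A: "A \<in> sets Bd"
  shows "measure (nu y) A = (\<integral>\<xi>. dens u y \<xi> * indicator A \<xi> \<partial>pinf u)"
proof -
  have "measure (nu y) A = (\<integral>\<xi>. indicator A \<xi> \<partial>nu y)"
    using sets.sets_into_space[OF A] sets_eq_imp_space_eq[OF sets_nu[of y]] by (simp add: Int_absorb2)
  also have "\<dots> = (\<integral>\<xi>. dens u y \<xi> * indicator A \<xi> \<partial>pinf u)"
    using A by (intro integral_dens assms(1)) simp
  finally show ?thesis .
qed

lemma integrable_dens:
  fixes g :: "'a letter stream \<Rightarrow> real"
  assumes "reach u y" "integrable (pinf u) g"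
  shows "integrable (nu y) g" "integrable (pinf u) (\<lambda>\<xi>. dens u y \<xi> * g \<xi>)"
proof -
  obtain C where C: "\<And>\<xi>. dens u y \<xi> \<le> C" using dens_bounded[OF assms(1)] by blast
  have m: "dens u y \<in> borel_measurable (pinf u)" using dens_facts(1)[OF assms(1)] by (simp only: borel_pinf)
  show "integrable (nu y) g" unfolding dens_facts(3)[OF assms(1)]
    by (rule integrable_bounded_density[OF m dens_facts(2)[OF assms(1)] C assms(2)])
  show "integrable (pinf u) (\<lambda>\<xi>. dens u y \<xi> * g \<xi>)"
    by (rule integrable_bounded_mult[OF m dens_facts(2)[OF assms(1)] C assms(2)])
qed

lemma integrable_dens_ln:
  assumes "reach u y"
  shows "integrable (nu y) (\<lambda>\<xi>. ln (dens u y \<xi>))"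
    "integrable (pinf u) (\<lambda>\<xi>. dens u y \<xi> * ln (dens u y \<xi>))"
    "integrable (pinf u) (dens u y)"
proof -
  obtain C where C: "\<And>\<xi>. dens u y \<xi> \<le> C" using dens_bounded[OF assms] by blast
  have m: "dens u y \<in> borel_measurable (pinf u)" using dens_facts(1)[OF assms] by (simp only: borel_pinf)
  show "integrable (nu y) (\<lambda>\<xi>. ln (dens u y \<xi>))"
    by (subst dens_facts(3)[OF assms])
      (rule integrable_density_ln[OF finite_pinf m dens_facts(2)[OF assms] C])
  show "integrable (pinf u) (\<lambda>\<xi>. dens u y \<xi> * ln (dens u y \<xi>))"
    by (rule integrable_mult_ln[OF finite_pinf m dens_facts(2)[OF assms] C])
  have "integrable (pinf u) (\<lambda>_. 1 :: real)"
    using finite_pinf[of u] by (simp add: finite_measure.integrable_const)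
  from integrable_dens(2)[OF assms this] show "integrable (pinf u) (dens u y)" by simp
qed

lemma dens_pos: "reach u y \<Longrightarrow> AE \<xi> in nu y. 0 < dens u y \<xi>"
proof -
  assume r: "reach u y"
  have "(\<lambda>\<xi>. ennreal (dens u y \<xi>)) \<in> borel_measurable (pinf u)"
    using dens_facts(1)[OF r] by (simp add: borel_pinf)
  then show ?thesis
    by (subst dens_facts(3)[OF r], subst AE_density) (auto simp: ennreal_less_zero_iff)
qed

lemma AE_nu_of_AE_pinf: "reach u y \<Longrightarrow> AE \<xi> in pinf u. P \<xi> \<Longrightarrow> AE \<xi> in nu y. P \<xi>"
proof -
  assume r: "reach u y" and P: "AE \<xi> in pinf u. P \<xi>"
  have "(\<lambda>\<xi>. ennreal (dens u y \<xi>)) \<in> borel_measurable (pinf u)"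
    using dens_facts(1)[OF r] by (simp add: borel_pinf)
  then show ?thesis
    by (subst dens_facts(3)[OF r], subst AE_density) (use P in auto)
qed

lemma reach_pos: "y \<in> D n \<Longrightarrow> q n u y \<noteq> 0 \<Longrightarrow> reach u y"
  using q_nonneg[of y n u] D_X[of n] unfolding reach_def by (metis less_eq_real_def subsetD)

text \<open>
  Hence \<open>q n u y * dens u y \<xi>\<close> is, as a function of \<open>y\<close>, a probability distribution: the conditional
  law of \<open>Y n\<close> given that the limit is \<open>\<xi>\<close>.
\<close>

lemma sum_dens:
  "AE \<xi> in pinf u. (\<Sum>y\<in>D n. q n u y * dens u y \<xi>) = 1"
proof -
  interpret finite_measure "pinf u" by (rule finite_pinf)
  let ?S = "\<lambda>\<xi>. \<Sum>y\<in>{y \<in> D n. q n u y \<noteq> 0}. q n u y * dens u y \<xi>"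
  have r: "reach u y" if "y \<in> {y \<in> D n. q n u y \<noteq> 0}" for y using that reach_pos by blast
  have S_eq: "(\<Sum>y\<in>D n. q n u y * dens u y \<xi>) = ?S \<xi>" for \<xi>
    by (rule sum.mono_neutral_right[OF finite_D]) auto
  have fin: "finite {y \<in> D n. q n u y \<noteq> 0}" using finite_D by simp
  have S_meas: "?S \<in> borel_measurable (pinf u)"
    unfolding borel_pinf using dens_facts(1)[OF r] by (intro borel_measurable_sum borel_measurable_times) auto
  have S_nn: "0 \<le> ?S \<xi>" for \<xi>
    using q_nonneg_D dens_facts(2)[OF r] by (intro sum_nonneg mult_nonneg_nonneg) auto
  have S_int: "integrable (pinf u) ?S"
    using integrable_dens_ln(3)[OF r] by (intro Bochner_Integration.integrable_sum integrable_mult_right) auto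
  have "density (pinf u) (\<lambda>\<xi>. ennreal (?S \<xi>)) = density (pinf u) (\<lambda>_. 1)"
  proof (rule measure_eqI)
    fix A assume "A \<in> sets (density (pinf u) (\<lambda>\<xi>. ennreal (?S \<xi>)))"
    then have A: "A \<in> sets (pinf u)" "A \<in> sets Bd" by (auto simp: sets_pinf)
    have iA: "integrable (pinf u) (\<lambda>\<xi>. dens u y \<xi> * indicator A \<xi>)" if "y \<in> {y \<in> D n. q n u y \<noteq> 0}" for y
      using integrable_mult_indicator[OF A(1) integrable_dens_ln(3)[OF r[OF that]]] by (simp add: mult.commute)
    have "emeasure (density (pinf u) (\<lambda>\<xi>. ennreal (?S \<xi>))) A = (\<integral>\<^sup>+\<xi>. ennreal (?S \<xi> * indicator A \<xi>) \<partial>pinf u)"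
      using S_meas A by (subst emeasure_density) (auto simp: ennreal_mult'' ennreal_indicator intro!: nn_integral_cong)
    also have "\<dots> = ennreal (\<integral>\<xi>. ?S \<xi> * indicator A \<xi> \<partial>pinf u)"
      using integrable_mult_indicator[OF A(1) S_int] S_nn
      by (intro nn_integral_eq_integral) (auto simp: mult.commute)
    also have "(\<integral>\<xi>. ?S \<xi> * indicator A \<xi> \<partial>pinf u) =
        (\<integral>\<xi>. (\<Sum>y\<in>{y \<in> D n. q n u y \<noteq> 0}. q n u y * (dens u y \<xi> * indicator A \<xi>)) \<partial>pinf u)"
      by (simp only: sum_distrib_right mult.assoc)
    also have "\<dots> = (\<Sum>y\<in>{y \<in> D n. q n u y \<noteq> 0}. q n u y * (\<integral>\<xi>. dens u y \<xi> * indicator A \<xi> \<partial>pinf u))"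
      using iA by (subst Bochner_Integration.integral_sum) auto
    also have "\<dots> = (\<Sum>y\<in>{y \<in> D n. q n u y \<noteq> 0}. q n u y * measure (nu y) A)"
      by (intro sum.cong refl arg_cong2[where f = "(*)"] measure_dens[symmetric] r A)
    also have "\<dots> = (\<Sum>y\<in>D n. q n u y * measure (nu y) A)"
      by (rule sum.mono_neutral_left[OF finite_D]) auto
    also have "\<dots> = measure (pinf u) A" by (rule pinf_decomp[OF A(2), symmetric])
    finally show "emeasure (density (pinf u) (\<lambda>\<xi>. ennreal (?S \<xi>))) A = emeasure (density (pinf u) (\<lambda>_. 1)) A"
      using A by (simp add: emeasure_eq_measure density_1)
  qed simp
  then have "AE \<xi> in pinf u. ennreal (?S \<xi>) = 1"
    using S_meas by (subst (asm) density_unique_iff) auto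
  then show ?thesis unfolding S_eq
    by eventually_elim (simp only: ennreal_eq_1)
qed

end

section \<open>The information carried by the limit\<close>

context boundary_walk
begin

lemma q_step_ge:
  assumes s: "s \<in> L" and x: "x \<in> W"
  shows "p [s] $ u $ v * q n v (x, w) \<le> q (Suc n) u (mu s x, w)"
proof -
  let ?F = "\<lambda>t v. p [t] $ u $ v * q n v (mu (ginv t) (mu s x), w)"
  have nn: "0 \<le> ?F t v" if "t \<in> L" for t v
    using that x s by (intro mult_nonneg_nonneg p_nonneg q_nonneg) (auto intro!: mu_W inv_L)
  have "p [s] $ u $ v * q n v (x, w) = ?F s v" by (simp only: mu_ginv[OF s x])
  also have "\<dots> \<le> (\<Sum>v\<in>UNIV. ?F s v)"
    by (rule member_le_sum) (use nn[OF s] in auto)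
  also have "\<dots> \<le> (\<Sum>t\<in>L. \<Sum>v\<in>UNIV. ?F t v)"
    by (rule member_le_sum[OF s _ finite_L]) (use nn in \<open>auto intro!: sum_nonneg\<close>)
  also have "\<dots> = q (Suc n) u (mu s x, w)" by (rule q_Suc[OF mu_W[OF s x], symmetric])
  finally show ?thesis .
qed

lemma reach_step:
  assumes "s \<in> L" "0 < p [s] $ u $ v" "reach v (x, w)"
  shows "reach u (mu s x, w)"
proof -
  obtain n where n: "x \<in> W" "0 < q n v (x, w)" using assms(3) by (auto simp: reach_def)
  then have "0 < q (Suc n) u (mu s x, w)"
    using q_step_ge[OF assms(1) n(1), of u v n w] mult_pos_pos[OF assms(2) n(2)] by linarith
  then show ?thesis using mu_W[OF assms(1) n(1)] by (auto simp: reach_def)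
qed

lemma reach_start: "reach v ([], v)"
  unfolding reach_def by (auto simp: W_Nil q_0 intro!: exI[of _ 0])

lemma mu_Nil: "mu s [] = [s]" by (simp add: letter_mult_word_def)

lemma reach_letter: "s \<in> L \<Longrightarrow> 0 < p [s] $ u $ v \<Longrightarrow> reach u ([s], v)"
  using reach_step[OF _ _ reach_start] by (simp only: mu_Nil)

lemma measurable_bact_nu: "x \<in> W \<Longrightarrow> bact x \<in> nu y \<rightarrow>\<^sub>M Bd"
  using measurable_bact[of x] measurable_cong_sets[OF sets_nu refl] by blast

lemma space_pinf: "space (pinf u) = BS"
  using sets_eq_imp_space_eq[OF sets_pinf] space_boundary by simp

lemma space_nu: "space (nu y) = BS"
  using sets_eq_imp_space_eq[OF sets_nu] space_boundary by simp

lemma nu_step: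
  assumes s: "s \<in> L" and x: "x \<in> W"
  shows "nu (mu s x, w) = distr (nu (x, w)) Bd (bact [s])"
proof -
  have "distr (nu (x, w)) Bd (bact [s]) = distr (pinf w) Bd (bact [s] \<circ> bact x)"
    unfolding nu_def act_measure_def fst_conv snd_conv
    by (rule distr_distr[OF measurable_bact[OF sing_W[OF s]] measurable_bact_pinf[OF x]])
  also have "\<dots> = distr (pinf w) Bd (bact (mu s x))"
  proof (rule distr_cong[OF refl refl])
    fix \<xi> assume "\<xi> \<in> space (pinf w)"
    then have \<xi>: "\<xi> \<in> BS" by (simp only: space_pinf)
    have "mu s x = foldr mu [s] x" by simp
    then show "(bact [s] \<circ> bact x) \<xi> = bact (mu s x) \<xi>"
      using act_mult[OF sing_W[OF s] x \<xi>] by (simp only: comp_def)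
  qed
  finally show ?thesis by (simp only: nu_def act_measure_def fst_conv snd_conv)
qed

lemma nu_start: "nu ([], v) = pinf v"
proof -
  have "bact [] = (\<lambda>\<xi>. \<xi>)" by (simp add: boundary_act_def fun_eq_iff)
  then show ?thesis unfolding nu_def act_measure_def fst_conv snd_conv
    using distr_id2[of Bd "pinf v"] sets_pinf by (simp only: distr_id2)
qed

lemma nu_letter: "s \<in> L \<Longrightarrow> nu ([s], v) = distr (pinf v) Bd (bact [s])"
  using nu_step[OF _ W_Nil, of s v] by (simp only: mu_Nil nu_start)

text \<open>
  The chain rule.  The law \<open>nu ([s], v)\<close> is the translate by \<open>s\<close> of the harmonic measure of \<open>v\<close>, so
  the density of \<open>nu (s x, w)\<close> with respect to it is the translated density \<open>dens v (x, w)\<close>.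
\<close>

lemma dens_step:
  assumes s: "s \<in> L" and p: "0 < p [s] $ u $ v" and r: "reach v (x, w)"
  shows "AE \<xi> in pinf u. dens u (mu s x, w) \<xi> = dens u ([s], v) \<xi> * dens v (x, w) (bact [ginv s] \<xi>)"
proof -
  interpret finite_measure "pinf u" by (rule finite_pinf)
  have x: "x \<in> W" using r by (simp add: reach_def)
  note r1 = reach_letter[OF s p] and r2 = reach_step[OF s p r]
  let ?T = "bact [s]" and ?T' = "bact [ginv s]"
  let ?f = "\<lambda>\<xi>. ennreal (dens v (x, w) \<xi>)"
  have T': "?T' \<in> Bd \<rightarrow>\<^sub>M Bd" by (rule measurable_bact[OF sing_W[OF inv_L[OF s]]])
  have T: "?T \<in> pinf v \<rightarrow>\<^sub>M Bd" by (rule measurable_bact_pinf[OF sing_W[OF s]])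
  have T'p: "?T' \<in> Bd \<rightarrow>\<^sub>M pinf v" using T' measurable_cong_sets[OF refl sets_pinf] by blast
  have fB: "?f \<in> borel_measurable Bd"
    using dens_facts(1)[OF r] by simp
  then have f: "?f \<in> borel_measurable (pinf v)" by (simp only: borel_pinf)
  have fT': "(\<lambda>\<xi>. ?f (?T' \<xi>)) \<in> borel_measurable Bd" by (rule measurable_compose[OF T' fB])
  have kB: "(\<lambda>\<xi>. ennreal (dens u ([s], v) \<xi>)) \<in> borel_measurable (pinf u)"
    unfolding borel_pinf using dens_facts(1)[OF r1] by simp
  have gB: "(\<lambda>\<xi>. ennreal (dens u (mu s x, w) \<xi>)) \<in> borel_measurable (pinf u)"
    unfolding borel_pinf using dens_facts(1)[OF r2] by simp
  have "density (pinf u) (\<lambda>\<xi>. ennreal (dens u (mu s x, w) \<xi>)) = nu (mu s x, w)"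
    by (rule dens_facts(3)[OF r2, symmetric])
  also have "\<dots> = distr (nu (x, w)) Bd ?T" by (rule nu_step[OF s x])
  also have "\<dots> = distr (density (pinf v) ?f) Bd ?T" by (simp only: dens_facts(3)[OF r, symmetric])
  also have "\<dots> = density (distr (pinf v) Bd ?T) (\<lambda>\<xi>. ?f (?T' \<xi>))"
    using act_ginv(1)[OF s] by (intro distr_density_inverse T T'p f) (simp only: space_pinf)
  also have "distr (pinf v) Bd ?T = nu ([s], v)" by (rule nu_letter[OF s, symmetric])
  also have "\<dots> = density (pinf u) (\<lambda>\<xi>. ennreal (dens u ([s], v) \<xi>))" by (rule dens_facts(3)[OF r1])
  also have "density \<dots> (\<lambda>\<xi>. ?f (?T' \<xi>)) = density (pinf u) (\<lambda>\<xi>. ennreal (dens u ([s], v) \<xi>) * ?f (?T' \<xi>))"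
    using fT' by (intro density_density_eq kB) (simp only: borel_pinf)
  finally have "AE \<xi> in pinf u. ennreal (dens u (mu s x, w) \<xi>) = ennreal (dens u ([s], v) \<xi>) * ?f (?T' \<xi>)"
    using borel_measurable_times_ennreal[OF kB fT'[folded borel_pinf[of u]]] gB by (subst (asm) density_unique_iff)
  then show ?thesis
  proof eventually_elim
    case (elim \<xi>)
    have "ennreal (dens u (mu s x, w) \<xi>) = ennreal (dens u ([s], v) \<xi> * dens v (x, w) (?T' \<xi>))"
      unfolding elim using dens_facts(2)[OF r1] by (simp add: ennreal_mult dens_facts(2)[OF r])
    then show ?case
      using dens_facts(2)[OF r1] dens_facts(2)[OF r] dens_facts(2)[OF r2]
      by (subst (asm) ennreal_inj) (auto intro!: mult_nonneg_nonneg)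
  qed
qed

text \<open>
  \<open>info u y\<close> is the relative entropy of \<open>nu y\<close> with respect to the harmonic measure of \<open>u\<close>.
\<close>

definition "info u y = (\<integral>\<xi>. ln (dens u y \<xi>) \<partial>nu y)"

text \<open>
  The logarithmic density of the first step, seen from the position reached by that step.
\<close>

definition "letter_ln s u v \<xi> = ln (dens u ([s], v) (bact [s] \<xi>))"

lemma letter_ln_integrable:
  assumes s: "s \<in> L" and p: "0 < p [s] $ u $ v"
  shows "integrable (pinf v) (letter_ln s u v)"
    and "(\<integral>\<xi>. letter_ln s u v \<xi> \<partial>pinf v) = info u ([s], v)"
proof -
  note r = reach_letter[OF s p]
  have T: "bact [s] \<in> pinf v \<rightarrow>\<^sub>M Bd" by (rule measurable_bact_pinf[OF sing_W[OF s]])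
  have m: "(\<lambda>\<xi>. ln (dens u ([s], v) \<xi>)) \<in> borel_measurable Bd"
    using dens_facts(1)[OF r] by simp
  show "integrable (pinf v) (letter_ln s u v)"
    using integrable_dens_ln(1)[OF r] unfolding nu_letter[OF s] letter_ln_def[abs_def] integrable_distr_eq[OF T m] .
  show "(\<integral>\<xi>. letter_ln s u v \<xi> \<partial>pinf v) = info u ([s], v)"
    unfolding info_def nu_letter[OF s] letter_ln_def integral_distr[OF T m] ..
qed

lemma info_step:
  assumes s: "s \<in> L" and p: "0 < p [s] $ u $ v" and r: "reach v (x, w)"
  shows "info u (mu s x, w) = (\<integral>\<xi>. letter_ln s u v \<xi> \<partial>nu (x, w)) + info v (x, w)"
proof -
  have x: "x \<in> W" using r by (simp add: reach_def)
  note r1 = reach_letter[OF s p] and r2 = reach_step[OF s p r]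
  let ?T = "bact [s]" and ?T' = "bact [ginv s]"
  have T: "?T \<in> nu (x, w) \<rightarrow>\<^sub>M Bd" by (rule measurable_bact_nu[OF sing_W[OF s]])
  have T': "?T' \<in> Bd \<rightarrow>\<^sub>M Bd" by (rule measurable_bact[OF sing_W[OF inv_L[OF s]]])
  have Tp: "?T \<in> pinf v \<rightarrow>\<^sub>M Bd" by (rule measurable_bact_pinf[OF sing_W[OF s]])
  have m: "(\<lambda>\<xi>. ln (dens u (mu s x, w) \<xi>)) \<in> borel_measurable Bd"
    using dens_facts(1)[OF r2] by simp
  note d = dens_facts(1)[OF r1] dens_facts(1)[OF r2] measurable_compose[OF T' dens_facts(1)[OF r]]
  let ?P = "\<lambda>\<xi>. dens u (mu s x, w) \<xi> = dens u ([s], v) \<xi> * dens v (x, w) (?T' \<xi>) \<and> 0 < dens u ([s], v) \<xi>"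
  have PB: "{\<xi> \<in> space Bd. ?P \<xi>} \<in> sets Bd" using d by measurable
  have "AE \<xi> in nu ([s], v). ?P \<xi>"
    using AE_nu_of_AE_pinf[OF r1 dens_step[OF s p r]] dens_pos[OF r1] by eventually_elim simp
  then have "AE \<xi> in pinf v. ?P (?T \<xi>)"
    unfolding nu_letter[OF s] using AE_distr_iff[OF Tp PB] by blast
  from AE_nu_of_AE_pinf[OF r this] have AE: "AE \<xi> in nu (x, w). ln (dens u (mu s x, w) (?T \<xi>)) = letter_ln s u v \<xi> + ln (dens v (x, w) \<xi>)"
    using dens_pos[OF r] AE_space
  proof eventually_elim
    case (elim \<xi>)
    have "?T' (?T \<xi>) = \<xi>" using elim(3) by (intro act_ginv(1)[OF s]) (simp only: space_nu)
    then show ?case using elim(1,2) by (simp add: letter_ln_def ln_mult)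
  qed
  have i1: "integrable (nu (x, w)) (letter_ln s u v)"
    by (rule integrable_dens(1)[OF r letter_ln_integrable(1)[OF s p]])
  have "info u (mu s x, w) = (\<integral>\<xi>. ln (dens u (mu s x, w) (?T \<xi>)) \<partial>nu (x, w))"
    unfolding info_def nu_step[OF s x] by (rule integral_distr[OF T m])
  also have "\<dots> = (\<integral>\<xi>. letter_ln s u v \<xi> + ln (dens v (x, w) \<xi>) \<partial>nu (x, w))"
    using borel_measurable_integrable[OF i1] borel_measurable_integrable[OF integrable_dens_ln(1)[OF r]]
    by (intro integral_cong_AE measurable_compose[OF T m] AE) simp
  also have "\<dots> = (\<integral>\<xi>. letter_ln s u v \<xi> \<partial>nu (x, w)) + info v (x, w)"
    unfolding info_def by (rule Bochner_Integration.integral_add[OF i1 integrable_dens_ln(1)[OF r]])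
  finally show ?thesis .
qed

lemma integral_pinf_decomp:
  assumes g: "integrable (pinf u) g"
  shows "(\<Sum>y\<in>D n. q n u y * (\<integral>\<xi>. g \<xi> \<partial>nu y)) = (\<integral>\<xi>. g \<xi> \<partial>pinf u)"
proof -
  let ?E = "{y \<in> D n. q n u y \<noteq> 0}"
  have r: "reach u y" if "y \<in> ?E" for y using that reach_pos by blast
  have gB: "g \<in> borel_measurable Bd" using borel_measurable_integrable[OF g] by (simp only: borel_pinf)
  have "(\<Sum>y\<in>D n. q n u y * (\<integral>\<xi>. g \<xi> \<partial>nu y)) = (\<Sum>y\<in>?E. q n u y * (\<integral>\<xi>. g \<xi> \<partial>nu y))"
    by (rule sum.mono_neutral_right[OF finite_D]) auto
  also have "\<dots> = (\<Sum>y\<in>?E. \<integral>\<xi>. q n u y * (dens u y \<xi> * g \<xi>) \<partial>pinf u)"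
    using integrable_dens(2)[OF r g] by (intro sum.cong refl) (simp add: integral_dens[OF r gB])
  also have "\<dots> = (\<integral>\<xi>. (\<Sum>y\<in>?E. q n u y * (dens u y \<xi> * g \<xi>)) \<partial>pinf u)"
    using integrable_dens(2)[OF r g] by (intro Bochner_Integration.integral_sum[symmetric] integrable_mult_right) auto
  also have "\<dots> = (\<integral>\<xi>. g \<xi> \<partial>pinf u)"
  proof (rule integral_cong_AE)
    show "(\<lambda>\<xi>. \<Sum>y\<in>?E. q n u y * (dens u y \<xi> * g \<xi>)) \<in> borel_measurable (pinf u)"
      using integrable_dens(2)[OF r g]
      by (intro borel_measurable_integrable Bochner_Integration.integrable_sum integrable_mult_right) auto
    show "g \<in> borel_measurable (pinf u)" by (rule borel_measurable_integrable[OF g])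
    show "AE \<xi> in pinf u. (\<Sum>y\<in>?E. q n u y * (dens u y \<xi> * g \<xi>)) = g \<xi>"
      using sum_dens[of n u]
    proof eventually_elim
      case (elim \<xi>)
      have "(\<Sum>y\<in>?E. q n u y * (dens u y \<xi> * g \<xi>)) = (\<Sum>y\<in>D n. q n u y * (dens u y \<xi> * g \<xi>))"
        by (rule sum.mono_neutral_left[OF finite_D]) auto
      also have "\<dots> = (\<Sum>y\<in>D n. q n u y * dens u y \<xi>) * g \<xi>"
        by (simp only: sum_distrib_right mult.assoc)
      finally show ?case using elim by simp
    qed
  qed
  finally show ?thesis .
qed

text \<open>
  This is the mutual information between \<open>Y n\<close> and the limit of the walk.
\<close>

definition "mean_info n u = (\<Sum>y\<in>D n. q n u y * info u y)"

text \<open>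
  Logarithms turn the chain rule into a sum.  The first summand no longer sees the later position,
  because averaging \<open>nu y\<close> over the positions at time \<open>n\<close> gives back the harmonic measure.
\<close>

lemma mean_info_Suc:
  "mean_info (Suc n) u = (\<Sum>s\<in>L. \<Sum>v\<in>UNIV. p [s] $ u $ v * (info u ([s], v) + mean_info n v))"
  unfolding mean_info_def sum_q_Suc
proof (intro sum.cong refl)
  fix s v assume s: "s \<in> L"
  show "p [s] $ u $ v * (\<Sum>y\<in>D n. q n v y * info u (mu s (fst y), snd y)) =
      p [s] $ u $ v * (info u ([s], v) + (\<Sum>y\<in>D n. q n v y * info v y))"
  proof (cases "p [s] $ u $ v = 0")
    case False
    then have p: "0 < p [s] $ u $ v" using p_nonneg[OF s, of u v] by simp
    have "q n v y * info u (mu s (fst y), snd y) = q n v y * (\<integral>\<xi>. letter_ln s u v \<xi> \<partial>nu y) + q n v y * info v y"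
      if "y \<in> D n" for y
    proof (cases "q n v y = 0")
      case False
      then have "reach v (fst y, snd y)" using reach_pos[OF that] by simp
      from info_step[OF s p this] show ?thesis by (simp add: ring_distribs)
    qed simp
    then have "(\<Sum>y\<in>D n. q n v y * info u (mu s (fst y), snd y)) =
        (\<Sum>y\<in>D n. q n v y * (\<integral>\<xi>. letter_ln s u v \<xi> \<partial>nu y)) + (\<Sum>y\<in>D n. q n v y * info v y)"
      by (simp add: sum.distrib)
    also have "(\<Sum>y\<in>D n. q n v y * (\<integral>\<xi>. letter_ln s u v \<xi> \<partial>nu y)) = info u ([s], v)"
      unfolding integral_pinf_decomp[OF letter_ln_integrable(1)[OF s p]] by (rule letter_ln_integrable(2)[OF s p])
    finally show ?thesis by simp
  qed simp
qed

text \<open>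
  The translate by \<open>s\<inverse>\<close> of the harmonic measure of \<open>u\<close> need not be absolutely continuous with respect
  to that of \<open>v\<close>, but the harmonic measure of \<open>v\<close> has a density with respect to it when the step
  \<open>s\<close> from \<open>u\<close> to \<open>v\<close> is possible; the integrand is minus the logarithm of that density.
\<close>

lemma info_lebesgue_deriv:
  assumes s: "s \<in> L" and p: "0 < p [s] $ u $ v"
  shows "(\<integral>\<xi>. ln (enn2real (lebesgue_deriv (pinf v) (act_measure d m Gs (inv\<^bsub>GP\<^esub> [s]) (pinf u)) \<xi>)) \<partial>pinf v) =
    - info u ([s], v)"
proof -
  note r = reach_letter[OF s p]
  let ?T = "bact [s]" and ?T' = "bact [ginv s]"
  let ?\<nu> = "nu ([ginv s], u)"
  have si: "ginv s \<in> L" by (rule inv_L[OF s])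
  have \<nu>: "act_measure d m Gs (inv\<^bsub>GP\<^esub> [s]) (pinf u) = ?\<nu>"
    by (simp only: nu_def inv_sing[OF s] fst_conv snd_conv)
  have fin: "finite_measure ?\<nu>" using sing_W[OF si] by (intro finite_nu) simp
  have sets: "sets ?\<nu> = sets (pinf v)" by (simp only: sets_nu sets_pinf)
  have T: "?T \<in> Bd \<rightarrow>\<^sub>M pinf u"
    using measurable_bact[OF sing_W[OF s]] measurable_cong_sets[OF refl sets_pinf] by blast
  have T': "?T' \<in> pinf u \<rightarrow>\<^sub>M Bd" by (rule measurable_bact_pinf[OF sing_W[OF si]])
  let ?\<kappa> = "\<lambda>\<xi>. dens u ([s], v) (?T \<xi>)"
  have \<kappa>B: "?\<kappa> \<in> borel_measurable Bd"
    by (rule measurable_compose[OF measurable_bact[OF sing_W[OF s]] dens_facts(1)[OF r]])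
  have kE: "(\<lambda>\<xi>. ennreal (dens u ([s], v) \<xi>)) \<in> borel_measurable (pinf u)"
    unfolding borel_pinf using dens_facts(1)[OF r] by simp
  have "density ?\<nu> (\<lambda>\<xi>. ennreal (?\<kappa> \<xi>)) = density (distr (pinf u) Bd ?T') (\<lambda>\<xi>. ennreal (?\<kappa> \<xi>))"
    by (simp only: nu_letter[OF si])
  also have "\<dots> = distr (density (pinf u) (\<lambda>\<xi>. ennreal (dens u ([s], v) \<xi>))) Bd ?T'"
    using act_ginv(2)[OF s] by (intro distr_density_inverse[symmetric] T T' kE) (simp only: space_pinf)
  also have "\<dots> = distr (nu ([s], v)) Bd ?T'" by (simp only: dens_facts(3)[OF r, symmetric])
  also have "\<dots> = nu (mu (ginv s) [s], v)" by (rule nu_step[OF si sing_W[OF s], symmetric])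
  also have "mu (ginv s) [s] = []" using mu_ginv[OF s W_Nil] by (simp only: mu_Nil)
  also have "nu ([], v) = pinf v" by (rule nu_start)
  finally have \<mu>: "pinf v = density ?\<nu> (\<lambda>\<xi>. ennreal (?\<kappa> \<xi>))" ..
  have F: "is_lebesgue_deriv (pinf v) ?\<nu> (lebesgue_deriv (pinf v) ?\<nu>)"
    by (rule is_lebesgue_deriv_lebesgue_deriv[OF finite_pinf fin sets])
  then have Fm: "lebesgue_deriv (pinf v) ?\<nu> \<in> borel_measurable (pinf v)"
    by (simp add: is_lebesgue_deriv_def)
  have AE: "AE \<xi> in pinf v. ln (enn2real (lebesgue_deriv (pinf v) ?\<nu> \<xi>)) = - ln (?\<kappa> \<xi>)"
    using \<kappa>B dens_facts(2)[OF r]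
    by (intro lebesgue_deriv_reciprocal[OF finite_pinf fin sets F _ _ \<mu>]) (simp_all only: borel_pinf)
  have "(\<integral>\<xi>. ln (enn2real (lebesgue_deriv (pinf v) ?\<nu> \<xi>)) \<partial>pinf v) = (\<integral>\<xi>. - letter_ln s u v \<xi> \<partial>pinf v)"
    unfolding letter_ln_def
  proof (rule integral_cong_AE[OF _ _ AE])
    show "(\<lambda>\<xi>. ln (enn2real (lebesgue_deriv (pinf v) ?\<nu> \<xi>))) \<in> borel_measurable (pinf v)"
      using Fm by measurable
    show "(\<lambda>\<xi>. - ln (?\<kappa> \<xi>)) \<in> borel_measurable (pinf v)"
      unfolding borel_pinf using \<kappa>B by measurable
  qed
  also have "\<dots> = - info u ([s], v)"
    by (simp only: Bochner_Integration.integral_minus letter_ln_integrable(2)[OF s p])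
  finally show ?thesis unfolding \<nu> .
qed

end

context stationary_walk
begin

lemma mean_info_tendsto:
  "(\<lambda>n. (\<Sum>u\<in>UNIV. \<pi> $ u * mean_info n u) / real n) \<longlonglongrightarrow>
    (\<Sum>s\<in>L. \<Sum>u\<in>UNIV. \<Sum>v\<in>UNIV. \<pi> $ u * p [s] $ u $ v * info u ([s], v))"
proof (rule tendsto_average_of_increments)
  have "(\<Sum>u\<in>UNIV. \<pi> $ u * mean_info (Suc n) u) - (\<Sum>u\<in>UNIV. \<pi> $ u * mean_info n u) =
      (\<Sum>s\<in>L. \<Sum>u\<in>UNIV. \<Sum>v\<in>UNIV. \<pi> $ u * p [s] $ u $ v * info u ([s], v))" for n
  proof -
    have "(\<Sum>u\<in>UNIV. \<pi> $ u * mean_info (Suc n) u) =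
      (\<Sum>u\<in>UNIV. \<pi> $ u * (\<Sum>s\<in>L. \<Sum>v\<in>UNIV. p [s] $ u $ v * info u ([s], v))) +
      (\<Sum>u\<in>UNIV. \<pi> $ u * (\<Sum>s\<in>L. \<Sum>v\<in>UNIV. p [s] $ u $ v * mean_info n v))"
      by (simp only: mean_info_Suc ring_distribs sum.distrib)
    then show ?thesis unfolding sum_pi_invariant sum_order by simp
  qed
  then show "(\<lambda>n. (\<Sum>u\<in>UNIV. \<pi> $ u * mean_info (Suc n) u) - (\<Sum>u\<in>UNIV. \<pi> $ u * mean_info n u)) \<longlonglongrightarrow>
      (\<Sum>s\<in>L. \<Sum>u\<in>UNIV. \<Sum>v\<in>UNIV. \<pi> $ u * p [s] $ u $ v * info u ([s], v))"
    by simp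
qed

end

section \<open>The entropy\<close>

text \<open>
  The inequality \<open>ln x \<le> x - 1\<close> at \<open>x = 1 / (t N)\<close>.
\<close>

lemma neg_mult_ln_le:
  fixes t N :: real
  assumes "0 \<le> t" "0 < N"
  shows "- (t * ln t) \<le> t * ln N + 1 / N - t"
proof (cases "t = 0")
  case False
  then have t: "t > 0" using assms by simp
  have "ln (1 / (t * N)) \<le> 1 / (t * N) - 1" using t assms by (intro ln_le_minus_one) simp
  then have "t * ln (1 / (t * N)) \<le> t * (1 / (t * N) - 1)" using t by (intro mult_left_mono) auto
  moreover have "t * ln (1 / (t * N)) = - (t * ln t) - t * ln N"
    using t assms by (simp add: ln_div ln_mult algebra_simps)
  moreover have "t * (1 / (t * N) - 1) = 1 / N - t" using t by (simp add: field_simps)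
  ultimately show ?thesis by linarith
qed (use assms in simp)

text \<open>
  Gibbs' inequality against the weight \<open>1 / N1\<close> on \<open>B\<close> and \<open>1 / N2\<close> off \<open>B\<close>: the entropy is governed
  by the size of \<open>B\<close> if \<open>t\<close> has little mass outside \<open>B\<close>.
\<close>

lemma entropy_le_two_scales:
  fixes t :: "'x \<Rightarrow> real"
  assumes A: "finite A" and t: "\<And>y. y \<in> A \<Longrightarrow> 0 \<le> t y" "(\<Sum>y\<in>A. t y) = 1"
    and N1: "1 \<le> N1" "real (card {y \<in> A. B y}) \<le> N1" and N2: "0 < N2" "real (card A) \<le> N2"
  shows "(\<Sum>y\<in>A. - (t y * ln (t y))) \<le> ln N1 + 2 + ln N2 * (\<Sum>y\<in>{y \<in> A. \<not> B y}. t y)"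
proof -
  have part: "(\<Sum>y\<in>E. - (t y * ln (t y))) \<le> ln N * (\<Sum>y\<in>E. t y) + 1"
    if E: "E \<subseteq> A" and N: "0 < N" "real (card E) \<le> N" for E N
  proof -
    have "(\<Sum>y\<in>E. - (t y * ln (t y))) \<le> (\<Sum>y\<in>E. t y * ln N + 1 / N)"
    proof (rule sum_mono)
      fix y assume "y \<in> E"
      then have "0 \<le> t y" using t(1) E by blast
      then show "- (t y * ln (t y)) \<le> t y * ln N + 1 / N" using neg_mult_ln_le[of "t y" N] N(1) by linarith
    qed
    also have "\<dots> = (\<Sum>y\<in>E. t y) * ln N + real (card E) / N"
      by (simp add: sum.distrib sum_distrib_right)
    also have "real (card E) / N \<le> 1" using N by simp
    finally show ?thesis by (simp add: mult.commute)
  qed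
  let ?B = "{y \<in> A. B y}" and ?C = "{y \<in> A. \<not> B y}"
  have U: "A = ?B \<union> ?C" "?B \<inter> ?C = {}" by auto
  have split: "sum g A = sum g ?B + sum g ?C" for g :: "'x \<Rightarrow> real"
    using A by (subst U(1), intro sum.union_disjoint) auto
  have "sum t ?B \<le> 1" using split[of t] t sum_nonneg[of ?C t] by auto
  then have "ln N1 * sum t ?B \<le> ln N1 * 1" using N1(1) by (intro mult_left_mono) auto
  moreover have "(\<Sum>y\<in>?B. - (t y * ln (t y))) \<le> ln N1 * sum t ?B + 1"
    using N1 by (intro part) auto
  moreover have "(\<Sum>y\<in>?C. - (t y * ln (t y))) \<le> ln N2 * sum t ?C + 1"
  proof (rule part)
    have "card ?C \<le> card A" using A by (intro card_mono) auto
    then show "real (card ?C) \<le> N2" using N2(2) by simp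
  qed (use N2 in auto)
  ultimately show ?thesis unfolding split[of "\<lambda>y. - (t y * ln (t y))"] by linarith
qed

lemma sum_powers_le: "(\<Sum>i\<le>n. a ^ i) \<le> (a + 1 :: nat) ^ n"
proof (induction n)
  case (Suc n)
  have h: "a ^ Suc n \<le> a * (a + 1) ^ n"
    unfolding power_Suc by (intro mult_left_mono power_mono) auto
  have "(a + 1) ^ Suc n = (a + 1) ^ n + a * (a + 1) ^ n" by simp
  then show ?case unfolding sum.atMost_Suc using add_mono[OF Suc.IH h] by (simp only:)
qed simp

context boundary_walk
begin

definition "colours = card (UNIV :: 'r set)"

lemma colours_pos: "0 < colours"
  unfolding colours_def by (simp add: card_gt_0_iff)

definition "growth = ln (real (card L) + 1)"

lemma growth_nonneg: "0 \<le> growth" by (simp add: growth_def)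

lemma card_words_times_colours:
  "card ({z. set z \<subseteq> L \<and> length z \<le> k} \<times> (UNIV :: 'r set)) \<le> colours * (card L + 1) ^ k"
  using sum_powers_le[of "card L" k]
  by (simp add: card_cartesian_product card_lists_length_le[OF finite_L] colours_def mult.commute)

lemma ln_count: "ln (real (colours * (card L + 1) ^ k)) = ln (real colours) + real k * growth"
proof -
  have "real (colours * (card L + 1) ^ k) = real colours * (real (card L) + 1) ^ k" by (simp add: add.commute)
  then show ?thesis using colours_pos by (simp add: ln_mult ln_realpow growth_def add.commute)
qed

lemma count_ge_1: "1 \<le> real (colours * (card L + 1) ^ k)"
proof -
  have "1 * 1 \<le> colours * (card L + 1) ^ k" using colours_pos by (intro mult_le_mono) auto
  then show ?thesis by linarith
qed

lemma card_D: "card (D n) \<le> colours * (card L + 1) ^ n"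
proof -
  have "D n \<subseteq> {z. set z \<subseteq> L \<and> length z \<le> n} \<times> UNIV" using W_set by (auto simp: D_def)
  then have "card (D n) \<le> card ({z. set z \<subseteq> L \<and> length z \<le> n} \<times> (UNIV :: 'r set))"
    by (intro card_mono finite_cartesian_product finite_lists_length_le finite_L) auto
  then show ?thesis using card_words_times_colours[of n] by linarith
qed

definition "walk_entropy n u = (\<Sum>y\<in>D n. q n u y * - ln (q n u y))"

text \<open>
  The entropy of the conditional law of \<open>Y n\<close> given that the limit is \<open>\<xi>\<close>.  States of probability
  zero are left out since \<open>dens u y\<close> is an arbitrary function for them.
\<close>

definition "cond_entropy n u \<xi> =
  (\<Sum>y\<in>{y \<in> D n. q n u y \<noteq> 0}. - (q n u y * dens u y \<xi> * ln (q n u y * dens u y \<xi>)))"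

lemma cond_entropy_term:
  assumes "y \<in> D n" "q n u y \<noteq> 0"
  shows "integrable (pinf u) (\<lambda>\<xi>. - (q n u y * dens u y \<xi> * ln (q n u y * dens u y \<xi>)))" (is "integrable _ ?g")
    and "(\<integral>\<xi>. - (q n u y * dens u y \<xi> * ln (q n u y * dens u y \<xi>)) \<partial>pinf u) =
      q n u y * - ln (q n u y) - q n u y * info u y"
proof -
  have r: "reach u y" by (rule reach_pos[OF assms])
  have q0: "0 < q n u y" using q_nonneg_D[OF assms(1), of n u] assms(2) by simp
  have e: "?g \<xi> = q n u y * - ln (q n u y) * dens u y \<xi> - q n u y * (dens u y \<xi> * ln (dens u y \<xi>))" for \<xi>
  proof (cases "dens u y \<xi> = 0")
    case False
    then have "0 < dens u y \<xi>" using dens_facts(2)[OF r, of \<xi>] by simp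
    then show ?thesis using q0 by (simp add: ln_mult algebra_simps)
  qed simp
  note i = integrable_dens_ln[OF r]
  show "integrable (pinf u) ?g" unfolding e
    by (intro Bochner_Integration.integrable_diff integrable_mult_right i)
  have "(\<integral>\<xi>. dens u y \<xi> \<partial>pinf u) = (\<integral>\<xi>. 1 \<partial>nu y)"
    using integral_dens[OF r, of "\<lambda>_. 1"] by simp
  also have "\<dots> = 1"
    using prob_space.prob_space[OF prob_nu[of y]] r by (simp add: reach_def)
  finally have d1: "(\<integral>\<xi>. dens u y \<xi> \<partial>pinf u) = 1" .
  have d2: "(\<integral>\<xi>. dens u y \<xi> * ln (dens u y \<xi>) \<partial>pinf u) = info u y"
    unfolding info_def using dens_facts(1)[OF r] by (intro integral_dens[OF r, symmetric]) simp
  show "(\<integral>\<xi>. ?g \<xi> \<partial>pinf u) = q n u y * - ln (q n u y) - q n u y * info u y"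
    unfolding e using i d1 d2 by (subst Bochner_Integration.integral_diff) simp_all
qed

lemma cond_entropy_integral:
  shows "integrable (pinf u) (cond_entropy n u)"
    and "(\<integral>\<xi>. cond_entropy n u \<xi> \<partial>pinf u) = walk_entropy n u - mean_info n u"
proof -
  let ?E = "{y \<in> D n. q n u y \<noteq> 0}"
  show "integrable (pinf u) (cond_entropy n u)"
    unfolding cond_entropy_def[abs_def] using cond_entropy_term(1)
    by (intro Bochner_Integration.integrable_sum) blast
  have "(\<integral>\<xi>. cond_entropy n u \<xi> \<partial>pinf u) =
      (\<Sum>y\<in>?E. \<integral>\<xi>. - (q n u y * dens u y \<xi> * ln (q n u y * dens u y \<xi>)) \<partial>pinf u)"
    unfolding cond_entropy_def using cond_entropy_term(1)
    by (intro Bochner_Integration.integral_sum) blast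
  also have "\<dots> = (\<Sum>y\<in>?E. q n u y * - ln (q n u y) - q n u y * info u y)"
    by (intro sum.cong refl cond_entropy_term(2)) auto
  also have "\<dots> = (\<Sum>y\<in>D n. q n u y * - ln (q n u y) - q n u y * info u y)"
    by (rule sum.mono_neutral_left[OF finite_D]) auto
  also have "\<dots> = walk_entropy n u - mean_info n u"
    by (simp only: sum_subtractf walk_entropy_def mean_info_def)
  finally show "(\<integral>\<xi>. cond_entropy n u \<xi> \<partial>pinf u) = walk_entropy n u - mean_info n u" .
qed

lemma q_dens_nonneg: "y \<in> D n \<Longrightarrow> q n u y \<noteq> 0 \<Longrightarrow> 0 \<le> q n u y * dens u y \<xi>"
  using q_nonneg_D[of y n n u] dens_facts(2)[OF reach_pos[of y n u]] by simp

lemma sum_dens_support: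
  "AE \<xi> in pinf u. (\<Sum>y\<in>{y \<in> D n. q n u y \<noteq> 0}. q n u y * dens u y \<xi>) = 1"
proof -
  have "(\<Sum>y\<in>D n. q n u y * dens u y \<xi>) = (\<Sum>y\<in>{y \<in> D n. q n u y \<noteq> 0}. q n u y * dens u y \<xi>)" for \<xi>
    by (rule sum.mono_neutral_right[OF finite_D]) auto
  then show ?thesis using sum_dens[of n u] by (simp only:)
qed

text \<open>
  Mutual information never exceeds entropy, as the difference is a conditional entropy, and the
  entropy of a discrete law is nonnegative.
\<close>

lemma mean_info_le_entropy: "mean_info n u \<le> walk_entropy n u"
proof -
  have "AE \<xi> in pinf u. 0 \<le> cond_entropy n u \<xi>"
    using sum_dens_support[of n u]
  proof eventually_elim
    case (elim \<xi>)
    show ?case unfolding cond_entropy_def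
    proof (rule sum_nonneg)
      fix y assume y: "y \<in> {y \<in> D n. q n u y \<noteq> 0}"
      let ?t = "q n u y * dens u y \<xi>"
      have t0: "0 \<le> ?t" using y q_dens_nonneg by blast
      have "?t \<le> (\<Sum>y\<in>{y \<in> D n. q n u y \<noteq> 0}. q n u y * dens u y \<xi>)"
        using y q_dens_nonneg finite_D by (intro member_le_sum) auto
      then have "?t \<le> 1" using elim by simp
      then have "?t * ln ?t \<le> 0" using t0 ln_le_minus_one[of ?t]
        by (cases "?t = 0") (auto intro!: mult_nonneg_nonpos simp del: mult_eq_0_iff)
      then show "0 \<le> - (?t * ln ?t)" by simp
    qed
  qed
  then have "0 \<le> (\<integral>\<xi>. cond_entropy n u \<xi> \<partial>pinf u)" by (rule integral_nonneg_AE)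
  then show ?thesis by (simp add: cond_entropy_integral)
qed

text \<open>
  The conditional entropy is small when \<open>Y n\<close> lies, with high probability, in a set of few elements
  that is determined by the limit.
\<close>

lemma entropy_le_mean_info:
  assumes B: "\<And>y. y \<in> D n \<Longrightarrow> {\<xi> \<in> space Bd. \<not> B y \<xi>} \<in> sets Bd"
    and k: "\<And>\<xi>. \<xi> \<in> BS \<Longrightarrow> card {y \<in> D n. B y \<xi>} \<le> colours * (card L + 1) ^ k"
  shows "walk_entropy n u - mean_info n u \<le> ln (real colours) + real k * growth + 2 +
    (ln (real colours) + real n * growth) * measure (M u) {\<omega> \<in> space (M u). Y n \<omega> \<in> D n \<and> \<not> B (Y n \<omega>) (Yinf \<omega>)}"
proof -
  interpret prob_space "pinf u" by (rule prob_pinf)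
  let ?E = "{y \<in> D n. q n u y \<noteq> 0}"
  let ?N1 = "real (colours * (card L + 1) ^ k)" and ?N2 = "real (colours * (card L + 1) ^ n)"
  let ?bad = "\<lambda>y. {\<xi> \<in> space Bd. \<not> B y \<xi>}"
  let ?Q = "\<lambda>\<xi>. \<Sum>y\<in>?E. q n u y * (dens u y \<xi> * indicator (?bad y) \<xi>)"
  have r: "reach u y" if "y \<in> ?E" for y using that reach_pos by blast
  have bad: "?bad y \<in> sets (pinf u)" if "y \<in> ?E" for y using B that by (simp add: sets_pinf)
  have iQ1: "integrable (pinf u) (\<lambda>\<xi>. dens u y \<xi> * indicator (?bad y) \<xi>)" if "y \<in> ?E" for y
    using integrable_mult_indicator[OF bad[OF that] integrable_dens_ln(3)[OF r[OF that]]] by (simp add: mult.commute)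
  have iQ: "integrable (pinf u) ?Q"
    using iQ1 by (intro Bochner_Integration.integrable_sum integrable_mult_right) blast
  have "(\<integral>\<xi>. ?Q \<xi> \<partial>pinf u) = (\<Sum>y\<in>?E. q n u y * (\<integral>\<xi>. dens u y \<xi> * indicator (?bad y) \<xi> \<partial>pinf u))"
    using iQ1 by (subst Bochner_Integration.integral_sum) auto
  also have "\<dots> = (\<Sum>y\<in>?E. q n u y * measure (nu y) (?bad y))"
    using B by (intro sum.cong refl arg_cong2[where f = "(*)"] measure_dens[symmetric] r) auto
  also have "\<dots> = (\<Sum>y\<in>D n. q n u y * measure (nu y) (?bad y))"
    by (rule sum.mono_neutral_left[OF finite_D]) auto
  also have "\<dots> = measure (M u) {\<omega> \<in> space (M u). Y n \<omega> \<in> D n \<and> \<not> B (Y n \<omega>) (Yinf \<omega>)}"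
    using B by (intro law_Y_Yinf_sum(2)[symmetric])
  finally have Q: "(\<integral>\<xi>. ?Q \<xi> \<partial>pinf u) = \<dots>" .
  have "AE \<xi> in pinf u. cond_entropy n u \<xi> \<le> (ln ?N1 + 2) + ln ?N2 * ?Q \<xi>"
    using sum_dens_support[of n u] AE_space
  proof eventually_elim
    case (elim \<xi>)
    have \<xi>: "\<xi> \<in> BS" using elim(2) by (simp only: space_pinf)
    have "cond_entropy n u \<xi> \<le> ln ?N1 + 2 + ln ?N2 * (\<Sum>y\<in>{y \<in> ?E. \<not> B y \<xi>}. q n u y * dens u y \<xi>)"
      unfolding cond_entropy_def
    proof (rule entropy_le_two_scales)
      show "1 \<le> ?N1" by (rule count_ge_1)
      show "0 < ?N2" using count_ge_1[of n] by linarith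
      have "card {y \<in> ?E. B y \<xi>} \<le> card {y \<in> D n. B y \<xi>}" using finite_D by (intro card_mono) auto
      then have "card {y \<in> ?E. B y \<xi>} \<le> colours * (card L + 1) ^ k" using k[OF \<xi>] by (rule order_trans)
      then show "real (card {y \<in> ?E. B y \<xi>}) \<le> ?N1" by (simp only: of_nat_le_iff)
      have "card ?E \<le> card (D n)" using finite_D by (intro card_mono) auto
      then have "card ?E \<le> colours * (card L + 1) ^ n" using card_D by (rule order_trans)
      then show "real (card ?E) \<le> ?N2" by (simp only: of_nat_le_iff)
      show "finite ?E" using finite_D by simp
      show "0 \<le> q n u y * dens u y \<xi>" if "y \<in> ?E" for y using that q_dens_nonneg by blast
    qed (rule elim(1))
    also have "(\<Sum>y\<in>{y \<in> ?E. \<not> B y \<xi>}. q n u y * dens u y \<xi>) = ?Q \<xi>"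
      using finite_D \<xi> by (intro sum.mono_neutral_cong_left) (auto simp: space_boundary indicator_def)
    finally show ?case .
  qed
  then have "(\<integral>\<xi>. cond_entropy n u \<xi> \<partial>pinf u) \<le> (\<integral>\<xi>. (ln ?N1 + 2) + ln ?N2 * ?Q \<xi> \<partial>pinf u)"
    using iQ by (intro integral_mono_AE cond_entropy_integral(1) Bochner_Integration.integrable_add
        integrable_mult_right) auto
  also have "\<dots> = (ln ?N1 + 2) + ln ?N2 * (\<integral>\<xi>. ?Q \<xi> \<partial>pinf u)"
    using iQ by (subst Bochner_Integration.integral_add) (simp_all add: prob_space)
  finally show ?thesis unfolding Q cond_entropy_integral(2) ln_count by simp
qed

text \<open>
  The states near the point at distance \<open>\<gamma> n\<close> on the ray from the identity to \<open>\<xi>\<close>: up to \<open>2 \<epsilon> n\<close>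
  letters at the end, the word is a prefix of \<open>\<xi>\<close>.
\<close>

definition "near \<gamma> \<epsilon> n y \<xi> \<longleftrightarrow> real (length (fst y)) \<le> (\<gamma> + \<epsilon>) * real n \<and>
  take (nat \<lfloor>(\<gamma> - \<epsilon>) * real n\<rfloor>) (fst y) = stake (nat \<lfloor>(\<gamma> - \<epsilon>) * real n\<rfloor>) \<xi>"

lemma near_sets: "{\<xi> \<in> space Bd. \<not> near \<gamma> \<epsilon> n y \<xi>} \<in> sets Bd"
proof -
  let ?K = "nat \<lfloor>(\<gamma> - \<epsilon>) * real n\<rfloor>"
  have "{\<xi> \<in> space Bd. \<not> near \<gamma> \<epsilon> n y \<xi>} =
    (if real (length (fst y)) \<le> (\<gamma> + \<epsilon>) * real n then space Bd - {\<xi> \<in> space Bd. stake ?K \<xi> = take ?K (fst y)}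
     else space Bd)"
    by (auto simp: near_def)
  also have "\<dots> \<in> sets Bd" using cylinder_sets by auto
  finally show ?thesis .
qed

text \<open>
  A word near \<open>\<xi>\<close> is determined by what follows its prefix of length about \<open>(\<gamma> - \<epsilon>) n\<close>, that is by at
  most \<open>2 \<epsilon> n + 1\<close> letters, and by its colour.
\<close>

lemma card_near:
  assumes \<epsilon>: "0 < \<epsilon>"
  shows "\<exists>k. real k \<le> 2 * \<epsilon> * real n + 1 \<and>
    (\<forall>\<xi>. card {y \<in> D n. near \<gamma> \<epsilon> n (y :: 'a letter list \<times> 'r) \<xi>} \<le> colours * (card L + 1) ^ k)"
proof -
  let ?K = "nat \<lfloor>(\<gamma> - \<epsilon>) * real n\<rfloor>" and ?M = "nat \<lfloor>(\<gamma> + \<epsilon>) * real n\<rfloor>"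
  define k where "k = ?M - ?K"
  have "real k \<le> 2 * \<epsilon> * real n + 1"
  proof (cases "?K < ?M")
    case True
    have "real ?M \<le> (\<gamma> + \<epsilon>) * real n" using True by linarith
    moreover have "real ?K \<ge> (\<gamma> - \<epsilon>) * real n - 1" by linarith
    ultimately have "real k \<le> (\<gamma> + \<epsilon>) * real n - ((\<gamma> - \<epsilon>) * real n - 1)"
      using True unfolding k_def by linarith
    then show ?thesis by (simp add: algebra_simps)
  next
    case False
    then have "k = 0" unfolding k_def by linarith
    then show ?thesis using \<epsilon> by simp
  qed
  moreover have "card {y \<in> D n. near \<gamma> \<epsilon> n (y :: 'a letter list \<times> 'r) \<xi>} \<le> colours * (card L + 1) ^ k" for \<xi>
  proof -
    let ?Z = "{z. set z \<subseteq> L \<and> length z \<le> k} \<times> (UNIV :: 'r set)"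
    have Z: "finite ?Z" by (intro finite_cartesian_product finite_lists_length_le finite_L) auto
    have "{y \<in> D n. near \<gamma> \<epsilon> n (y :: 'a letter list \<times> 'r) \<xi>} \<subseteq> (\<lambda>z. (stake ?K \<xi> @ fst z, snd z)) ` ?Z"
    proof
      fix y :: "'a letter list \<times> 'r" assume "y \<in> {y \<in> D n. near \<gamma> \<epsilon> n y \<xi>}"
      then have y: "fst y \<in> W" "real (length (fst y)) \<le> (\<gamma> + \<epsilon>) * real n" "take ?K (fst y) = stake ?K \<xi>"
        by (auto simp: D_def near_def)
      have "length (fst y) \<le> ?M" using y(2) by (rule le_nat_floor)
      then have l: "length (drop ?K (fst y)) \<le> k" by (simp add: k_def)
      have "set (drop ?K (fst y)) \<subseteq> L" using set_drop_subset[of ?K "fst y"] W_set[OF y(1)] by (rule order_trans)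
      then have z: "(drop ?K (fst y), snd y) \<in> ?Z" using l by simp
      have "y = (stake ?K \<xi> @ drop ?K (fst y), snd y)"
        using append_take_drop_id[of ?K "fst y"] by (simp only: y(3) prod.collapse)
      then show "y \<in> (\<lambda>z. (stake ?K \<xi> @ fst z, snd z)) ` ?Z" using z by (intro image_eqI[of _ _ "(drop ?K (fst y), snd y)"]) simp_all
    qed
    then have "card {y \<in> D n. near \<gamma> \<epsilon> n (y :: 'a letter list \<times> 'r) \<xi>} \<le> card ?Z"
      using surj_card_le[OF Z] by blast
    then show ?thesis using card_words_times_colours[of k] by (rule order_trans)
  qed
  ultimately show ?thesis by blast
qed

text \<open>
  The length of the walk grows at rate \<open>\<gamma>\<close>.  Hence after time \<open>n\<close> the walk is always longer than
  \<open>(\<gamma> - \<epsilon>) n\<close>, and can never again alter its prefix of that length, which is therefore already the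
  prefix of the limit.
\<close>

lemma AE_near:
  assumes drift: "is_drift GP (generators d m Gs) M Y \<gamma>" and \<epsilon>: "0 < \<epsilon>"
  shows "AE \<omega> in M u. \<forall>\<^sub>F n in sequentially. near \<gamma> \<epsilon> n (Y n \<omega>) (Yinf \<omega>)"
proof -
  have "AE \<omega> in M u. (\<lambda>n. real (word_length GP (generators d m Gs) (fst (Y n \<omega>))) / real n) \<longlonglongrightarrow> \<gamma>"
    using drift unfolding is_drift_def tendsto_as_L1_def by blast
  then show ?thesis
    using AE_nb[of u] AE_limit[of u] AE_space
  proof eventually_elim
    case (elim \<omega>)
    have lim: "(\<lambda>n. real (length (fst (Y n \<omega>))) / real n) \<longlonglongrightarrow> \<gamma>"
      using elim(1) by (simp only: word_length_eq[OF Y_W[OF elim(4)]])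
    have "\<forall>\<^sub>F n in sequentially. dist (real (length (fst (Y n \<omega>))) / real n) \<gamma> < \<epsilon> / 2 \<and> 0 < n"
      using lim \<epsilon> by (intro eventually_conj tendstoD eventually_gt_at_top) auto
    then obtain N where N: "\<And>n. n \<ge> N \<Longrightarrow> dist (real (length (fst (Y n \<omega>))) / real n) \<gamma> < \<epsilon> / 2 \<and> 0 < n"
      by (auto simp: eventually_sequentially)
    have bounds: "real (length (fst (Y n \<omega>))) < (\<gamma> + \<epsilon> / 2) * real n"
      "(\<gamma> - \<epsilon> / 2) * real n < real (length (fst (Y n \<omega>)))" if "n \<ge> N" for n
    proof -
      have n0: "0 < real n" using N[OF that] by simp
      have "\<bar>real (length (fst (Y n \<omega>))) / real n - \<gamma>\<bar> < \<epsilon> / 2" using N[OF that] by (simp add: dist_real_def)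
      then have "real (length (fst (Y n \<omega>))) / real n < \<gamma> + \<epsilon> / 2" "\<gamma> - \<epsilon> / 2 < real (length (fst (Y n \<omega>))) / real n"
        by linarith+
      then show "real (length (fst (Y n \<omega>))) < (\<gamma> + \<epsilon> / 2) * real n"
        "(\<gamma> - \<epsilon> / 2) * real n < real (length (fst (Y n \<omega>)))"
        using n0 by (simp_all add: pos_divide_less_eq pos_less_divide_eq)
    qed
    have "near \<gamma> \<epsilon> n (Y n \<omega>) (Yinf \<omega>)" if n: "n \<ge> N" for n
    proof -
      let ?K = "nat \<lfloor>(\<gamma> - \<epsilon>) * real n\<rfloor>"
      have n0: "0 < real n" using N[OF n] by simp
      have "(\<gamma> + \<epsilon> / 2) * real n \<le> (\<gamma> + \<epsilon>) * real n" using \<epsilon> n0 by (intro mult_right_mono) auto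
      then have len: "real (length (fst (Y n \<omega>))) \<le> (\<gamma> + \<epsilon>) * real n" using bounds(1)[OF n] by linarith
      have step: "take ?K (fst (Y (Suc j) \<omega>)) = take ?K (fst (Y j \<omega>))" if j: "j \<ge> n" for j
      \<comment> \<open>A zero prefix length includes the case of a negative \<open>\<gamma> - \<epsilon>\<close>.\<close>
      proof (cases "?K = 0")
        case False
        then have g0: "0 < (\<gamma> - \<epsilon>) * real n" and K: "real ?K \<le> (\<gamma> - \<epsilon>) * real n" by linarith+
        have ge: "0 < \<gamma> - \<epsilon>" using g0 n0 by (simp add: zero_less_mult_iff)
        have "(\<gamma> - \<epsilon>) * real n \<le> (\<gamma> - \<epsilon> / 2) * real j"
          using ge \<epsilon> j by (intro mult_mono) auto
        also have "\<dots> < real (length (fst (Y j \<omega>)))" using bounds(2)[of j] j n by simp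
        finally have Kl: "?K < length (fst (Y j \<omega>))" using K by linarith
        have "Y (Suc j) \<omega> \<in> nb (Y j \<omega>)" using elim(2) by blast
        from nb_cases[OF this] obtain s w where s: "s \<in> L" "Y (Suc j) \<omega> = (foldr mu (fst (Y j \<omega>)) [s], w)"
          by blast
        show ?thesis unfolding s(2) fst_conv by (rule take_right_mult[OF Y_W[OF elim(4)] s(1) Kl])
      qed simp
      have "take ?K (fst (Y (n + j) \<omega>)) = take ?K (fst (Y n \<omega>))" for j
        by (induction j) (simp_all add: step)
      moreover obtain N' where "\<And>j. j \<ge> N' \<Longrightarrow> take ?K (fst (Y j \<omega>)) = stake ?K (Yinf \<omega>)"
        using elim(3)[unfolded words_tendsto_def, rule_format, of ?K] by (auto simp: eventually_sequentially)
      then have "take ?K (fst (Y (n + N') \<omega>)) = stake ?K (Yinf \<omega>)" by simp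
      ultimately show ?thesis unfolding near_def using len by simp
    qed
    then show ?case unfolding eventually_sequentially by blast
  qed
qed

text \<open>
  The limit of the walk determines its position at time \<open>n\<close> up to a subexponential number of choices
  with probability tending to one; the remaining states number exponentially many at most, so their
  contribution to the conditional entropy is of order \<open>n\<close> times a vanishing probability.
\<close>

lemma cond_entropy_tendsto:
  assumes drift: "is_drift GP (generators d m Gs) M Y \<gamma>"
  shows "(\<lambda>n. (walk_entropy n u - mean_info n u) / real n) \<longlonglongrightarrow> 0"
proof (rule order_tendstoI)
  fix a :: real assume "a < 0"
  have "0 \<le> (walk_entropy n u - mean_info n u) / real n" for n using mean_info_le_entropy[of n u] by simp
  then show "\<forall>\<^sub>F n in sequentially. a < (walk_entropy n u - mean_info n u) / real n"
    using \<open>a < 0\<close> by (intro always_eventually allI) (rule less_le_trans)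
next
  fix a :: real assume a: "0 < a"
  \<comment> \<open>The choice makes \<open>2 \<epsilon> growth\<close> at most \<open>a / 2\<close>; the added one avoids a division by zero.\<close>
  define \<epsilon> where "\<epsilon> = a / 4 / (growth + 1)"
  have C1: "0 < growth + 1" using growth_nonneg by simp
  then have \<epsilon>: "0 < \<epsilon>" using a by (simp add: \<epsilon>_def)
  have "growth + 1 \<noteq> 0" using C1 by simp
  then have "\<epsilon> * (growth + 1) = a / 4" unfolding \<epsilon>_def by (rule nonzero_eq_divide_eq[THEN iffD1, OF _ refl])
  then have \<epsilon>growth: "2 * \<epsilon> * growth < a" using \<epsilon> a by (simp add: algebra_simps)
  let ?bad = "\<lambda>n. measure (M u) {\<omega> \<in> space (M u). Y n \<omega> \<in> D n \<and> \<not> near \<gamma> \<epsilon> n (Y n \<omega>) (Yinf \<omega>)}"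
  have bad: "?bad \<longlonglongrightarrow> 0"
  proof -
    have fin: "finite_measure (M u)" using prob_M[of u] by (simp add: prob_space_def)
    have "?bad \<longlonglongrightarrow> measure (M u) {\<omega> \<in> space (M u). False}"
    proof (rule finite_measure.tendsto_measure_eventually_eq[OF fin])
      show "AE \<omega> in M u. \<forall>\<^sub>F n in sequentially. (Y n \<omega> \<in> D n \<and> \<not> near \<gamma> \<epsilon> n (Y n \<omega>) (Yinf \<omega>)) = False"
        using AE_near[OF drift \<epsilon>]
      proof eventually_elim
        case (elim \<omega>)
        then show ?case by eventually_elim simp
      qed
    qed (auto intro!: law_Y_Yinf_sum(1) near_sets)
    then show ?thesis by simp
  qed
  let ?R = "\<lambda>n. (ln (real colours) + growth + 2) / real n + 2 * \<epsilon> * growth + (ln (real colours) / real n + growth) * ?bad n"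
  have "?R \<longlonglongrightarrow> 0 + 2 * \<epsilon> * growth + (0 + growth) * 0"
    by (intro tendsto_add tendsto_mult tendsto_const lim_const_over_n bad)
  then have "\<forall>\<^sub>F n in sequentially. ?R n < a"
    using \<epsilon>growth by (intro order_tendstoD(2)) simp_all
  then show "\<forall>\<^sub>F n in sequentially. (walk_entropy n u - mean_info n u) / real n < a"
    using eventually_gt_at_top[of 0]
  proof eventually_elim
    case (elim n)
    obtain k where k: "real k \<le> 2 * \<epsilon> * real n + 1"
      "\<And>\<xi>. card {y \<in> D n. near \<gamma> \<epsilon> n (y :: 'a letter list \<times> 'r) \<xi>} \<le> colours * (card L + 1) ^ k"
      using card_near[OF \<epsilon>, of n \<gamma>] by blast
    have "walk_entropy n u - mean_info n u \<le> ln (real colours) + real k * growth + 2 + (ln (real colours) + real n * growth) * ?bad n"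
      by (rule entropy_le_mean_info[OF near_sets k(2)])
    also have "real k * growth \<le> (2 * \<epsilon> * real n + 1) * growth"
      using k(1) growth_nonneg by (rule mult_right_mono)
    finally have "(walk_entropy n u - mean_info n u) / real n \<le>
      (ln (real colours) + (2 * \<epsilon> * real n + 1) * growth + 2 + (ln (real colours) + real n * growth) * ?bad n) / real n"
      by (simp add: divide_right_mono)
    also have "\<dots> = ?R n" using elim(2) by (simp add: field_simps)
    finally show ?case using elim(1) by linarith
  qed
qed

end

context stationary_walk
begin

lemma entropy_tendsto:
  assumes "is_entropy GP p M Y h"
  shows "(\<lambda>n. walk_entropy n u / real n) \<longlonglongrightarrow> h"
proof -
  let ?Z = "\<lambda>n \<omega>. - (1 / real n) * ln (q n u (Y n \<omega>))"
  have one: "\<one>\<^bsub>GP\<^esub> = []" by (simp add: free_prod_def)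
  have "(\<lambda>n. \<integral>\<omega>. ?Z n \<omega> \<partial>M u) \<longlonglongrightarrow> h"
  proof (rule tendsto_as_L1_integral[OF prob_M])
    show "integrable (M u) (?Z n)" for n by (rule integral_Y(1))
    show "tendsto_as_L1 (M u) ?Z h"
      using assms unfolding is_entropy_def states_eq one q_def by blast
  qed
  moreover have "(\<integral>\<omega>. ?Z n \<omega> \<partial>M u) = walk_entropy n u / real n" for n
  proof -
    have "(\<integral>\<omega>. ?Z n \<omega> \<partial>M u) = (\<Sum>y\<in>D n. q n u y * (- (1 / real n) * ln (q n u y)))"
      by (rule integral_Y(2))
    also have "\<dots> = (\<Sum>y\<in>D n. q n u y * - ln (q n u y) / real n)"
      by (intro sum.cong refl) simp
    also have "\<dots> = walk_entropy n u / real n"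
      unfolding walk_entropy_def by (rule sum_divide_distrib[symmetric])
    finally show ?thesis .
  qed
  ultimately show ?thesis by (simp only:)
qed

text \<open>
  Entropy and mutual information with the limit have the same growth rate, and the rate of the latter
  is the mean information of a single step.
\<close>

theorem entropy_formula:
  assumes drift: "is_drift GP (generators d m Gs) M Y \<gamma>" and h: "is_entropy GP p M Y h"
  shows "h = - (\<Sum>\<^sub>\<infinity>g\<in>carrier GP. \<Sum>u\<in>UNIV. \<Sum>v\<in>UNIV. \<pi> $ u * p g $ u $ v *
     (\<integral>\<xi>. ln (enn2real (lebesgue_deriv (pinf v) (act_measure d m Gs (inv\<^bsub>GP\<^esub> g) (pinf u)) \<xi>)) \<partial>pinf v))"
proof -
  let ?h = "\<Sum>s\<in>L. \<Sum>u\<in>UNIV. \<Sum>v\<in>UNIV. \<pi> $ u * p [s] $ u $ v * info u ([s], v)"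
  have "(\<lambda>n. mean_info n u / real n) \<longlonglongrightarrow> h" for u
  proof -
    have "(\<lambda>n. walk_entropy n u / real n - (walk_entropy n u - mean_info n u) / real n) \<longlonglongrightarrow> h - 0"
      by (intro tendsto_diff entropy_tendsto[OF h] cond_entropy_tendsto[OF drift])
    then show ?thesis by (simp add: diff_divide_distrib)
  qed
  then have "(\<lambda>n. \<Sum>u\<in>UNIV. \<pi> $ u * (mean_info n u / real n)) \<longlonglongrightarrow> (\<Sum>u\<in>UNIV. \<pi> $ u * h)"
    by (intro tendsto_sum tendsto_mult_left)
  moreover have "(\<Sum>u\<in>UNIV. \<pi> $ u * h) = h" by (simp add: sum_distrib_right[symmetric] sum_pi)
  moreover have "(\<Sum>u\<in>UNIV. \<pi> $ u * (mean_info n u / real n)) = (\<Sum>u\<in>UNIV. \<pi> $ u * mean_info n u) / real n" for n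
    by (simp add: sum_divide_distrib)
  ultimately have "(\<lambda>n. (\<Sum>u\<in>UNIV. \<pi> $ u * mean_info n u) / real n) \<longlonglongrightarrow> h" by (simp only:)
  from LIMSEQ_unique[OF this mean_info_tendsto] have "h = ?h" .
  also have "?h = - (\<Sum>s\<in>L. \<Sum>u\<in>UNIV. \<Sum>v\<in>UNIV. \<pi> $ u * p [s] $ u $ v *
     (\<integral>\<xi>. ln (enn2real (lebesgue_deriv (pinf v) (act_measure d m Gs (inv\<^bsub>GP\<^esub> [s]) (pinf u)) \<xi>)) \<partial>pinf v))"
  proof -
    have "\<pi> $ u * p [s] $ u $ v * info u ([s], v) = - (\<pi> $ u * p [s] $ u $ v *
     (\<integral>\<xi>. ln (enn2real (lebesgue_deriv (pinf v) (act_measure d m Gs (inv\<^bsub>GP\<^esub> [s]) (pinf u)) \<xi>)) \<partial>pinf v))"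
      if s: "s \<in> L" for s u v
    proof (cases "p [s] $ u $ v = 0")
      case False
      then have "0 < p [s] $ u $ v" using p_nonneg[OF s, of u v] by simp
      from info_lebesgue_deriv[OF s this] show ?thesis by simp
    qed simp
    then show ?thesis by (simp only: sum_negf cong: sum.cong)
  qed
  also have "\<dots> = - (\<Sum>\<^sub>\<infinity>g\<in>carrier GP. \<Sum>u\<in>UNIV. \<Sum>v\<in>UNIV. \<pi> $ u * p g $ u $ v *
     (\<integral>\<xi>. ln (enn2real (lebesgue_deriv (pinf v) (act_measure d m Gs (inv\<^bsub>GP\<^esub> g) (pinf u)) \<xi>)) \<partial>pinf v))"
    by (subst infsum_letters) simp_all
  finally show ?thesis .
qed

end
theorem mainTheorem4:
  fixes d m :: nat
    and Gs :: "nat \<Rightarrow> 'a monoid"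
    and G :: "'a letter list monoid"
    and S :: "'a letter set"
    and p :: "'a letter list \<Rightarrow> real^'r^'r"
    and \<pi> :: "real^'r"
    and M :: "'r \<Rightarrow> 'w measure"
    and Y :: "nat \<Rightarrow> 'w \<Rightarrow> 'a letter list \<times> 'r"
    and Yinf :: "'w \<Rightarrow> 'a letter stream"
    and pinf :: "'r \<Rightarrow> 'a letter stream measure"
    and \<mu> :: "'a letter \<Rightarrow> 'r \<Rightarrow> 'r \<Rightarrow> real"
    and \<gamma> h :: real
  assumes factors: "\<And>j. j < m \<Longrightarrow> group (Gs j) \<and> finite (carrier (Gs j))"
    and G_def: "G = free_prod d m Gs"
    and S_def: "S = letters d m Gs"
    and not_Z: "\<not> G \<cong> integer_group"
    and not_D: "\<not> G \<cong> free_prod 0 2 (\<lambda>_. integer_mod_group 2)"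
    and family: "colour_family G p"
    and nearest_neighbour: "walk_support G p \<subseteq> generators d m Gs"
    and quasi_irreducible: "quasi_irreducible G p"
    and walk: "coloured_walk G p M Y"
    and limit: "is_boundary_limit d m Gs M Y Yinf"
    and pinf_def: "pinf = harmonic_measure d m Gs M Yinf"
    and \<mu>_def: "\<mu> = first_letter_prob M Y Yinf"
    and invariant: "invariant_prob (colour_matrix G p) \<pi>"
    and drift: "is_drift G (generators d m Gs) M Y \<gamma>"
    and entropy: "is_entropy G p M Y h"
  shows "\<gamma> = (\<Sum>g\<in>S. \<Sum>u\<in>UNIV. \<Sum>v\<in>UNIV. \<Sum>w\<in>UNIV.
           \<pi> $ u * p [g] $ u $ v *
             (- \<mu> (letter_inv Gs g) v w + (\<Sum>s\<in>next_letters d m Gs g. \<mu> s v w)))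
       \<and> h = - (\<Sum>\<^sub>\<infinity>g\<in>carrier G. \<Sum>u\<in>UNIV. \<Sum>v\<in>UNIV.
           \<pi> $ u * p g $ u $ v *
             (\<integral>\<xi>. ln (enn2real
                (lebesgue_deriv (pinf v) (act_measure d m Gs (inv\<^bsub>G\<^esub> g) (pinf u)) \<xi>)) \<partial>pinf v))"
proof -
  interpret stationary_walk d m Gs p M Y Yinf \<pi>
  proof (intro stationary_walk.intro boundary_walk.intro finite_free_product.intro free_product.intro
      finite_free_product_axioms.intro boundary_walk_axioms.intro stationary_walk_axioms.intro)
    show "group (Gs j)" if "j < m" for j using factors[OF that] by blast
    show "finite (carrier (Gs j))" if "j < m" for j using factors[OF that] by blast
    show "colour_family (free_prod d m Gs) p" using family unfolding G_def .
    show "walk_support (free_prod d m Gs) p \<subseteq> generators d m Gs" using nearest_neighbour unfolding G_def .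
    show "coloured_walk (free_prod d m Gs) p M Y" using walk unfolding G_def .
    show "is_boundary_limit d m Gs M Y Yinf" by (rule limit)
    show "invariant_prob (colour_matrix (free_prod d m Gs) p) \<pi>" using invariant unfolding G_def .
  qed
  show ?thesis
    using drift_formula[OF drift[unfolded G_def]] entropy_formula[OF drift[unfolded G_def] entropy[unfolded G_def]]
    unfolding G_def S_def pinf_def \<mu>_def by blast
qed

end
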